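(* Let $\alpha \in [1,3)$, and let $T_{2,\alpha,min}$ and $T_{4,\alpha,min}$ be the minimal operators in $L^2((0,1))$ associated with the differential expressions $$\tau_{2,\alpha} = -\frac{d^2}{dx^2} + \frac{\alpha^2 - (1/4)}{(1-x)^2}, \qquad x \in [0,1),$$ and $$\tau_{4,\alpha} = \tau_{2,\alpha}^2 = \frac{d^4}{dx^4} - \frac{d}{dx}\,\frac{2\alpha^2 - (1/2)}{(1-x)^2}\,\frac{d}{dx} + \frac{\alpha^4 - (13/2)\alpha^2 + (5/4)^2}{(1-x)^4}, \qquad x \in [0,1),$$ respectively. Then $$\operatorname{def}(T_{2,\alpha,min},0) = 1, \qquad \operatorname{def}\big(T_{2,\alpha,min}^2,0\big) = 2 = 2\operatorname{def}(T_{2,\alpha,min},0), \qquad \operatorname{def}(T_{4,\alpha,min},0) = 3.$$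
   Context: For a densely defined closed operator $T$ in a Hilbert space, $\operatorname{def}(T,0) = \dim\big((\operatorname{ran}(T))^{\perp}\big) = \dim(\ker(T^* ))$. The square $T_{2,\alpha,min}^2$ has its natural domain $\{f \in \operatorname{dom}(T_{2,\alpha,min}) \mid T_{2,\alpha,min}f \in \operatorname{dom}(T_{2,\alpha,min})\}$. The maximal operators act as $T_{2,\alpha,max}f = \tau_{2,\alpha}f$ on $\operatorname{dom}(T_{2,\alpha,max}) = \{g \in L^2((0,1)) \mid g, g' \in AC_{loc}([0,1)),\ \tau_{2,\alpha}g \in L^2((0,1))\}$ and $T_{4,\alpha,max}f = \tau_{4,\alpha}f$ on $\operatorname{dom}(T_{4,\alpha,max}) = \{g \in L^2((0,1)) \mid g,g',g'',g''' \in AC_{loc}([0,1)),\ \tau_{4,\alpha}g \in L^2((0,1))\}$. The minimal operators are $T_{2,\alpha,min} = T_{2,\alpha,max}^*$ and $T_{4,\alpha,min} = T_{4,\alpha,max}^*$, with $T_{2,\alpha,min}^* = T_{2,\alpha,max}$ and $T_{4,\alpha,min}^* = T_{4,\alpha,max}$. *)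

theory Defs
  imports "HOL-Analysis.Analysis"
begin

section \<open>The complex Hilbert space \<open>L\<^sup>2((0,1))\<close>\<close>

abbreviation M01 :: "real measure" where
  "M01 \<equiv> lebesgue_on {0<..<1}"

definition square_integrable :: "(real \<Rightarrow> complex) \<Rightarrow> bool" where
  "square_integrable f \<longleftrightarrow>
     f \<in> borel_measurable M01 \<and> integrable M01 (\<lambda>x. (cmod (f x))\<^sup>2)"

lemma square_integrable_zero: "square_integrable (\<lambda>x. 0)"
  by (simp add: square_integrable_def)

lemma square_integrable_scale:
  assumes "square_integrable f"
  shows "square_integrable (\<lambda>x. c * f x)"
  using assms by (auto simp: square_integrable_def norm_mult power_mult_distrib)

lemma square_integrable_add:
  assumes "square_integrable f" and "square_integrable g"
  shows "square_integrable (\<lambda>x. f x + g x)"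
proof -
  have m: "f \<in> borel_measurable M01" "g \<in> borel_measurable M01"
    using assms by (auto simp: square_integrable_def)
  have bound: "(cmod (f x + g x))\<^sup>2 \<le> 2 * (cmod (f x))\<^sup>2 + 2 * (cmod (g x))\<^sup>2" for x
  proof -
    have "(cmod (f x + g x))\<^sup>2 \<le> (cmod (f x) + cmod (g x))\<^sup>2"
      by (intro power_mono norm_triangle_ineq norm_ge_zero)
    also have "\<dots> \<le> 2 * (cmod (f x))\<^sup>2 + 2 * (cmod (g x))\<^sup>2"
      using sum_squares_bound[of "cmod (f x)" "cmod (g x)"] by (simp add: power2_sum)
    finally show ?thesis .
  qed
  have "integrable M01 (\<lambda>x. (cmod (f x + g x))\<^sup>2)"
  proof (rule Bochner_Integration.integrable_bound)
    show "integrable M01 (\<lambda>x. 2 * (cmod (f x))\<^sup>2 + 2 * (cmod (g x))\<^sup>2)"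
      using assms by (auto simp: square_integrable_def)
    show "(\<lambda>x. (cmod (f x + g x))\<^sup>2) \<in> borel_measurable M01"
      using m by measurable
    show "AE x in M01. norm ((cmod (f x + g x))\<^sup>2)
            \<le> norm (2 * (cmod (f x))\<^sup>2 + 2 * (cmod (g x))\<^sup>2)"
      using bound by simp
  qed
  moreover have "(\<lambda>x. f x + g x) \<in> borel_measurable M01"
    using m by measurable
  ultimately show ?thesis
    by (simp add: square_integrable_def)
qed

lemma square_integrable_minus:
  "square_integrable f \<Longrightarrow> square_integrable (\<lambda>x. - f x)"
  using square_integrable_scale[of f "-1"] by simp

definition L2_rel :: "(real \<Rightarrow> complex) \<Rightarrow> (real \<Rightarrow> complex) \<Rightarrow> bool" where
  "L2_rel f g \<longleftrightarrow> square_integrable f \<and> square_integrable g \<and> (AE x in M01. f x = g x)"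

lemma part_equivp_L2_rel: "part_equivp L2_rel"
proof (rule part_equivpI)
  show "\<exists>f. L2_rel f f"
    using square_integrable_zero by (auto simp: L2_rel_def)
  show "symp L2_rel"
    by (auto intro!: sympI simp: L2_rel_def eq_commute)
  show "transp L2_rel"
    unfolding L2_rel_def by (intro transpI) (auto elim: eventually_elim2)
qed

text \<open>For square integrable \<open>f\<close>, \<open>abs_L2 f\<close> is the class of \<open>f\<close>; on other functions
  \<open>abs_L2\<close> is unspecified.\<close>

quotient_type L2 = "real \<Rightarrow> complex" / partial: L2_rel
  by (rule part_equivp_L2_rel)

instantiation L2 :: ab_group_add
begin

lift_definition zero_L2 :: L2 is "\<lambda>x. 0"
  by (simp add: L2_rel_def square_integrable_zero)

lift_definition plus_L2 :: "L2 \<Rightarrow> L2 \<Rightarrow> L2" is "\<lambda>f g x. f x + g x"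
  by (auto simp: L2_rel_def intro!: square_integrable_add elim: eventually_elim2)

lift_definition uminus_L2 :: "L2 \<Rightarrow> L2" is "\<lambda>f x. - f x"
  by (auto simp: L2_rel_def intro!: square_integrable_minus)

definition minus_L2 :: "L2 \<Rightarrow> L2 \<Rightarrow> L2" where
  "minus_L2 f g = f + - g"

instance
proof
  fix a b c :: L2
  show "a + b + c = a + (b + c)"
    by transfer (auto simp: L2_rel_def algebra_simps intro!: square_integrable_add)
  show "a + b = b + a"
    by transfer (auto simp: L2_rel_def algebra_simps intro!: square_integrable_add)
  show "0 + a = a"
    by transfer (auto simp: L2_rel_def)
  show "- a + a = 0"
    by transfer (auto simp: L2_rel_def square_integrable_zero)
  show "a - b = a + - b"
    by (simp add: minus_L2_def)
qed

end

lift_definition scale_L2 :: "complex \<Rightarrow> L2 \<Rightarrow> L2" is "\<lambda>c f x. c * f x"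
  by (auto simp: L2_rel_def intro!: square_integrable_scale)

lift_definition inner_L2 :: "L2 \<Rightarrow> L2 \<Rightarrow> complex" is
  "\<lambda>f g. \<integral>x. f x * cnj (g x) \<partial>M01"
proof -
  have cnj: "cnj \<in> borel_measurable borel"
    by (intro borel_measurable_continuous_onI continuous_intros)
  fix f f' g g' assume "L2_rel f f'" and "L2_rel g g'"
  then have m: "f \<in> borel_measurable M01" "f' \<in> borel_measurable M01"
      "g \<in> borel_measurable M01" "g' \<in> borel_measurable M01"
    and ae: "AE x in M01. f x = f' x" "AE x in M01. g x = g' x"
    by (auto simp: L2_rel_def square_integrable_def)
  show "(\<integral>x. f x * cnj (g x) \<partial>M01) = (\<integral>x. f' x * cnj (g' x) \<partial>M01)"
  proof (rule integral_cong_AE)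
    show "(\<lambda>x. f x * cnj (g x)) \<in> borel_measurable M01"
      by (intro borel_measurable_times m measurable_compose[OF m(3) cnj])
    show "(\<lambda>x. f' x * cnj (g' x)) \<in> borel_measurable M01"
      by (intro borel_measurable_times m measurable_compose[OF m(4) cnj])
    show "AE x in M01. f x * cnj (g x) = f' x * cnj (g' x)"
      using ae by eventually_elim simp
  qed
qed

global_interpretation L2: vector_space scale_L2
proof
  fix a b :: complex and x y :: L2
  show "scale_L2 a (x + y) = scale_L2 a x + scale_L2 a y"
    by transfer (auto simp: L2_rel_def algebra_simps
        intro!: square_integrable_add square_integrable_scale)
  show "scale_L2 (a + b) x = scale_L2 a x + scale_L2 b x"
    by transfer (auto simp: L2_rel_def algebra_simps
        intro!: square_integrable_add square_integrable_scale)
  show "scale_L2 a (scale_L2 b x) = scale_L2 (a * b) x"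
    by transfer (auto simp: L2_rel_def mult.assoc
        intro!: square_integrable_scale[of _ "_ * _", simplified mult.assoc])
  show "scale_L2 1 x = x"
    by transfer (auto simp: L2_rel_def)
qed


section \<open>Operators as graphs\<close>

text \<open>An operator \<open>T\<close> with domain \<open>dom(T)\<close> is represented by its graph, the set of all pairs
  \<open>(f, T f)\<close> with \<open>f \<in> dom(T)\<close>.  So \<open>Domain T\<close> and \<open>Range T\<close> are its domain and range, and
  \<open>T O T\<close> is its square on the natural domain.\<close>

type_synonym L2_operator = "(L2 \<times> L2) set"

text \<open>This is again the graph of an operator whenever \<open>T\<close> is densely defined.\<close>

definition adjoint_L2 :: "L2_operator \<Rightarrow> L2_operator" where
  "adjoint_L2 T = {(g, h). \<forall>(f, Tf) \<in> T. inner_L2 Tf g = inner_L2 f h}"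

definition orth_complement_L2 :: "L2 set \<Rightarrow> L2 set" where
  "orth_complement_L2 S = {g. \<forall>f \<in> S. inner_L2 f g = 0}"

text \<open>The deficiency \<open>def(T,0)\<close>.  The complex dimension \<open>L2.dim\<close> is the number \<open>0\<close> on
  infinite-dimensional subspaces, so a positive value entails finite dimension.\<close>

definition deficiency0 :: "L2_operator \<Rightarrow> nat" where
  "deficiency0 T = L2.dim (orth_complement_L2 (Range T))"


section \<open>The differential expressions and their maximal and minimal operators\<close>

definition AC_on :: "real \<Rightarrow> real \<Rightarrow> (real \<Rightarrow> complex) \<Rightarrow> bool" where
  "AC_on a b f \<longleftrightarrow>
     (\<forall>\<epsilon>>0. \<exists>\<delta>>0. \<forall>P :: (real \<times> real) set.
        finite P \<and> (\<forall>(u, v) \<in> P. a \<le> u \<and> u \<le> v \<and> v \<le> b) \<and>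
        disjoint_family_on (\<lambda>(u, v). {u<..<v}) P \<and>
        (\<Sum>(u, v)\<in>P. v - u) < \<delta> \<longrightarrow>
        (\<Sum>(u, v)\<in>P. cmod (f v - f u)) < \<epsilon>)"

definition AC_loc :: "(real \<Rightarrow> complex) \<Rightarrow> bool" where
  "AC_loc f \<longleftrightarrow> (\<forall>a b. 0 \<le> a \<and> a \<le> b \<and> b < 1 \<longrightarrow> AC_on a b f)"

text \<open>The derivative on \<open>[0,1)\<close>, one-sided at \<open>0\<close>.  It is unspecified where \<open>f\<close> is not
  differentiable; for \<open>AC_loc f\<close> this is a null set.\<close>

definition D01 :: "(real \<Rightarrow> complex) \<Rightarrow> real \<Rightarrow> complex" where
  "D01 f x = vector_derivative f (at x within {0..<1})"

definition tau2 :: "real \<Rightarrow> (real \<Rightarrow> complex) \<Rightarrow> real \<Rightarrow> complex" where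
  "tau2 \<alpha> f x =
     - D01 (D01 f) x + complex_of_real ((\<alpha>\<^sup>2 - 1/4) / (1 - x)\<^sup>2) * f x"

definition tau4 :: "real \<Rightarrow> (real \<Rightarrow> complex) \<Rightarrow> real \<Rightarrow> complex" where
  "tau4 \<alpha> f x =
     D01 (D01 (D01 (D01 f))) x
     - D01 (\<lambda>y. complex_of_real ((2 * \<alpha>\<^sup>2 - 1/2) / (1 - y)\<^sup>2) * D01 f y) x
     + complex_of_real ((\<alpha> ^ 4 - 13/2 * \<alpha>\<^sup>2 + (5/4)\<^sup>2) / (1 - x) ^ 4) * f x"

definition T2max :: "real \<Rightarrow> L2_operator" where
  "T2max \<alpha> = {(abs_L2 f, abs_L2 (tau2 \<alpha> f)) | f.
     square_integrable f \<and> AC_loc f \<and> AC_loc (D01 f) \<and>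
     square_integrable (tau2 \<alpha> f)}"

definition T4max :: "real \<Rightarrow> L2_operator" where
  "T4max \<alpha> = {(abs_L2 f, abs_L2 (tau4 \<alpha> f)) | f.
     square_integrable f \<and> AC_loc f \<and> AC_loc (D01 f) \<and>
     AC_loc (D01 (D01 f)) \<and> AC_loc (D01 (D01 (D01 f))) \<and>
     square_integrable (tau4 \<alpha> f)}"

definition T2min :: "real \<Rightarrow> L2_operator" where
  "T2min \<alpha> = adjoint_L2 (T2max \<alpha>)"

definition T4min :: "real \<Rightarrow> L2_operator" where
  "T4min \<alpha> = adjoint_L2 (T4max \<alpha>)"

end

theory Submission
  imports Defs
begin

text \<open>Let \<open>u = (1 - x)^(1/2 + \<alpha>)\<close> and \<open>w = (1 - x)^(1/2 - \<alpha>)\<close>, the two solutions of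
  \<open>\<tau>\<^sub>2 f = 0\<close>, and choose \<open>u\<^sub>2\<close>, \<open>u\<^sub>3\<close> with \<open>\<tau>\<^sub>2 u\<^sub>2
  = u\<close> and \<open>\<tau>\<^sub>2 u\<^sub>3 = w\<close>. These four functions span the solutions of
  \<open>\<tau>\<^sub>4 f = 0\<close>. For \<open>1 \<le> \<alpha> < 3\<close> the functions \<open>u\<close>, \<open>u\<^sub>2\<close>,
  \<open>u\<^sub>3\<close> are square integrable and \<open>w\<close> is not. The orthogonal complement of the range
  is the span of \<open>u\<close> for the minimal operator \<open>T\<^sub>2\<close>, of \<open>u\<close> and \<open>u\<^sub>2\<close> for its
  square, and of \<open>u\<close>, \<open>u\<^sub>2\<close>, \<open>u\<^sub>3\<close> for \<open>T\<^sub>4\<close>, which gives the dimensions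
  1, 2 and 3.

  That these functions are orthogonal to the respective range follows at once, because minimal
  operators are adjoints of maximal ones (\<open>kernel_orthogonal_Range_adjoint\<close>,
  \<open>iterated_kernel_orthogonal_Range_adjoint_square\<close>).

  For the converse the ranges have to be large. Let \<open>H\<close> be a real continuous function that
  vanishes near \<open>1\<close>. Variation of constants (\<open>green_solution\<close>) yields the solution \<open>g\<close> of
  \<open>\<tau>\<^sub>2 g = H\<close> with \<open>g(0) = g'(0) = 0\<close>. If \<open>H\<close> is orthogonal to \<open>u\<close>, then \<open>g\<close> and
  \<open>g'\<close> decay so fast at \<open>1\<close> (\<open>green_decay\<close>) that the pair \<open>(g, H)\<close> belongs to the minimal
  operator (\<open>decaying_solution_in_T2min\<close>). If \<open>H\<close> is orthogonal to \<open>u\<^sub>2\<close> too, then \<open>g\<close>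
  is orthogonal to \<open>u\<close> and the step can be repeated. If \<open>H\<close> is orthogonal to all four
  functions, then \<open>g\<close> and the next solution vanish near \<open>1\<close>, and \<open>H\<close> is in the range of the
  minimal operator \<open>T\<^sub>4\<close> (\<open>test_function_in_Range_T4min\<close>). So an element orthogonal to
  the range annihilates all such \<open>H\<close> satisfying one, two or four moment conditions, and is
  therefore a linear combination of the functions that occur in these conditions
  (\<open>annihilator_eq_lincomb\<close>). In the fourth order case the coefficient of \<open>w\<close> is zero, as
  everything else is square integrable.

  The maximal operators are defined through derivatives of absolutely continuous functions, in
  the sense of \<open>\<epsilon>\<close> and \<open>\<delta>\<close>. All that is used about their elements is the
  Lagrange identity (\<open>weak_solution_Lagrange\<close>), which rests on the fundamental theorem of
  calculus for absolutely continuous functions (\<open>AC_on_has_integral\<close>). The latter needs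
  their almost everywhere differentiability, obtained by writing them locally as differences
  of monotone functions and applying Lebesgue's theorem; the proof of Lebesgue's theorem
  given here combines Vitali's covering lemma with Hahn decompositions.\<close>

section \<open>Almost everywhere differentiability of monotone functions\<close>

text \<open>Every point of the exceptional set has arbitrarily small balls \<open>B\<close> with \<open>|B| \<le> (2/c)
  \<nu>(B)\<close> lying in any prescribed neighbourhood of \<open>A\<close>. Vitali's covering lemma selects
  disjoint ones whose fivefold enlargements still cover, so the outer measure is at most
  \<open>(10/c) \<nu>(U)\<close> for each open \<open>U \<supseteq> A\<close>; by outer regularity of \<open>\<nu>\<close> this is
  as small as desired.\<close>

lemma negligible_large_density_on_null_set:
  fixes \<nu> :: "real measure"
  assumes fin: "finite_measure \<nu>" and sets: "sets \<nu> = sets borel"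
    and A: "A \<in> sets borel" "emeasure \<nu> A = 0" and c: "0 < c"
  shows "negligible {x \<in> A. \<forall>d>0. \<exists>r. 0 < r \<and> r < d \<and> c * r < measure \<nu> (cball x r)}"
    (is "negligible ?E")
  unfolding negligible_outer_le
proof (intro allI impI)
  interpret \<nu>: finite_measure \<nu> by fact
  fix e :: real assume e: "0 < e"
  have sp: "space \<nu> = UNIV" using sets_eq_imp_space_eq[OF sets] by simp
  have "emeasure \<nu> A = (INF U \<in> {U. A \<subseteq> U \<and> open U}. emeasure \<nu> U)"
    using outer_regular[OF sets _ A(1)] \<nu>.emeasure_finite by simp
  then have "(INF U \<in> {U. A \<subseteq> U \<and> open U}. emeasure \<nu> U) < ennreal (c * e / 10)"
    using A(2) c e by (simp del: ennreal_eq_0_iff)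
  then obtain U where U: "A \<subseteq> U" "open U" "emeasure \<nu> U < ennreal (c * e / 10)"
    by (auto simp: INF_less_iff)
  then have mU: "measure \<nu> U < c * e / 10"
    using c e by (simp add: \<nu>.emeasure_eq_measure ennreal_less_iff)
  \<comment> \<open>Balls are indexed by centre and radius, so that one centre may carry many balls.\<close>
  define K where "K = {(x, r). x \<in> A \<and> 0 < r \<and> r \<le> 1 \<and> cball x r \<subseteq> U \<and> c * r < measure \<nu> (cball x r)}"
  have cov: "?E \<subseteq> (\<Union>i\<in>K. cball (fst i) (snd i))"
  proof
    fix x assume x: "x \<in> ?E"
    then obtain d where d: "d > 0" "cball x d \<subseteq> U"
      using U open_contains_cball by blast
    obtain r where r: "0 < r" "r < min d 1" "c * r < measure \<nu> (cball x r)"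
      using x d(1) by (auto dest!: spec[of _ "min d 1"])
    then have "(x, r) \<in> K" using x d by (auto simp: K_def)
    then show "x \<in> (\<Union>i\<in>K. cball (fst i) (snd i))" using r(1) by force
  qed
  obtain C where C: "countable C" "C \<subseteq> K"
     "pairwise (\<lambda>i j. disjnt (cball (fst i) (snd i)) (cball (fst j) (snd j))) C"
     "?E \<subseteq> (\<Union>i\<in>C. cball (fst i) (5 * snd i))"
  proof (rule Vitali_covering_lemma_cballs[OF cov, of 1])
    show "0 < snd i \<and> snd i \<le> 1" if "i \<in> K" for i
      using that by (auto simp: K_def)
  qed
  have fin_bound: "measure lebesgue (\<Union>i\<in>F. cball (fst i) (5 * snd i)) \<le> e"
    if F: "F \<subseteq> C" "finite F" for F
  proof -
    have "measure lebesgue (\<Union>i\<in>F. cball (fst i) (5 * snd i))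
        \<le> (\<Sum>i\<in>F. measure lebesgue (cball (fst i) (5 * snd i)))"
      using F by (intro measure_UNION_le) auto
    also have "\<dots> = (\<Sum>i\<in>F. 10 * snd i)"
    proof (rule sum.cong)
      fix i assume "i \<in> F"
      then have "0 < snd i" using F C by (auto simp: K_def)
      then show "measure lebesgue (cball (fst i) (5 * snd i)) = 10 * snd i"
        by (simp add: cball_eq_atLeastAtMost)
    qed simp
    also have "\<dots> \<le> (\<Sum>i\<in>F. 10 / c * measure \<nu> (cball (fst i) (snd i)))"
    proof (rule sum_mono)
      fix i assume "i \<in> F"
      then have "c * snd i < measure \<nu> (cball (fst i) (snd i))" using F C by (auto simp: K_def)
      then show "10 * snd i \<le> 10 / c * measure \<nu> (cball (fst i) (snd i))"
        using c by (simp add: field_simps)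
    qed
    also have "\<dots> = 10 / c * measure \<nu> (\<Union>i\<in>F. cball (fst i) (snd i))"
    proof -
      have "disjoint_family_on (\<lambda>i. cball (fst i) (snd i)) F"
        using C(3) F unfolding pairwise_def disjoint_family_on_def disjnt_def by blast
      then have "measure \<nu> (\<Union>i\<in>F. cball (fst i) (snd i)) = (\<Sum>i\<in>F. measure \<nu> (cball (fst i) (snd i)))"
        using F(2) by (intro \<nu>.finite_measure_finite_Union) (simp_all add: sets image_subset_iff)
      then show ?thesis by (simp add: sum_distrib_left)
    qed
    also have "\<dots> \<le> 10 / c * measure \<nu> U"
    proof -
      have "(\<Union>i\<in>F. cball (fst i) (snd i)) \<subseteq> U" using F C by (force simp: K_def)
      moreover have "U \<in> sets \<nu>" using U(2) by (simp add: sets)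
      ultimately show ?thesis
        using c by (intro mult_left_mono \<nu>.finite_measure_mono) auto
    qed
    also have "\<dots> \<le> e" using mU c by (simp add: field_simps)
    finally show ?thesis .
  qed
  have "(\<Union>i\<in>C. cball (fst i) (5 * snd i)) \<in> lmeasurable"
    using C(1) lmeasurable_cball fin_bound by (rule fmeasurable_UN_bound)
  moreover have "measure lebesgue (\<Union>i\<in>C. cball (fst i) (5 * snd i)) \<le> e"
    using C(1) lmeasurable_cball fin_bound by (rule measure_UN_bound)
  ultimately show "\<exists>T. ?E \<subseteq> T \<and> T \<in> lmeasurable \<and> measure lebesgue T \<le> e"
    using C(4) by blast
qed

text \<open>The closed segment between \<open>x\<close> and \<open>x + h\<close> serves both signs of \<open>h\<close> at once, so that the
  two-sided limit at \<open>0\<close> is later literally a limit of difference quotients.\<close>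

lemma AE_density_zero_on_null_set:
  fixes \<nu> :: "real measure"
  assumes fin: "finite_measure \<nu>" and sets: "sets \<nu> = sets borel"
    and A: "A \<in> sets borel" "emeasure \<nu> A = 0"
  shows "AE x in lebesgue. x \<in> A \<longrightarrow>
           ((\<lambda>h. measure \<nu> (closed_segment x (x + h)) / \<bar>h\<bar>) \<longlongrightarrow> 0) (at 0)"
proof -
  interpret \<nu>: finite_measure \<nu> by fact
  define N where "N = (\<lambda>n::nat. {x \<in> A. \<forall>d>0. \<exists>r. 0 < r \<and> r < d \<and> 
     inverse (real (Suc n)) * r < measure \<nu> (cball x r)})"
  have "negligible (N n)" for n
    unfolding N_def by (rule negligible_large_density_on_null_set[OF fin sets A]) simp
  then have null: "negligible (\<Union>n. N n)"
    by (intro negligible_Union_nat) auto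
  have conv: "((\<lambda>h. measure \<nu> (closed_segment x (x + h)) / \<bar>h\<bar>) \<longlongrightarrow> 0) (at 0)"
    if x: "x \<in> A" "x \<notin> (\<Union>n. N n)" for x
  proof (rule tendstoI)
    fix e :: real assume "0 < e"
    then obtain n where n: "inverse (real (Suc n)) < e" using reals_Archimedean by blast
    have "x \<notin> N n" using x by blast
    then obtain d where d: "d > 0" "\<And>r. 0 < r \<Longrightarrow> r < d \<Longrightarrow> 
       measure \<nu> (cball x r) \<le> inverse (real (Suc n)) * r"
      using x(1) unfolding N_def mem_Collect_eq by (meson not_less)
    have "dist (measure \<nu> (closed_segment x (x + h)) / \<bar>h\<bar>) 0 < e"
      if h: "h \<noteq> 0" "\<bar>h\<bar> < d" for h
    proof -
      have "closed_segment x (x + h) \<subseteq> cball x \<bar>h\<bar>"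
        by (auto simp: closed_segment_eq_real_ivl dist_real_def split: if_splits)
      then have "measure \<nu> (closed_segment x (x + h)) \<le> measure \<nu> (cball x \<bar>h\<bar>)"
        by (intro \<nu>.finite_measure_mono) (simp_all add: sets)
      also have "\<dots> \<le> inverse (real (Suc n)) * \<bar>h\<bar>" using d(2)[of "\<bar>h\<bar>"] h by simp
      also have "\<dots> < e * \<bar>h\<bar>" using n h by (intro mult_strict_right_mono) auto
      finally show ?thesis using h by (simp add: divide_less_eq)
    qed
    then show "\<forall>\<^sub>F h in at 0. dist (measure \<nu> (closed_segment x (x + h)) / \<bar>h\<bar>) 0 < e"
      unfolding eventually_at by (intro exI[of _ d]) (use d(1) in \<open>simp add: dist_real_def\<close>)
  qed
  show ?thesis
    by (rule AE_I'[where N="\<Union>n. N n"]) (use null conv in \<open>auto simp: negligible_iff_null_sets\<close>)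
qed

text \<open>\<open>Y\<close> is the part of a Hahn decomposition of \<open>\<mu> - q |\<cdot>|\<close> where this signed measure
  is negative. Splitting a small interval along \<open>Y\<close>, the piece on which the wanted estimate
  may fail is measured by a measure that vanishes on the side containing \<open>x\<close>, and so has
  density \<open>0\<close> at almost every such \<open>x\<close>. The bound on the measure of the complement of \<open>Y\<close>
  serves to exclude infinite density.\<close>

lemma density_threshold:
  fixes \<mu> :: "real measure"
  assumes fin: "finite_measure \<mu>" and sets: "sets \<mu> = sets borel" and q: "0 \<le> q" and ab: "a < b"
  obtains Y where "Y \<in> sets borel"
    "ennreal q * emeasure lborel ({a..b} - Y) \<le> emeasure \<mu> UNIV"
    "AE x in lebesgue. x \<in> {a<..<b} \<inter> Y \<longrightarrow>
        (\<forall>c>0. \<forall>\<^sub>F h in at 0. measure \<mu> (closed_segment x (x + h)) / \<bar>h\<bar> \<le> q + c)"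
    "AE x in lebesgue. x \<in> {a<..<b} - Y \<longrightarrow>
        (\<forall>c>0. \<forall>\<^sub>F h in at 0. q - c \<le> measure \<mu> (closed_segment x (x + h)) / \<bar>h\<bar>)"
proof -
  interpret \<mu>: finite_measure \<mu> by fact
  have sp: "space \<mu> = UNIV" using sets_eq_imp_space_eq[OF sets] by simp
  define \<kappa> where "\<kappa> = density lborel (\<lambda>x. ennreal q * indicator {a..b} x)"
  have s\<kappa>: "sets \<kappa> = sets borel" by (simp add: \<kappa>_def)
  have \<kappa>: "emeasure \<kappa> X = ennreal q * emeasure lborel ({a..b} \<inter> X)" if "X \<in> sets borel" for X
    using that unfolding \<kappa>_def
    by (subst emeasure_density)
       (auto simp: mult.assoc nn_integral_cmult indicator_inter_arith[symmetric]
             simp del: nn_integral_indicator intro!: arg_cong2[where f="(*)"] nn_integral_indicator)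
  have fin\<kappa>: "finite_measure \<kappa>"
    using \<kappa>[of UNIV] ab by (intro finite_measureI) (simp_all add: \<kappa>_def ennreal_mult_eq_top_iff)
  interpret \<kappa>: finite_measure \<kappa> by fact
  obtain Y where Y: "Y \<in> sets borel"
     "\<And>X. X \<in> sets borel \<Longrightarrow> X \<subseteq> Y \<Longrightarrow> emeasure \<mu> X \<le> emeasure \<kappa> X"
     "\<And>X. X \<in> sets borel \<Longrightarrow> X \<inter> Y = {} \<Longrightarrow> emeasure \<kappa> X \<le> emeasure \<mu> X"
    using finite_unsigned_Hahn_decomposition[OF fin\<kappa> fin] by (auto simp: sets s\<kappa>)
  have restr: "finite_measure (density M (indicator Z)) \<and> sets (density M (indicator Z)) = sets borel \<and>
      (\<forall>X\<in>sets borel. measure (density M (indicator Z)) X = measure M (X \<inter> Z))"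
    if "finite_measure M" "sets M = sets borel" "Z \<in> sets borel" for M and Z :: "real set"
  proof -
    interpret M: finite_measure M by fact
    have e: "emeasure (density M (indicator Z)) X = emeasure M (X \<inter> Z)" if "X \<in> sets borel" for X
      using that \<open>sets M = sets borel\<close> \<open>Z \<in> sets borel\<close>
      by (subst emeasure_density) (auto simp: indicator_inter_arith[symmetric] Int_commute)
    have "space M = UNIV" using sets_eq_imp_space_eq[OF that(2)] by simp
    then show ?thesis
      using e e[of UNIV] that(2) by (auto intro!: finite_measureI simp: measure_def)
  qed
  \<comment> \<open>Restrictions to the complement of \<open>Y\<close> and to \<open>Y\<close>: each is null on the side where it is
    used.\<close>
  define \<nu>1 where "\<nu>1 = density \<mu> (indicator (- Y))"
  define \<nu>2 where "\<nu>2 = density \<kappa> (indicator Y)"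
  have nu1: "finite_measure \<nu>1" "sets \<nu>1 = sets borel" "\<And>X. X \<in> sets borel \<Longrightarrow> measure \<nu>1 X = measure \<mu> (X - Y)"
    using restr[OF fin sets, of "- Y"] Y(1) by (auto simp: \<nu>1_def Diff_eq)
  have nu2: "finite_measure \<nu>2" "sets \<nu>2 = sets borel" "\<And>X. X \<in> sets borel \<Longrightarrow> measure \<nu>2 X = measure \<kappa> (X \<inter> Y)"
    using restr[OF fin\<kappa> s\<kappa>, of "Y"] Y(1) by (auto simp: \<nu>2_def)
  interpret nu1: finite_measure \<nu>1 by fact
  interpret nu2: finite_measure \<nu>2 by fact
  have seg: "closed_segment x (x + h) \<in> sets borel" for x h :: real by simp
  have m\<kappa>: "measure \<kappa> (closed_segment x (x + h)) \<le> q * \<bar>h\<bar>"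
      "closed_segment x (x + h) \<subseteq> {a..b} \<Longrightarrow> measure \<kappa> (closed_segment x (x + h)) = q * \<bar>h\<bar>" for x h
  proof -
    have len: "emeasure lborel (closed_segment x (x + h)) = ennreal \<bar>h\<bar>"
      by (auto simp: closed_segment_eq_real_ivl)
    have "emeasure \<kappa> (closed_segment x (x + h)) \<le> ennreal q * ennreal \<bar>h\<bar>"
      unfolding \<kappa>[OF seg] len[symmetric] by (intro mult_left_mono emeasure_mono) auto
    then have "ennreal (measure \<kappa> (closed_segment x (x + h))) \<le> ennreal (q * \<bar>h\<bar>)"
      using q by (simp add: \<kappa>.emeasure_eq_measure ennreal_mult)
    then show "measure \<kappa> (closed_segment x (x + h)) \<le> q * \<bar>h\<bar>" using q by simp
    assume "closed_segment x (x + h) \<subseteq> {a..b}"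
    then have "{a..b} \<inter> closed_segment x (x + h) = closed_segment x (x + h)" by blast
    then have "emeasure \<kappa> (closed_segment x (x + h)) = ennreal (q * \<bar>h\<bar>)"
      using q \<kappa>[OF seg, of x h] len by (simp add: ennreal_mult)
    then show "measure \<kappa> (closed_segment x (x + h)) = q * \<bar>h\<bar>"
      using q by (simp add: measure_def)
  qed
  show ?thesis
  proof (rule that[OF Y(1)])
    have "ennreal q * emeasure lborel ({a..b} - Y) = emeasure \<kappa> (- Y)"
      using Y(1) by (subst \<kappa>) (auto simp: Diff_eq)
    also have "\<dots> \<le> emeasure \<mu> (- Y)" using Y by auto
    also have "\<dots> \<le> emeasure \<mu> UNIV" using sets by (intro emeasure_mono) (auto simp: Y(1))
    finally show "ennreal q * emeasure lborel ({a..b} - Y) \<le> emeasure \<mu> UNIV" .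
  next
    have "emeasure \<nu>1 Y = 0" using nu1(3)[OF Y(1)] by (simp add: nu1.emeasure_eq_measure)
    from AE_density_zero_on_null_set[OF nu1(1,2) Y(1) this]
    show "AE x in lebesgue. x \<in> {a<..<b} \<inter> Y \<longrightarrow>
        (\<forall>c>0. \<forall>\<^sub>F h in at 0. measure \<mu> (closed_segment x (x + h)) / \<bar>h\<bar> \<le> q + c)"
    proof (rule AE_mp, intro AE_I2 impI allI)
      fix x c :: real 
      assume x: "x \<in> Y \<longrightarrow> ((\<lambda>h. measure \<nu>1 (closed_segment x (x + h)) / \<bar>h\<bar>) \<longlongrightarrow> 0) (at 0)"
        "x \<in> {a<..<b} \<inter> Y" and c: "0 < c"
      then have "\<forall>\<^sub>F h in at 0. measure \<nu>1 (closed_segment x (x + h)) / \<bar>h\<bar> < c"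
        by (intro order_tendstoD) auto
      moreover have "\<forall>\<^sub>F h in at 0. h \<noteq> (0::real)" by (simp add: eventually_at_filter)
      ultimately show "\<forall>\<^sub>F h in at 0. measure \<mu> (closed_segment x (x + h)) / \<bar>h\<bar> \<le> q + c"
      proof eventually_elim
        fix h :: real assume h: "measure \<nu>1 (closed_segment x (x + h)) / \<bar>h\<bar> < c" "h \<noteq> 0"
        let ?I = "closed_segment x (x + h)"
        have "measure \<mu> ?I = measure \<mu> (?I \<inter> Y) + measure \<mu> (?I - Y)"
          using \<mu>.finite_measure_Union[of "?I \<inter> Y" "?I - Y"] Y(1) 
          by (simp add: sets Int_Diff_Un Int_Diff_disjoint)
        also have "measure \<mu> (?I \<inter> Y) \<le> measure \<kappa> (?I \<inter> Y)"
          using Y(2)[of "?I \<inter> Y"] Y(1) by (simp add: \<mu>.emeasure_eq_measure \<kappa>.emeasure_eq_measure)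
        also have "measure \<kappa> (?I \<inter> Y) \<le> measure \<kappa> ?I"
          by (intro \<kappa>.finite_measure_mono) (auto simp: s\<kappa>)
        also have "\<dots> \<le> q * \<bar>h\<bar>" by (rule m\<kappa>)
        also have "measure \<mu> (?I - Y) = measure \<nu>1 ?I" by (simp add: nu1(3))
        also have "measure \<nu>1 ?I \<le> c * \<bar>h\<bar>" using h by (simp add: divide_less_eq)
        finally show "measure \<mu> ?I / \<bar>h\<bar> \<le> q + c" using h(2) by (simp add: divide_le_eq ring_distribs)
      qed
    qed
  next
    have "emeasure \<nu>2 (- Y) = 0" using nu2(3)[of "- Y"] Y(1) by (simp add: nu2.emeasure_eq_measure)
    from AE_density_zero_on_null_set[OF nu2(1,2) _ this] Y(1)
    have "AE x in lebesgue. x \<in> - Y \<longrightarrow> ((\<lambda>h. measure \<nu>2 (closed_segment x (x + h)) / \<bar>h\<bar>) \<longlongrightarrow> 0) (at 0)"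
      by auto
    then show "AE x in lebesgue. x \<in> {a<..<b} - Y \<longrightarrow>
        (\<forall>c>0. \<forall>\<^sub>F h in at 0. q - c \<le> measure \<mu> (closed_segment x (x + h)) / \<bar>h\<bar>)"
    proof (rule AE_mp, intro AE_I2 impI allI)
      fix x c :: real 
      assume x: "x \<in> - Y \<longrightarrow> ((\<lambda>h. measure \<nu>2 (closed_segment x (x + h)) / \<bar>h\<bar>) \<longlongrightarrow> 0) (at 0)"
        "x \<in> {a<..<b} - Y" and c: "0 < c"
      then have "\<forall>\<^sub>F h in at 0. measure \<nu>2 (closed_segment x (x + h)) / \<bar>h\<bar> < c"
        by (intro order_tendstoD) auto
      moreover have "\<forall>\<^sub>F h in at 0. h \<noteq> (0::real)" by (simp add: eventually_at_filter)
      moreover have "\<forall>\<^sub>F h in at 0. closed_segment x (x + h) \<subseteq> {a..b}"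
        unfolding eventually_at
        by (rule exI[of _ "min (x - a) (b - x)"])
           (use x(2) in \<open>auto simp: closed_segment_eq_real_ivl dist_real_def split: if_splits\<close>)
      ultimately show "\<forall>\<^sub>F h in at 0. q - c \<le> measure \<mu> (closed_segment x (x + h)) / \<bar>h\<bar>"
      proof eventually_elim
        fix h :: real 
        let ?I = "closed_segment x (x + h)"
        assume h: "measure \<nu>2 ?I / \<bar>h\<bar> < c" "h \<noteq> 0" "?I \<subseteq> {a..b}"
        have "q * \<bar>h\<bar> = measure \<kappa> (?I \<inter> Y) + measure \<kappa> (?I - Y)"
          using \<kappa>.finite_measure_Union[of "?I \<inter> Y" "?I - Y"] Y(1) m\<kappa>(2)[OF h(3)]
          by (simp add: s\<kappa> Int_Diff_Un Int_Diff_disjoint)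
        also have "measure \<kappa> (?I - Y) \<le> measure \<mu> (?I - Y)"
          using Y(3)[of "?I - Y"] Y(1) by (simp add: \<mu>.emeasure_eq_measure \<kappa>.emeasure_eq_measure Diff_Int_distrib2)
        also have "measure \<mu> (?I - Y) \<le> measure \<mu> ?I"
          by (intro \<mu>.finite_measure_mono) (auto simp: sets)
        also have "measure \<kappa> (?I \<inter> Y) = measure \<nu>2 ?I" by (simp add: nu2(3))
        also have "measure \<nu>2 ?I \<le> c * \<bar>h\<bar>" using h by (simp add: divide_less_eq)
        finally show "q - c \<le> measure \<mu> ?I / \<bar>h\<bar>" using h(2) by (simp add: le_divide_eq ring_distribs)
      qed
    qed
  qed
qed

text \<open>Apply the threshold lemma to all rational \<open>q\<close>: off a null set, every \<open>q\<close> is an upper or a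
  lower bound for the density in the limit, which leaves no gap between limes inferior and
  limes superior. The limit is the infimum of the \<open>q\<close> of the first kind; there is one almost
  everywhere, for the set \<open>B\<close> of points without any satisfies \<open>q |B| \<le> \<mu>(\<real>) <
  \<infinity>\<close> for every \<open>q\<close>.\<close>

lemma AE_density_converges:
  fixes \<mu> :: "real measure"
  assumes fin: "finite_measure \<mu>" and sets: "sets \<mu> = sets borel" and ab: "a < b"
  shows "AE x in lebesgue. x \<in> {a<..<b} \<longrightarrow>
           (\<exists>L. ((\<lambda>h. measure \<mu> (closed_segment x (x + h)) / \<bar>h\<bar>) \<longlongrightarrow> L) (at 0))"
proof -
  interpret \<mu>: finite_measure \<mu> by fact
  let ?D = "\<lambda>x h. measure \<mu> (closed_segment x (x + h)) / \<bar>h\<bar>"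
  let ?up = "\<lambda>x q. \<forall>c>0. \<forall>\<^sub>F h in at 0. ?D x h \<le> q + c"
  let ?low = "\<lambda>x q. \<forall>c>0. \<forall>\<^sub>F h in at 0. q - c \<le> ?D x h"
  have "\<forall>q\<in>{0..}. \<exists>Y. Y \<in> sets borel \<and> ennreal q * emeasure lborel ({a..b} - Y) \<le> emeasure \<mu> UNIV \<and>
      (AE x in lebesgue. x \<in> {a<..<b} \<inter> Y \<longrightarrow> ?up x q) \<and> (AE x in lebesgue. x \<in> {a<..<b} - Y \<longrightarrow> ?low x q)"
    by (intro ballI) (rule density_threshold[OF fin sets _ ab], auto)
  from bchoice[OF this] obtain Y where Y: "\<And>q. 0 \<le> q \<Longrightarrow> Y q \<in> sets borel"
    "\<And>q. 0 \<le> q \<Longrightarrow> ennreal q * emeasure lborel ({a..b} - Y q) \<le> emeasure \<mu> UNIV"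
    "\<And>q. 0 \<le> q \<Longrightarrow> AE x in lebesgue. x \<in> {a<..<b} \<inter> Y q \<longrightarrow> ?up x q"
    "\<And>q. 0 \<le> q \<Longrightarrow> AE x in lebesgue. x \<in> {a<..<b} - Y q \<longrightarrow> ?low x q"
    by (auto simp only: atLeast_iff)
  define Q where "Q = {q\<in>\<rat>. 0 \<le> (q::real)}"
  have Q: "countable Q" unfolding Q_def by (rule countable_subset[OF _ countable_rat]) auto
  have AEQ: "AE x in lebesgue. \<forall>q\<in>Q. (x \<in> {a<..<b} \<inter> Y q \<longrightarrow> ?up x q) \<and> (x \<in> {a<..<b} - Y q \<longrightarrow> ?low x q)"
    unfolding AE_ball_countable[OF Q]
  proof
    fix q assume "q \<in> Q"
    then have "0 \<le> q" by (simp add: Q_def)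
    from Y(3,4)[OF this]
    show "AE x in lebesgue. (x \<in> {a<..<b} \<inter> Y q \<longrightarrow> ?up x q) \<and> (x \<in> {a<..<b} - Y q \<longrightarrow> ?low x q)"
      by eventually_elim blast
  qed
  define B where "B = {a..b} - (\<Union>n::nat. Y (real n))"
  have B: "B \<in> sets borel" unfolding B_def using Y(1) by auto
  have "emeasure lborel B = 0"
  proof (rule ccontr)
    assume nz: "emeasure lborel B \<noteq> 0"
    have bound: "of_nat n * emeasure lborel B \<le> emeasure \<mu> UNIV" for n :: nat
    proof -
      have "of_nat n * emeasure lborel B \<le> of_nat n * emeasure lborel ({a..b} - Y (real n))"
        unfolding B_def using Y(1) by (intro mult_left_mono emeasure_mono) auto
      also have "\<dots> \<le> emeasure \<mu> UNIV" using Y(2)[of "real n"] by (simp add: ennreal_of_nat_eq_real_of_nat)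
      finally show ?thesis .
    qed
    have "B \<subseteq> {a..b}" by (auto simp: B_def)
    then have fB: "emeasure lborel B < top"
      using emeasure_mono[of B "{a..b}" lborel] ab by (auto simp: top.not_eq_extremum intro: le_less_trans)
    then obtain \<beta> where \<beta>: "emeasure lborel B = ennreal \<beta>" "0 < \<beta>"
      using nz by (cases "emeasure lborel B") (auto simp: top.not_eq_extremum less_le)
    obtain m where m: "emeasure \<mu> UNIV = ennreal m" "0 \<le> m"
      by (metis \<mu>.emeasure_eq_measure measure_nonneg)
    obtain n :: nat where "m / \<beta> < real n" using reals_Archimedean2 by blast
    then have "m < real n * \<beta>" using \<beta> by (simp add: divide_less_eq)
    moreover have "ennreal (real n * \<beta>) \<le> ennreal m"
      using bound[of n] \<beta> m by (simp add: ennreal_of_nat_eq_real_of_nat ennreal_mult)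
    ultimately show False using m by simp
  qed
  then have "B \<in> null_sets lebesgue" using B by (simp add: null_sets_completionI null_setsI)
  then have AEB: "AE x in lebesgue. x \<notin> B" by (rule AE_not_in)
  from AEQ AEB show ?thesis
  proof eventually_elim
    case (elim x)
    show ?case
    proof
      assume x: "x \<in> {a<..<b}"
      define S where "S = {q\<in>Q. x \<in> Y q}"
      have up: "?up x q" if "q \<in> S" for q using elim(1) that x by (auto simp: S_def)
      have low: "?low x q" if "q \<in> Q" "q \<notin> S" for q using elim(1) that x by (auto simp: S_def)
      have bdd: "bdd_below S" by (rule bdd_belowI[of _ 0]) (auto simp: S_def Q_def)
      have ne: "S \<noteq> {}" 
      proof -
        obtain n where "x \<in> Y (real n)" using elim(2) x by (auto simp: B_def)
        then have "real n \<in> S" by (auto simp: S_def Q_def)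
        then show ?thesis by blast
      qed
      define L where "L = Inf S"
      have ev: "\<forall>\<^sub>F h in at 0. ?D x h < L + e \<and> L - e < ?D x h" if e: "0 < e" for e
      proof (rule eventually_conj)
        obtain q where q: "q \<in> S" "q < L + e / 2"
          using cInf_lessD[OF ne, of "L + e / 2"] e by (auto simp: L_def)
        have "\<forall>\<^sub>F h in at 0. ?D x h \<le> q + e / 2" using up[OF q(1)] e by simp
        then show "\<forall>\<^sub>F h in at 0. ?D x h < L + e"
          by (rule eventually_mono) (use q in linarith)
        show "\<forall>\<^sub>F h in at 0. L - e < ?D x h"
        proof (cases "L \<le> 0")
          case True
          have "0 \<le> ?D x h" for h by simp
          then show ?thesis
            using True e by (intro always_eventually allI) (smt (verit))
        next
          case False
          then obtain q where q: "q \<in> \<rat>" "max 0 (L - e / 2) < q" "q < L"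
            using Rats_dense_in_real[of "max 0 (L - e / 2)" L] e by auto
          then have "q \<notin> S" using cInf_lower[OF _ bdd] by (force simp: L_def)
          then have "\<forall>\<^sub>F h in at 0. q - e / 2 \<le> ?D x h" using low[of q] q e by (simp add: Q_def)
          then show ?thesis by (rule eventually_mono) (use q in linarith)
        qed
      qed
      have "(?D x \<longlongrightarrow> L) (at 0)"
      proof (rule tendstoI)
        fix e :: real assume "0 < e"
        from ev[OF this] show "\<forall>\<^sub>F h in at 0. dist (?D x h) L < e"
          by (rule eventually_mono) (auto simp: dist_real_def)
      qed
      then show "\<exists>L. (?D x \<longlongrightarrow> L) (at 0)" ..
    qed
  qed
qed

text \<open>Lebesgue's theorem: the difference quotients are the densities of the Stieltjes measure.\<close>

lemma mono_continuous_AE_differentiable: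
  fixes F :: "real \<Rightarrow> real"
  assumes mono: "mono F" and cont: "continuous_on UNIV F" and bdd: "\<And>x. \<bar>F x\<bar> \<le> B"
  shows "AE x in lebesgue. F differentiable at x"
proof -
  let ?\<mu> = "interval_measure F"
  have Icc: "emeasure ?\<mu> {a..b} = F b - F a" if "a \<le> b" for a b
    using that mono cont by (intro emeasure_interval_measure_Icc) (auto simp: mono_def)
  have "emeasure ?\<mu> UNIV = (SUP n::nat. emeasure ?\<mu> {- real n..real n})"
  proof -
    have "x \<in> (\<Union>n::nat. {- real n..real n})" for x :: real
    proof -
      obtain n :: nat where "\<bar>x\<bar> \<le> real n" using real_arch_simple by blast
      then have "x \<in> {- real n..real n}" by auto
      then show ?thesis by blast
    qed
    then have "(\<Union>n::nat. {- real n..real n}) = UNIV" by blast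
    then show ?thesis
      by (subst SUP_emeasure_incseq) (auto simp: incseq_def)
  qed
  also have "\<dots> \<le> ennreal (2 * B)"
  proof (rule SUP_least)
    fix n :: nat
    have "F (real n) - F (- real n) \<le> 2 * B" using bdd[of "real n"] bdd[of "- real n"] by linarith
    then show "emeasure ?\<mu> {- real n..real n} \<le> ennreal (2 * B)"
      by (subst Icc) (auto intro!: ennreal_leI)
  qed
  finally have fin: "finite_measure ?\<mu>"
    by (intro finite_measureI) (auto simp: top_unique)
  have D: "measure ?\<mu> (closed_segment x (x + h)) / \<bar>h\<bar> = (F (x + h) - F x) / h" for x h
  proof -
    have m: "measure ?\<mu> {a..b} = F b - F a" if "a \<le> b" for a b
      using Icc[OF that] monoD[OF mono that] by (simp add: measure_def)
    show ?thesis
      by (cases "0 \<le> h") (simp_all add: closed_segment_eq_real_ivl m divide_simps)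
  qed
  have "AE x in lebesgue. x \<in> {- real (Suc n)<..<real (Suc n)} \<longrightarrow> F differentiable at x" for n
    using AE_density_converges[OF fin, of "- real (Suc n)" "real (Suc n)"]
    by (auto simp: D real_differentiable_def DERIV_def elim!: eventually_mono)
  then have "AE x in lebesgue. \<forall>n. x \<in> {- real (Suc n)<..<real (Suc n)} \<longrightarrow> F differentiable at x"
    unfolding AE_all_countable by blast
  then show ?thesis
  proof (rule eventually_mono)
    fix x assume *: "\<forall>n. x \<in> {- real (Suc n)<..<real (Suc n)} \<longrightarrow> F differentiable at x"
    obtain n where "\<bar>x\<bar> < real n" using reals_Archimedean2 by blast
    then have "x \<in> {- real (Suc n)<..<real (Suc n)}" by auto
    then show "F differentiable at x" using * by blast
  qed
qed

section \<open>Absolutely continuous functions\<close>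

definition nonoverlapping :: "real \<Rightarrow> real \<Rightarrow> (real \<times> real) set \<Rightarrow> bool" where
  "nonoverlapping a b P \<longleftrightarrow> finite P \<and> (\<forall>(u, v)\<in>P. a \<le> u \<and> u \<le> v \<and> v \<le> b) \<and>
     disjoint_family_on (\<lambda>(u, v). {u<..<v}) P"

lemma AC_on_iff_nonoverlapping:
  "AC_on a b f \<longleftrightarrow> (\<forall>\<epsilon>>0. \<exists>\<delta>>0. \<forall>P. nonoverlapping a b P \<and> (\<Sum>(u, v)\<in>P. v - u) < \<delta> \<longrightarrow>
      (\<Sum>(u, v)\<in>P. cmod (f v - f u)) < \<epsilon>)"
  unfolding AC_on_def nonoverlapping_def by (simp only: conj_assoc)

lemma nonoverlapping_length_le:
  assumes P: "nonoverlapping a b P" and U: "U \<in> lmeasurable" "\<And>u v. (u, v) \<in> P \<Longrightarrow> {u<..<v} \<subseteq> U"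
  shows "(\<Sum>(u, v)\<in>P. v - u) \<le> measure lebesgue U"
proof -
  have "(\<Sum>(u, v)\<in>P. v - u) = (\<Sum>p\<in>P. measure lebesgue (case p of (u, v) \<Rightarrow> {u<..<v}))"
    using P by (intro sum.cong) (auto simp: nonoverlapping_def)
  also have "\<dots> = measure lebesgue (\<Union>p\<in>P. case p of (u, v) \<Rightarrow> {u<..<v})"
  proof (rule measure_finite_Union[symmetric])
    show "(\<lambda>p. case p of (u, v) \<Rightarrow> {u<..<v}) ` P \<subseteq> sets lebesgue" by (auto split: prod.splits)
  qed (use P in \<open>auto simp: nonoverlapping_def split: prod.splits\<close>)
  also have "\<dots> \<le> measure lebesgue U"
  proof (rule measure_mono_fmeasurable)
    show "(\<Union>p\<in>P. case p of (u, v) \<Rightarrow> {u<..<v}) \<subseteq> U" using U(2) by fastforce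
    show "(\<Union>p\<in>P. case p of (u, v) \<Rightarrow> {u<..<v}) \<in> sets lebesgue"
      using P by (intro sets.finite_UN) (auto simp: nonoverlapping_def split: prod.splits)
  qed (rule U)
  finally show ?thesis .
qed

lemma nonoverlapping_length_le_interval:
  assumes "nonoverlapping a b P" "a \<le> b"
  shows "(\<Sum>(u, v)\<in>P. v - u) \<le> b - a"
  using nonoverlapping_length_le[OF assms(1), of "{a..b}"] assms
  by (force simp: nonoverlapping_def)

text \<open>For clamping maps \<open>m\<close> (minimum or maximum with a fixed point). Clamping may identify several
  intervals, but only after collapsing them to a point, where the summands vanish; hence
  reindexing is harmless.\<close>

lemma nonoverlapping_image:
  fixes m :: "real \<Rightarrow> real" and F :: "real \<Rightarrow> 'a::ab_group_add"
  assumes P: "nonoverlapping a b P"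
    and m: "\<And>u v. a \<le> u \<Longrightarrow> u \<le> v \<Longrightarrow> v \<le> b \<Longrightarrow> a' \<le> m u \<and> m u \<le> m v \<and> m v \<le> b' \<and> {m u<..<m v} \<subseteq> {u<..<v}"
  shows "nonoverlapping a' b' (map_prod m m ` P)"
    and "(\<Sum>(u, v)\<in>map_prod m m ` P. F v - F u) = (\<Sum>(u, v)\<in>P. F (m v) - F (m u))"
proof -
  have sub: "{m u<..<m v} \<subseteq> {u<..<v}" "m u \<le> m v" if "(u, v) \<in> P" for u v
  proof -
    have "a \<le> u" "u \<le> v" "v \<le> b" using P that by (auto simp: nonoverlapping_def)
    from m[OF this] show "{m u<..<m v} \<subseteq> {u<..<v}" "m u \<le> m v" by blast+
  qed
  have disj: "{u<..<v} \<inter> {u'<..<v'} = {}" if "(u, v) \<in> P" "(u', v') \<in> P" "(u, v) \<noteq> (u', v')" for u v u' v'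
    using P that by (force simp: nonoverlapping_def disjoint_family_on_def)
  have "disjoint_family_on (\<lambda>(u, v). {u<..<v}) (map_prod m m ` P)"
    unfolding disjoint_family_on_def
  proof (intro ballI impI)
    fix p q assume "p \<in> map_prod m m ` P" "q \<in> map_prod m m ` P" "p \<noteq> q"
    then obtain u v u' v' where uv: "(u, v) \<in> P" "(u', v') \<in> P" "p = (m u, m v)" "q = (m u', m v')"
      by auto
    then have "(u, v) \<noteq> (u', v')" using \<open>p \<noteq> q\<close> by auto
    then have "{m u<..<m v} \<inter> {m u'<..<m v'} = {}"
      using disj[OF uv(1,2)] sub(1)[OF uv(1)] sub(1)[OF uv(2)] by blast
    then show "(case p of (u, v) \<Rightarrow> {u<..<v}) \<inter> (case q of (u, v) \<Rightarrow> {u<..<v}) = {}"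
      by (simp only: uv(3,4) prod.case)
  qed
  then show "nonoverlapping a' b' (map_prod m m ` P)"
    using P m by (fastforce simp: nonoverlapping_def)
  have "(\<Sum>p\<in>map_prod m m ` P. F (snd p) - F (fst p)) = (\<Sum>p\<in>P. F (snd (map_prod m m p)) - F (fst (map_prod m m p)))"
  proof (rule sum.reindex_nontrivial[unfolded o_def])
    show "finite P" using P by (simp add: nonoverlapping_def)
    fix p q assume pq: "p \<in> P" "q \<in> P" "p \<noteq> q" "map_prod m m p = map_prod m m q"
    obtain u v u' v' where e: "p = (u, v)" "q = (u', v')" by (cases p, cases q)
    have uv: "(u, v) \<in> P" "(u', v') \<in> P" "(u, v) \<noteq> (u', v')" and mm: "m u' = m u" "m v' = m v"
      using pq e by auto
    have "{m u<..<m v} \<subseteq> {u'<..<v'}" using sub(1)[OF uv(2)] by (simp only: mm)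
    with sub(1)[OF uv(1)] have "{m u<..<m v} \<subseteq> {u<..<v} \<inter> {u'<..<v'}" by (rule Int_greatest)
    then have "{m u<..<m v} = {}" by (simp only: disj[OF uv] subset_empty)
    then have "m u = m v" using sub(2)[of u v] pq e by simp
    then show "F (snd (map_prod m m p)) - F (fst (map_prod m m p)) = 0" using e by simp
  qed
  then show "(\<Sum>(u, v)\<in>map_prod m m ` P. F v - F u) = (\<Sum>(u, v)\<in>P. F (m v) - F (m u))"
    by (simp add: case_prod_beta)
qed

lemma AC_onD_pair:
  assumes "AC_on a b f" "0 < e"
  obtains d where "0 < d" "\<And>u v. a \<le> u \<Longrightarrow> u \<le> v \<Longrightarrow> v \<le> b \<Longrightarrow> v - u < d \<Longrightarrow> cmod (f v - f u) < e"
proof -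
  obtain d where d: "d > 0" "\<And>P. nonoverlapping a b P \<Longrightarrow> (\<Sum>(u, v)\<in>P. v - u) < d \<Longrightarrow> (\<Sum>(u, v)\<in>P. cmod (f v - f u)) < e"
    using assms unfolding AC_on_iff_nonoverlapping by meson
  have "cmod (f v - f u) < e" if "a \<le> u" "u \<le> v" "v \<le> b" "v - u < d" for u v
    using d(2)[of "{(u, v)}"] that by (simp add: nonoverlapping_def disjoint_family_on_def)
  then show ?thesis using that d(1) by blast
qed

lemma AC_on_imp_continuous_on:
  assumes "AC_on a b f"
  shows "continuous_on {a..b} f"
  unfolding continuous_on_iff
proof (intro ballI allI impI)
  fix x e :: real assume x: "x \<in> {a..b}" and e: "0 < e"
  obtain d where d: "0 < d" "\<And>u v. a \<le> u \<Longrightarrow> u \<le> v \<Longrightarrow> v \<le> b \<Longrightarrow> v - u < d \<Longrightarrow> cmod (f v - f u) < e"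
    using AC_onD_pair[OF assms e] by blast
  have "dist (f y) (f x) < e" if "y \<in> {a..b}" "dist y x < d" for y
    using d(2)[of x y] d(2)[of y x] x that
    by (cases "x \<le> y") (auto simp: dist_norm norm_minus_commute)
  then show "\<exists>d>0. \<forall>x'\<in>{a..b}. dist x' x < d \<longrightarrow> dist (f x') (f x) < e" using d(1) by blast
qed

text \<open>Source of all closure properties of absolute continuity used below.\<close>

lemma AC_on_dominated:
  assumes f: "AC_on a b f" and g: "AC_on a b g"
    and dom: "\<And>u v. a \<le> u \<Longrightarrow> u \<le> v \<Longrightarrow> v \<le> b \<Longrightarrow> cmod (h v - h u) \<le> B * (cmod (f v - f u) + cmod (g v - g u))"
  shows "AC_on a b h"
  unfolding AC_on_iff_nonoverlapping
proof (intro allI impI)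
  fix e :: real assume e: "0 < e"
  define C where "C = max B 1"
  have C: "C > 0" "B \<le> C" by (auto simp: C_def)
  then have e': "0 < e / (2 * C)" using e by simp
  obtain d1 where d1: "d1 > 0" "\<And>P. nonoverlapping a b P \<Longrightarrow> (\<Sum>(u, v)\<in>P. v - u) < d1 \<Longrightarrow> (\<Sum>(u, v)\<in>P. cmod (f v - f u)) < e / (2 * C)"
    using f e' unfolding AC_on_iff_nonoverlapping by meson
  obtain d2 where d2: "d2 > 0" "\<And>P. nonoverlapping a b P \<Longrightarrow> (\<Sum>(u, v)\<in>P. v - u) < d2 \<Longrightarrow> (\<Sum>(u, v)\<in>P. cmod (g v - g u)) < e / (2 * C)"
    using g e' unfolding AC_on_iff_nonoverlapping by meson
  have "(\<Sum>(u, v)\<in>P. cmod (h v - h u)) < e"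
    if P: "nonoverlapping a b P" "(\<Sum>(u, v)\<in>P. v - u) < min d1 d2" for P
  proof -
    have "(\<Sum>(u, v)\<in>P. cmod (h v - h u)) \<le> (\<Sum>(u, v)\<in>P. C * (cmod (f v - f u) + cmod (g v - g u)))"
    proof (intro sum_mono, clarify)
      fix u v assume "(u, v) \<in> P"
      then have "cmod (h v - h u) \<le> B * (cmod (f v - f u) + cmod (g v - g u))"
        using P by (intro dom) (auto simp: nonoverlapping_def)
      also have "\<dots> \<le> C * (cmod (f v - f u) + cmod (g v - g u))"
        using C by (intro mult_right_mono) auto
      finally show "cmod (h v - h u) \<le> C * (cmod (f v - f u) + cmod (g v - g u))" .
    qed
    also have "\<dots> = C * ((\<Sum>(u, v)\<in>P. cmod (f v - f u)) + (\<Sum>(u, v)\<in>P. cmod (g v - g u)))"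
      by (simp add: case_prod_beta sum.distrib flip: sum_distrib_left)
    also have "\<dots> < C * (e / (2 * C) + e / (2 * C))"
      using P C d1(2)[of P] d2(2)[of P] by (intro mult_strict_left_mono add_strict_mono) auto
    also have "\<dots> = e" using C by (simp add: field_simps)
    finally show ?thesis .
  qed
  then show "\<exists>\<delta>>0. \<forall>P. nonoverlapping a b P \<and> (\<Sum>(u, v)\<in>P. v - u) < \<delta> \<longrightarrow>
      (\<Sum>(u, v)\<in>P. cmod (h v - h u)) < e"
    using d1(1) d2(1) by (intro exI[of _ "min d1 d2"]) auto
qed

lemma AC_on_id: "AC_on a b (\<lambda>x. complex_of_real x)"
  unfolding AC_on_iff_nonoverlapping
proof (intro allI impI)
  fix e :: real assume "0 < e"
  have "(\<Sum>(u, v)\<in>P. cmod (complex_of_real v - complex_of_real u)) = (\<Sum>(u, v)\<in>P. v - u)"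
    if "nonoverlapping a b P" for P
    using that by (intro sum.cong) (auto simp: nonoverlapping_def simp flip: of_real_diff)
  then show "\<exists>\<delta>>0. \<forall>P. nonoverlapping a b P \<and> (\<Sum>(u, v)\<in>P. v - u) < \<delta> \<longrightarrow>
      (\<Sum>(u, v)\<in>P. cmod (complex_of_real v - complex_of_real u)) < e"
    using \<open>0 < e\<close> by auto
qed

lemma AC_on_lipschitz:
  assumes "\<And>u v. a \<le> u \<Longrightarrow> u \<le> v \<Longrightarrow> v \<le> b \<Longrightarrow> cmod (h v - h u) \<le> B * (v - u)"
  shows "AC_on a b h"
proof (rule AC_on_dominated[OF AC_on_id AC_on_id, where B="B / 2"])
  fix u v assume "a \<le> u" "u \<le> v" "v \<le> b"
  then show "cmod (h v - h u) \<le> B / 2 * (cmod (complex_of_real v - complex_of_real u) + cmod (complex_of_real v - complex_of_real u))"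
    using assms[of u v] by (simp add: algebra_simps flip: of_real_diff)
qed

lemma AC_on_add:
  assumes "AC_on a b f" "AC_on a b g"
  shows "AC_on a b (\<lambda>x. f x + g x)"
proof (rule AC_on_dominated[OF assms, where B=1])
  fix u v
  show "cmod (f v + g v - (f u + g u)) \<le> 1 * (cmod (f v - f u) + cmod (g v - g u))"
    using norm_triangle_ineq[of "f v - f u" "g v - g u"] by (simp add: algebra_simps)
qed

lemma AC_on_uminus: "AC_on a b f \<Longrightarrow> AC_on a b (\<lambda>x. - f x)"
  by (rule AC_on_dominated[where B=1 and f=f and g=f]) (auto simp: norm_minus_commute)

lemma AC_on_mult:
  assumes f: "AC_on a b f" and g: "AC_on a b g"
  shows "AC_on a b (\<lambda>x. f x * g x)"
proof -
  have "\<exists>B. \<forall>x\<in>{a..b}. cmod (k x) \<le> B" if "AC_on a b k" for k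
    using compact_imp_bounded[OF compact_continuous_image[OF AC_on_imp_continuous_on[OF that] compact_Icc]]
    by (auto simp: bounded_iff)
  from this[OF f] this[OF g] obtain A B where A: "\<And>x. x \<in> {a..b} \<Longrightarrow> cmod (f x) \<le> A"
    and B: "\<And>x. x \<in> {a..b} \<Longrightarrow> cmod (g x) \<le> B" by blast
  show ?thesis
  proof (rule AC_on_dominated[OF f g, where B="max A B"])
    fix u v assume uv: "a \<le> u" "u \<le> v" "v \<le> b"
    have "cmod (f v * g v - f u * g u) = cmod (g u * (f v - f u) + f v * (g v - g u))"
      by (simp add: algebra_simps)
    also have "\<dots> \<le> cmod (g u) * cmod (f v - f u) + cmod (f v) * cmod (g v - g u)"
      using norm_triangle_ineq by (simp flip: norm_mult)
    also have "\<dots> \<le> max A B * cmod (f v - f u) + max A B * cmod (g v - g u)"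
      using A[of v] B[of u] uv by (intro add_mono mult_right_mono) auto
    finally show "cmod (f v * g v - f u * g u) \<le> max A B * (cmod (f v - f u) + cmod (g v - g u))"
      by (simp add: ring_distribs)
  qed
qed

section \<open>Absolutely continuous functions are differentiable almost everywhere\<close>

definition positive_variation :: "(real \<Rightarrow> real) \<Rightarrow> real \<Rightarrow> real \<Rightarrow> real" where
  "positive_variation F c x = Sup ((\<lambda>P. \<Sum>(u, v)\<in>P. F v - F u) ` Collect (nonoverlapping c x))"

text \<open>On a sufficiently short interval the positive variation \<open>V\<close> is bounded by \<open>1\<close>. Both \<open>V\<close> and
  \<open>V - F\<close> are monotone, and \<open>V\<close> is continuous because cutting a family of intervals at \<open>x\<close>
  shows that \<open>V y - V x\<close> is bounded by the variation over \<open>[x, y]\<close>. So Lebesgue's theorem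
  applies to both, and \<open>F\<close> is their difference. As differentiability is a local property,
  short intervals suffice.\<close>

lemma AC_on_AE_differentiable_local:
  fixes F :: "real \<Rightarrow> real"
  assumes AC: "AC_on a b (\<lambda>x. complex_of_real (F x))" and cd: "a \<le> c" "c < d" "d \<le> b"
    and \<delta>: "d - c < \<delta>" "\<And>P. nonoverlapping a b P \<Longrightarrow> (\<Sum>(u, v)\<in>P. v - u) < \<delta> \<Longrightarrow> (\<Sum>(u, v)\<in>P. \<bar>F v - F u\<bar>) < 1"
  shows "AE x in lebesgue. x \<in> {c<..<d} \<longrightarrow> F differentiable at x"
proof -
  let ?S = "\<lambda>P. \<Sum>(u, v)\<in>P. F v - F u"
  define V where "V = positive_variation F c"
  have le_abs: "?S P \<le> (\<Sum>(u, v)\<in>P. \<bar>F v - F u\<bar>)" for P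
    by (intro sum_mono) auto
  have weaken: "nonoverlapping c' x' P" if "nonoverlapping c x P" "c' \<le> c" "x \<le> x'" for c x c' x' P
    using that by (force simp: nonoverlapping_def)
  have bound: "?S P < 1" if "nonoverlapping c x P" "x \<le> d" "c \<le> x" for P x
  proof -
    have "nonoverlapping a b P" using that(1) by (rule weaken) (use that cd in auto)
    moreover have "(\<Sum>(u, v)\<in>P. v - u) < \<delta>"
      using nonoverlapping_length_le_interval[OF that(1,3)] that \<delta>(1) by linarith
    ultimately show ?thesis using \<delta>(2) le_abs[of P] by fastforce
  qed
  have bdd: "bdd_above (?S ` Collect (nonoverlapping c x))" if "x \<le> d" "c \<le> x" for x
    by (rule bdd_aboveI[of _ 1]) (use bound[OF _ that] in \<open>auto intro: less_imp_le\<close>)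
  have empty: "{} \<in> Collect (nonoverlapping c x)" for x by (simp add: nonoverlapping_def disjoint_family_on_def)
  have upper: "?S P \<le> V x" if "nonoverlapping c x P" "x \<le> d" "c \<le> x" for P x
    unfolding V_def positive_variation_def using that by (intro cSUP_upper bdd) auto
  have least: "V x \<le> z" if "\<And>P. nonoverlapping c x P \<Longrightarrow> ?S P \<le> z" for x z
    unfolding V_def positive_variation_def using empty that by (intro cSUP_least) auto
  have V01: "0 \<le> V x" "V x \<le> 1" if "x \<le> d" "c \<le> x" for x
    using upper[of x "{}"] empty that least[of x 1] bound[OF _ that] by (auto intro: less_imp_le)
  have incr: "F y - F x \<le> V y - V x" if xy: "c \<le> x" "x \<le> y" "y \<le> d" for x y
  proof -
    have "V x \<le> V y - (F y - F x)"
    proof (rule least)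
      fix P assume P: "nonoverlapping c x P"
      show "?S P \<le> V y - (F y - F x)"
      proof (cases "x = y")
        case True
        then show ?thesis using upper[OF P] xy by simp
      next
        case False
        then have new: "(x, y) \<notin> P" using P xy by (auto simp: nonoverlapping_def)
        have "{u<..<v} \<inter> {x<..<y} = {}" if "(u, v) \<in> P" for u v
          using P that by (auto simp: nonoverlapping_def)
        then have "nonoverlapping c y (insert (x, y) P)"
          using P xy new by (auto simp: nonoverlapping_def disjoint_family_on_def Int_commute)
        from upper[OF this] have "?S (insert (x, y) P) \<le> V y" using xy by simp
        moreover have "?S (insert (x, y) P) = (F y - F x) + ?S P"
          using P new by (simp add: nonoverlapping_def)
        ultimately show ?thesis by simp
      qed
    qed
    then show ?thesis by simp
  qed
  have V_mono: "V x \<le> V y" if xy: "c \<le> x" "x \<le> y" "y \<le> d" for x y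
  proof (rule least)
    fix P assume P: "nonoverlapping c x P"
    show "?S P \<le> V y" using weaken[OF P order_refl xy(2)] xy by (intro upper) auto
  qed
  have V_cont: "\<exists>\<eta>>0. \<forall>x y. c \<le> x \<and> x \<le> y \<and> y \<le> d \<and> y - x < \<eta> \<longrightarrow> V y - V x \<le> e" if e: "0 < e" for e
  proof -
    obtain \<eta> where \<eta>: "\<eta> > 0" "\<And>P. nonoverlapping a b P \<Longrightarrow> (\<Sum>(u, v)\<in>P. v - u) < \<eta> \<Longrightarrow>
        (\<Sum>(u, v)\<in>P. cmod (complex_of_real (F v) - complex_of_real (F u))) < e"
      using AC e unfolding AC_on_iff_nonoverlapping by meson
    have "V y - V x \<le> e" if xy: "c \<le> x" "x \<le> y" "y \<le> d" "y - x < \<eta>" for x y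
    proof -
      have "V y \<le> V x + e"
      proof (rule least)
        fix P assume P: "nonoverlapping c y P"
        let ?L = "map_prod (\<lambda>t. min t x) (\<lambda>t. min t x) ` P" and ?R = "map_prod (\<lambda>t. max t x) (\<lambda>t. max t x) ` P"
        have L: "nonoverlapping c x ?L" "?S ?L = (\<Sum>(u, v)\<in>P. F (min v x) - F (min u x))"
          by (rule nonoverlapping_image[OF P, where m="\<lambda>t. min t x" and a'=c and b'=x]; use xy in auto)+
        have R: "nonoverlapping x y ?R" "?S ?R = (\<Sum>(u, v)\<in>P. F (max v x) - F (max u x))"
          by (rule nonoverlapping_image[OF P, where m="\<lambda>t. max t x" and a'=x and b'=y]; use xy in auto)+
        have "?S P = ?S ?L + ?S ?R"
          unfolding L(2) R(2) by (subst sum.distrib[symmetric], rule sum.cong) (auto simp: min_def max_def)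
        moreover have "?S ?L \<le> V x" using L xy by (intro upper) auto
        moreover have "?S ?R < e"
        proof -
          have "nonoverlapping a b ?R" using R(1) by (rule weaken) (use xy cd in auto)
          moreover have "(\<Sum>(u, v)\<in>?R. v - u) < \<eta>"
            using nonoverlapping_length_le_interval[OF R(1) xy(2)] xy(4) by linarith
          ultimately have "(\<Sum>(u, v)\<in>?R. cmod (complex_of_real (F v) - complex_of_real (F u))) < e"
            by (rule \<eta>(2))
          then show ?thesis using le_abs[of ?R] by (simp flip: of_real_diff)
        qed
        ultimately show "?S P \<le> V x + e" by simp
      qed
      then show ?thesis by simp
    qed
    then show ?thesis using \<eta>(1) by blast
  qed
  \<comment> \<open>Extend from \<open>[c, d]\<close> to the line by constants, as Lebesgue's theorem above is stated
    for functions on the line.\<close>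
  define m where "m = (\<lambda>x. max c (min d x))"
  have m: "c \<le> m x" "m x \<le> d" "x \<in> {c<..<d} \<Longrightarrow> m x = x" for x using cd by (auto simp: m_def)
  have m_mono: "m x \<le> m y" if "x \<le> y" for x y using that by (auto simp: m_def)
  have m_lip: "\<bar>m x - m y\<bar> \<le> \<bar>x - y\<bar>" for x y using cd by (auto simp: m_def)
  have contV: "continuous_on UNIV (\<lambda>x. V (m x))"
    unfolding continuous_on_iff
  proof (intro ballI allI impI)
    fix x e :: real assume "0 < e"
    then obtain \<eta> where \<eta>: "\<eta> > 0" "\<And>x y. c \<le> x \<Longrightarrow> x \<le> y \<Longrightarrow> y \<le> d \<Longrightarrow> y - x < \<eta> \<Longrightarrow> V y - V x \<le> e / 2"
      using V_cont[of "e / 2"] by auto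
    have "dist (V (m y)) (V (m x)) < e" if "dist y x < \<eta>" for y
    proof (cases "x \<le> y")
      case True
      then show ?thesis
        using \<eta>(2)[of "m x" "m y"] V_mono[of "m x" "m y"] m(1,2) m_mono[of x y] m_lip[of x y] that \<open>0 < e\<close>
        by (simp add: dist_real_def)
    next
      case False
      then show ?thesis
        using \<eta>(2)[of "m y" "m x"] V_mono[of "m y" "m x"] m(1,2) m_mono[of y x] m_lip[of x y] that \<open>0 < e\<close>
        by (simp add: dist_real_def)
    qed
    then show "\<exists>d>0. \<forall>x'\<in>UNIV. dist x' x < d \<longrightarrow> dist (V (m x')) (V (m x)) < e" using \<eta>(1) by blast
  qed
  have "continuous_on {a..b} F"
    using AC_on_imp_continuous_on[OF AC] by (simp add: continuous_on_of_real_o_iff)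
  then have contF: "continuous_on {c..d} F" by (rule continuous_on_subset) (use cd in auto)
  have contFm: "continuous_on UNIV (\<lambda>x. F (m x))"
  proof (rule continuous_on_compose2[OF contF])
    show "continuous_on UNIV m" unfolding m_def by (intro continuous_intros)
  qed (use m in auto)
  obtain B where B: "\<And>x. x \<in> {c..d} \<Longrightarrow> \<bar>F x\<bar> \<le> B"
    using compact_imp_bounded[OF compact_continuous_image[OF contF compact_Icc]]
    unfolding bounded_iff ball_simps real_norm_def by blast
  have "AE x in lebesgue. (\<lambda>x. V (m x)) differentiable at x"
    by (rule mono_continuous_AE_differentiable[of _ 1])
       (use contV V01 m V_mono m_mono in \<open>auto simp: mono_def\<close>)
  moreover have "AE x in lebesgue. (\<lambda>x. V (m x) - F (m x)) differentiable at x"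
  proof (rule mono_continuous_AE_differentiable[of _ "1 + B"])
    show "mono (\<lambda>x. V (m x) - F (m x))"
    proof (rule monoI)
      fix x y :: real assume "x \<le> y"
      then show "V (m x) - F (m x) \<le> V (m y) - F (m y)"
        using incr[of "m x" "m y"] m m_mono[of x y] by simp
    qed
    show "continuous_on UNIV (\<lambda>x. V (m x) - F (m x))" by (intro continuous_intros contV contFm)
    show "\<bar>V (m x) - F (m x)\<bar> \<le> 1 + B" for x
      using B[of "m x"] V01[of "m x"] m[of x] by auto
  qed
  ultimately show ?thesis
  proof eventually_elim
    case (elim x)
    then have "(\<lambda>x. V (m x) - (V (m x) - F (m x))) differentiable at x"
      by (rule differentiable_diff)
    then have D: "(\<lambda>x. F (m x)) differentiable at x" by simp
    show ?case
    proof
      assume x: "x \<in> {c<..<d}"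
      obtain D where "((\<lambda>x. F (m x)) has_real_derivative D) (at x)"
        using D by (auto simp: real_differentiable_def)
      then have "(F has_real_derivative D) (at x)"
        by (rule has_field_derivative_transform_within_open[where S="{c<..<d}"]) (use x m in auto)
      then show "F differentiable at x" by (auto simp: real_differentiable_def)
    qed
  qed
qed

lemma AC_on_AE_differentiable_real:
  fixes F :: "real \<Rightarrow> real"
  assumes AC: "AC_on a b (\<lambda>x. complex_of_real (F x))"
  shows "AE x in lebesgue. x \<in> {a<..<b} \<longrightarrow> F differentiable at x"
proof -
  obtain \<delta> where \<delta>: "\<delta> > 0" "\<And>P. nonoverlapping a b P \<Longrightarrow> (\<Sum>(u, v)\<in>P. v - u) < \<delta> \<Longrightarrow> (\<Sum>(u, v)\<in>P. \<bar>F v - F u\<bar>) < 1"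
    using AC unfolding AC_on_iff_nonoverlapping by (auto simp flip: of_real_diff dest!: spec[of _ 1])
  define Q where "Q = {(c, d). c \<in> \<rat> \<and> d \<in> \<rat> \<and> a \<le> c \<and> c < d \<and> d \<le> b \<and> d - c < \<delta>}"
  have "Q \<subseteq> \<rat> \<times> \<rat>" by (auto simp: Q_def)
  then have Q: "countable Q" by (rule countable_subset) (auto intro: countable_rat)
  have "AE x in lebesgue. \<forall>p\<in>Q. x \<in> {fst p<..<snd p} \<longrightarrow> F differentiable at x"
    unfolding AE_ball_countable[OF Q]
  proof
    fix p assume "p \<in> Q"
    then show "AE x in lebesgue. x \<in> {fst p<..<snd p} \<longrightarrow> F differentiable at x"
      by (intro AC_on_AE_differentiable_local[OF AC _ _ _ _ \<delta>(2)]) (auto simp: Q_def)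
  qed
  then show ?thesis
  proof (rule eventually_mono, intro impI)
    fix x assume *: "\<forall>p\<in>Q. x \<in> {fst p<..<snd p} \<longrightarrow> F differentiable at x" and x: "x \<in> {a<..<b}"
    obtain c where c: "c \<in> \<rat>" "max a (x - \<delta> / 2) < c" "c < x"
      using Rats_dense_in_real[of "max a (x - \<delta> / 2)" x] x \<delta>(1) by auto
    obtain d where d: "d \<in> \<rat>" "x < d" "d < min b (x + \<delta> / 2)"
      using Rats_dense_in_real[of x "min b (x + \<delta> / 2)"] x \<delta>(1) by auto
    have "(c, d) \<in> Q" using c d by (auto simp: Q_def)
    then show "F differentiable at x" using *[rule_format, of "(c, d)"] c d by auto
  qed
qed

lemma AC_on_AE_differentiable:
  assumes AC: "AC_on a b f"
  shows "AE x in lebesgue. x \<in> {a<..<b} \<longrightarrow> f differentiable at x"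
proof -
  have "AC_on a b (\<lambda>x. complex_of_real (Re (f x)))" "AC_on a b (\<lambda>x. complex_of_real (Im (f x)))"
    using abs_Re_le_cmod[of "f v - f u" for u v] abs_Im_le_cmod[of "f v - f u" for u v]
    by (auto intro!: AC_on_dominated[OF AC AC, where B="1/2"] simp flip: of_real_diff)
  from this[THEN AC_on_AE_differentiable_real] show ?thesis
  proof eventually_elim
    case (elim x)
    show ?case
    proof
      assume "x \<in> {a<..<b}"
      then obtain D E where "((\<lambda>x. Re (f x)) has_vector_derivative D) (at x)" "((\<lambda>x. Im (f x)) has_vector_derivative E) (at x)"
        using elim by (auto simp: real_differentiable_def has_real_derivative_iff_has_vector_derivative)
      then have "((\<lambda>x. complex_of_real (Re (f x)) + \<i> * complex_of_real (Im (f x))) has_vector_derivative 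
          complex_of_real D + \<i> * complex_of_real E) (at x)"
        by (intro has_vector_derivative_add has_vector_derivative_mult_right
              bounded_linear.has_vector_derivative[OF bounded_linear_of_real])
      then show "f differentiable at x" by (simp add: differentiableI_vector flip: complex_eq)
    qed
  qed
qed

section \<open>The fundamental theorem of calculus\<close>

text \<open>The fundamental theorem of calculus for the Henstock-Kurzweil integral. Let \<open>N\<close> be the null
  set where the derivative fails to be \<open>g\<close>. The gauge at a point off \<open>N\<close> comes from
  differentiability; at a point of \<open>N\<close> it keeps the interval inside an open set \<open>U
  \<supseteq> N\<close> of small measure, and then absolute continuity of \<open>f\<close> makes the total
  contribution of these intervals small.\<close>

theorem AC_on_has_integral:
  assumes AC: "AC_on a b f" and ab: "a \<le> b"
    and deriv: "AE x in lebesgue. x \<in> {a<..<b} \<longrightarrow> (f has_vector_derivative g x) (at x)"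
  shows "(g has_integral f b - f a) {a..b}"
proof -
  define N where "N = {x\<in>{a..b}. \<not> (f has_vector_derivative g x) (at x)}"
  have N: "negligible N"
  proof -
    obtain M where M: "M \<in> null_sets lebesgue" "\<And>x. x \<notin> M \<Longrightarrow> x \<in> {a<..<b} \<longrightarrow> (f has_vector_derivative g x) (at x)"
      using deriv by (rule AE_E3) auto
    have "N \<subseteq> {a, b} \<union> M"
    proof
      fix x assume "x \<in> N"
      then have "x \<in> {a..b}" "\<not> (f has_vector_derivative g x) (at x)" by (auto simp: N_def)
      then show "x \<in> {a, b} \<union> M" using M(2)[of x] by auto
    qed
    moreover have "negligible ({a, b} \<union> M)" using M(1) by (simp add: negligible_iff_null_sets[symmetric])
    ultimately have "negligible ({a, b} \<union> M)" "N \<subseteq> {a, b} \<union> M" by blast+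
    then show ?thesis by (rule negligible_subset)
  qed
  define g0 where "g0 = (\<lambda>x. if x \<in> N then 0 else g x)"
  have "(g0 has_integral f b - f a) (cbox a b)"
    unfolding has_integral_factor_content
  proof (intro allI impI)
    fix e :: real assume e: "0 < e"
    show "\<exists>d. gauge d \<and> (\<forall>p. p tagged_division_of cbox a b \<and> d fine p \<longrightarrow>
        norm ((\<Sum>(x, k)\<in>p. measure lborel k *\<^sub>R g0 x) - (f b - f a)) \<le> e * measure lborel (cbox a b))"
    proof (cases "a = b")
      case True
      then have "(g0 has_integral f b - f a) (cbox a b)" by (simp add: has_integral_refl)
      then show ?thesis unfolding has_integral_factor_content using e by blast
    next
      case False
      with ab have lt: "a < b" by simp
      define \<epsilon> where "\<epsilon> = e / 2"
      have \<epsilon>: "0 < \<epsilon>" "0 < \<epsilon> * (b - a)" using e lt by (auto simp: \<epsilon>_def)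
      obtain \<delta> where \<delta>: "\<delta> > 0" "\<And>P. nonoverlapping a b P \<Longrightarrow> (\<Sum>(u, v)\<in>P. v - u) < \<delta> \<Longrightarrow> (\<Sum>(u, v)\<in>P. cmod (f v - f u)) < \<epsilon> * (b - a)"
        using AC \<epsilon>(2) unfolding AC_on_iff_nonoverlapping by meson
      obtain U where U: "open U" "N \<subseteq> U" "U \<in> lmeasurable" "measure lebesgue U < \<delta>"
      proof -
        have Ns: "N \<in> null_sets lebesgue" using N by (simp add: negligible_iff_null_sets)
        then have "N \<in> sets lebesgue" by (rule null_setsD2)
        from sets_lebesgue_outer_open[OF this \<delta>(1)]
        obtain U where U: "open U" "N \<subseteq> U" "emeasure lebesgue (U - N) < ennreal \<delta>" .
        have "emeasure lebesgue U = emeasure lebesgue (U - N)"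
          using U(1) Ns by (intro emeasure_Diff_null_set[symmetric]) auto
        with U(3) have em: "emeasure lebesgue U < ennreal \<delta>" by simp
        have "U \<in> lmeasurable" using U(1) less_trans[OF em ennreal_less_top] by (intro fmeasurableI) auto
        moreover from this have "measure lebesgue U < \<delta>"
          using em \<delta>(1) by (simp add: emeasure_eq_measure2 ennreal_less_iff)
        ultimately show ?thesis using U(1,2) that by blast
      qed
      have "\<exists>s>0. (x \<in> N \<longrightarrow> ball x s \<subseteq> U) \<and>
          (x \<in> {a..b} - N \<longrightarrow> (\<forall>y. \<bar>y - x\<bar> < s \<longrightarrow> norm (f y - f x - (y - x) *\<^sub>R g x) \<le> \<epsilon> * \<bar>y - x\<bar>))" for x
      proof (cases "x \<in> {a..b} - N")
        case True
        then have "(f has_vector_derivative g x) (at x)" by (auto simp: N_def)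
        then obtain s where "s > 0" "\<forall>y. norm (y - x) < s \<longrightarrow> norm (f y - f x - (y - x) *\<^sub>R g x) \<le> \<epsilon> * norm (y - x)"
          using \<epsilon>(1) unfolding has_vector_derivative_def has_derivative_at_alt by blast
        then show ?thesis using True by auto
      next
        case False
        show ?thesis
        proof (cases "x \<in> N")
          case True
          then show ?thesis using U(1,2) open_contains_ball[of U] by blast
        qed (use False in \<open>auto intro: exI[of _ 1]\<close>)
      qed
      then obtain s where s: "\<And>x. s x > 0" "\<And>x. x \<in> N \<Longrightarrow> ball x (s x) \<subseteq> U"
        "\<And>x y. x \<in> {a..b} \<Longrightarrow> x \<notin> N \<Longrightarrow> \<bar>y - x\<bar> < s x \<Longrightarrow> norm (f y - f x - (y - x) *\<^sub>R g x) \<le> \<epsilon> * \<bar>y - x\<bar>"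
        by (metis DiffI)
      define d where "d = (\<lambda>x. ball x (s x))"
      have gauge: "gauge d" unfolding d_def by (rule gauge_ball_dependent) (use s(1) in auto)
      have bound: "norm ((\<Sum>(x, k)\<in>p. measure lborel k *\<^sub>R g0 x) - (f b - f a)) \<le> e * measure lborel (cbox a b)"
        if p: "p tagged_division_of cbox a b" and fine: "d fine p" for p
      proof -
        have fin: "finite p" using p by blast
        have piece: "x \<in> {a..b} \<and> a \<le> Inf k \<and> Inf k \<le> x \<and> x \<le> Sup k \<and> Sup k \<le> b \<and> k = {Inf k..Sup k} \<and> measure lborel k = Sup k - Inf k"
          if xk: "(x, k) \<in> p" for x k
        proof -
          obtain u v where k: "k = {u..v}" using tagged_division_ofD(4)[OF p xk] by auto
          have "x \<in> k" "k \<subseteq> {a..b}" using tagged_division_ofD(2,3)[OF p xk] by auto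
          then show ?thesis using k by auto
        qed
        have "f b - f a = (\<Sum>(x, k)\<in>p. f (Sup k) - f (Inf k))"
          using additive_tagged_division_1[OF ab, of p f] p by simp
        then have "norm ((\<Sum>(x, k)\<in>p. measure lborel k *\<^sub>R g0 x) - (f b - f a))
           = norm (\<Sum>(x, k)\<in>p. measure lborel k *\<^sub>R g0 x - (f (Sup k) - f (Inf k)))"
          by (simp add: sum_subtractf case_prod_beta)
        also have "\<dots> \<le> (\<Sum>(x, k)\<in>p. norm (measure lborel k *\<^sub>R g0 x - (f (Sup k) - f (Inf k))))"
          by (rule order_trans[OF norm_sum]) (simp add: case_prod_beta)
        also have "\<dots> \<le> (\<Sum>(x, k)\<in>p. \<epsilon> * measure lborel k + (if x \<in> N then cmod (f (Sup k) - f (Inf k)) else 0))"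
        proof (rule sum_mono, clarify)
          fix x k assume xk: "(x, k) \<in> p"
          note pc = piece[OF xk]
          show "norm (measure lborel k *\<^sub>R g0 x - (f (Sup k) - f (Inf k))) \<le> \<epsilon> * measure lborel k + (if x \<in> N then cmod (f (Sup k) - f (Inf k)) else 0)"
          proof (cases "x \<in> N")
            case True
            then show ?thesis using \<epsilon>(1) by (simp add: g0_def norm_minus_commute)
          next
            case False
            have "k \<subseteq> ball x (s x)" using fine xk by (auto simp: fine_def d_def)
            moreover have "Inf k \<in> k" "Sup k \<in> k" using pc by (metis atLeastAtMost_iff order_refl order_trans)+
            ultimately have "Inf k \<in> ball x (s x)" "Sup k \<in> ball x (s x)" by blast+
            then have "\<bar>Inf k - x\<bar> < s x" "\<bar>Sup k - x\<bar> < s x"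
              by (simp_all add: dist_real_def abs_minus_commute)
            then have 1: "norm (f (Inf k) - f x - (Inf k - x) *\<^sub>R g x) \<le> \<epsilon> * \<bar>Inf k - x\<bar>"
              and 2: "norm (f (Sup k) - f x - (Sup k - x) *\<^sub>R g x) \<le> \<epsilon> * \<bar>Sup k - x\<bar>"
              using s(3)[of x "Inf k"] s(3)[of x "Sup k"] pc False by blast+
            have "measure lborel k *\<^sub>R g0 x - (f (Sup k) - f (Inf k)) =
               (f (Inf k) - f x - (Inf k - x) *\<^sub>R g x) - (f (Sup k) - f x - (Sup k - x) *\<^sub>R g x)"
            proof -
              have "measure lborel k = Sup k - Inf k" using pc by blast
              then show ?thesis using False by (simp add: g0_def scaleR_diff_left)
            qed
            also have "norm \<dots> \<le> \<epsilon> * \<bar>Inf k - x\<bar> + \<epsilon> * \<bar>Sup k - x\<bar>"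
              by (rule order_trans[OF norm_triangle_ineq4]) (intro add_mono 1 2)
            also have "\<dots> = \<epsilon> * measure lborel k"
            proof -
              have "measure lborel k = Sup k - Inf k" "Inf k \<le> x" "x \<le> Sup k" using pc by blast+
              then show ?thesis by (simp flip: distrib_left)
            qed
            finally show ?thesis using False by simp
          qed
        qed
        also have "\<dots> = \<epsilon> * (b - a) + (\<Sum>(x, k)\<in>{(x, k)\<in>p. x \<in> N}. cmod (f (Sup k) - f (Inf k)))"
        proof -
          have "(\<Sum>(x, k)\<in>p. \<epsilon> * measure lborel k) = \<epsilon> * (b - a)"
            using additive_content_tagged_division[OF p] ab by (simp add: case_prod_beta flip: sum_distrib_left)
          moreover have "(\<Sum>(x, k)\<in>p. if x \<in> N then cmod (f (Sup k) - f (Inf k)) else 0) =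
             (\<Sum>(x, k)\<in>{(x, k)\<in>p. x \<in> N}. cmod (f (Sup k) - f (Inf k)))"
          proof -
            have eq: "{(x, k)\<in>p. x \<in> N} = {z\<in>p. fst z \<in> N}" by auto
            show ?thesis unfolding eq case_prod_beta by (rule sum.inter_filter[OF fin, symmetric])
          qed
          ultimately show ?thesis by (simp add: case_prod_beta sum.distrib)
        qed
        also have "(\<Sum>(x, k)\<in>{(x, k)\<in>p. x \<in> N}. cmod (f (Sup k) - f (Inf k))) < \<epsilon> * (b - a)"
        proof -
          define p' where "p' = {(x, k)\<in>p. x \<in> N}"
          define P where "P = (\<lambda>(x, k). (Inf k, Sup k)) ` p'"
          have p': "p' \<subseteq> p" by (auto simp: p'_def)
          then have p'_fin: "finite p'" using fin by (rule finite_subset)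
          have disj: "{Inf k<..<Sup k} \<inter> {Inf l<..<Sup l} = {}" if "(x, k) \<in> p" "(y, l) \<in> p" "(x, k) \<noteq> (y, l)" for x k y l
          proof -
            have int: "interior k = {Inf k<..<Sup k}" if "(x, k) \<in> p" for x k
            proof -
              have "k = {Inf k..Sup k}" using piece[OF that] by blast
              then show ?thesis by (metis interior_atLeastAtMost_real)
            qed
            have "interior k \<inter> interior l = {}" using tagged_division_ofD(5)[OF p that] by simp
            then show ?thesis using int[OF that(1)] int[OF that(2)] by simp
          qed
          have sum_eq: "(\<Sum>(u, v)\<in>P. cmod (f v - f u)) = (\<Sum>(x, k)\<in>p'. cmod (f (Sup k) - f (Inf k)))"
          proof -
            have "(\<Sum>q\<in>P. cmod (f (snd q) - f (fst q))) = (\<Sum>z\<in>p'. cmod (f (Sup (snd z)) - f (Inf (snd z))))"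
              unfolding P_def
            proof (subst sum.reindex_nontrivial)
              fix z w assume zw: "z \<in> p'" "w \<in> p'" "z \<noteq> w" 
                "(case z of (x, k) \<Rightarrow> (Inf k, Sup k)) = (case w of (x, k) \<Rightarrow> (Inf k, Sup k))"
              obtain x k y l where e: "z = (x, k)" "w = (y, l)" by (cases z, cases w)
              have zw': "(x, k) \<in> p" "(y, l) \<in> p" "(x, k) \<noteq> (y, l)" and eq: "Inf l = Inf k" "Sup l = Sup k"
                using zw p' e by auto
              have "{Inf k<..<Sup k} = {}" using disj[OF zw'] by (simp add: eq)
              then have "Inf k = Sup k" using piece[OF zw'(1)] by auto
              then show "cmod (f (snd (case z of (x, k) \<Rightarrow> (Inf k, Sup k))) - f (fst (case z of (x, k) \<Rightarrow> (Inf k, Sup k)))) = 0"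
                by (simp add: e)
            qed (use p'_fin in \<open>simp_all add: case_prod_beta\<close>)
            then show ?thesis by (simp add: case_prod_beta)
          qed
          have P: "nonoverlapping a b P"
            unfolding nonoverlapping_def
          proof (intro conjI)
            show "finite P" using p'_fin by (simp add: P_def)
            show "\<forall>(u, v)\<in>P. a \<le> u \<and> u \<le> v \<and> v \<le> b"
            proof clarify
              fix u v assume "(u, v) \<in> P"
              then obtain x k where xk: "(x, k) \<in> p" "u = Inf k" "v = Sup k" by (auto simp: P_def p'_def)
              from piece[OF xk(1)] show "a \<le> u \<and> u \<le> v \<and> v \<le> b"
                unfolding xk(2,3) by (blast intro: order_trans)
            qed
            show "disjoint_family_on (\<lambda>(u, v). {u<..<v}) P"
              unfolding disjoint_family_on_def
            proof (intro ballI impI)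
              fix q r assume "q \<in> P" "r \<in> P" "q \<noteq> r"
              then obtain x k y l where xk: "(x, k) \<in> p'" "(y, l) \<in> p'" "q = (Inf k, Sup k)" "r = (Inf l, Sup l)"
                by (auto simp: P_def)
              then have "(x, k) \<noteq> (y, l)" using \<open>q \<noteq> r\<close> by auto
              then show "(case q of (u, v) \<Rightarrow> {u<..<v}) \<inter> (case r of (u, v) \<Rightarrow> {u<..<v}) = {}"
                using disj[of x k y l] xk(1,2) p' unfolding xk(3,4) prod.case by blast
            qed
          qed
          have "(\<Sum>(u, v)\<in>P. v - u) \<le> measure lebesgue U"
          proof (rule nonoverlapping_length_le[OF P U(3)])
            fix u v assume "(u, v) \<in> P"
            then obtain x k where xk: "(x, k) \<in> p" "x \<in> N" "u = Inf k" "v = Sup k" by (auto simp: P_def p'_def)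
            have "k \<subseteq> ball x (s x)" using fine xk by (auto simp: fine_def d_def)
            also have "\<dots> \<subseteq> U" using s(2) xk(2) by blast
            finally have "k \<subseteq> U" .
            moreover have "k = {u..v}" using piece[OF xk(1)] xk(3,4) by blast
            ultimately show "{u<..<v} \<subseteq> U" by (auto simp: subset_iff)
          qed
          then have "(\<Sum>(u, v)\<in>P. cmod (f v - f u)) < \<epsilon> * (b - a)"
            using U(4) by (intro \<delta>(2)[OF P]) simp
          then show ?thesis unfolding sum_eq p'_def .
        qed
        finally show ?thesis using ab by (simp add: \<epsilon>_def algebra_simps)
      qed
      show ?thesis
      proof (intro exI conjI allI impI)
        show "gauge d" by (rule gauge)
      qed (elim conjE, rule bound)
    qed
  qed
  then have "(g0 has_integral f b - f a) {a..b}" by simp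
  moreover have "g x = g0 x" if "x \<in> {a..b} - N" for x using that by (simp add: g0_def)
  ultimately show ?thesis by (intro has_integral_spike[OF N, of "{a..b}" g g0]) 
qed

section \<open>Weak solutions of the second order equation\<close>

lemma AE_M01_iff: "(AE x in M01. P x) \<longleftrightarrow> (AE x in lebesgue. x \<in> {0<..<1} \<longrightarrow> P x)"
  by (rule AE_restrict_space_iff) simp

lemma at_within_01: "0 < x \<Longrightarrow> x < 1 \<Longrightarrow> at x within {0..<1} = at (x::real)"
  by (rule at_within_interior) simp

lemma at_within_01_neq_bot: "0 \<le> x \<Longrightarrow> x < 1 \<Longrightarrow> at x within {0..<1} \<noteq> bot" for x :: real
  by (cases "x = 0") (simp_all add: at_within_01 trivial_limit_within islimpt_greaterThanLessThan1 
     islimpt_subset[OF islimpt_greaterThanLessThan1[of 0 1], of "{0..<1}"] subset_eq)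

lemma D01_eq:
  assumes "0 \<le> x" "x < 1" "(f has_vector_derivative f') (at x within {0..<1})"
  shows "D01 f x = f'"
  unfolding D01_def using at_within_01_neq_bot[OF assms(1,2)] assms(3) by (rule vector_derivative_within)

text \<open>Where \<open>f\<close> is not differentiable, the value of \<open>D01 f\<close> is arbitrary; this is why everything
  about the maximal operators is stated almost everywhere below.\<close>

lemma AC_loc_AE_has_vector_derivative:
  assumes "AC_loc f"
  shows "AE x in M01. (f has_vector_derivative D01 f x) (at x)"
proof -
  have "AE x in lebesgue. \<forall>n::nat. x \<in> {0<..<1 - inverse (real (Suc n))} \<longrightarrow> f differentiable at x"
    unfolding AE_all_countable
  proof
    fix n :: nat
    have "inverse (real (Suc n)) \<le> 1" by (simp add: inverse_le_1_iff)
    then have "AC_on 0 (1 - inverse (real (Suc n))) f"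
      using assms unfolding AC_loc_def by simp
    then show "AE x in lebesgue. x \<in> {0<..<1 - inverse (real (Suc n))} \<longrightarrow> f differentiable at x"
      by (rule AC_on_AE_differentiable)
  qed
  then show ?thesis
    unfolding AE_M01_iff
  proof (rule eventually_mono, intro impI)
    fix x assume *: "\<forall>n::nat. x \<in> {0<..<1 - inverse (real (Suc n))} \<longrightarrow> f differentiable at x"
      and x: "x \<in> {0<..<1::real}"
    obtain n where "inverse (real (Suc n)) < 1 - x" using reals_Archimedean[of "1 - x"] x by auto
    then have "x \<in> {0<..<1 - inverse (real (Suc n))}" using x by auto
    then have "f differentiable at x" using * by blast
    then show "(f has_vector_derivative D01 f x) (at x)"
      using x by (simp add: D01_def at_within_01 vector_derivative_works)
  qed
qed

lemma AC_loc_add: "AC_loc f \<Longrightarrow> AC_loc g \<Longrightarrow> AC_loc (\<lambda>x. f x + g x)"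
  and AC_loc_mult: "AC_loc f \<Longrightarrow> AC_loc g \<Longrightarrow> AC_loc (\<lambda>x. f x * g x)"
  and AC_loc_uminus: "AC_loc f \<Longrightarrow> AC_loc (\<lambda>x. - f x)"
  unfolding AC_loc_def by (blast intro: AC_on_add AC_on_mult AC_on_uminus)+

lemma AC_loc_diff: "AC_loc f \<Longrightarrow> AC_loc g \<Longrightarrow> AC_loc (\<lambda>x. f x - g x)"
  using AC_loc_add[of f "\<lambda>x. - g x"] AC_loc_uminus[of g] by simp

lemma AC_loc_cong:
  assumes "\<And>x. 0 \<le> x \<Longrightarrow> x < 1 \<Longrightarrow> f x = g x"
  shows "AC_loc f \<longleftrightarrow> AC_loc g"
proof -
  have "AC_loc g'" if f': "AC_loc f'" and e: "\<And>x. 0 \<le> x \<Longrightarrow> x < 1 \<Longrightarrow> f' x = g' x" for f' g'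
    unfolding AC_loc_def
  proof (intro allI impI)
    fix a b :: real assume ab: "0 \<le> a \<and> a \<le> b \<and> b < 1"
    then have "AC_on a b f'" using f' by (simp add: AC_loc_def)
    from AC_on_dominated[OF this this, where B=1 and h=g'] show "AC_on a b g'"
      using ab e by force
  qed
  from this[of f g] this[of g f] assms show ?thesis by metis
qed

lemma continuously_differentiable_AC_loc:
  assumes d: "\<And>x. 0 \<le> x \<Longrightarrow> x < 1 \<Longrightarrow> (f has_vector_derivative f' x) (at x within {0..<1})"
    and c: "continuous_on {0..<1} f'"
  shows "AC_loc f"
  unfolding AC_loc_def
proof (intro allI impI)
  fix a b :: real assume ab: "0 \<le> a \<and> a \<le> b \<and> b < 1"
  then have sub: "{a..b} \<subseteq> {0..<1}" by auto
  obtain B where B: "\<And>x. x \<in> {a..b} \<Longrightarrow> cmod (f' x) \<le> B"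
    using compact_imp_bounded[OF compact_continuous_image[OF continuous_on_subset[OF c sub] compact_Icc]]
    unfolding bounded_iff ball_simps by blast
  show "AC_on a b f"
  proof (rule AC_on_lipschitz)
    fix u v assume uv: "a \<le> u" "u \<le> v" "v \<le> b"
    have "norm (f v - f u) \<le> B * norm (v - u)"
    proof (rule differentiable_bound[of "{a..b}" f "\<lambda>x h. h *\<^sub>R f' x"])
      fix x assume x: "x \<in> {a..b}"
      show "(f has_derivative (\<lambda>h. h *\<^sub>R f' x)) (at x within {a..b})"
        using d[of x] x ab sub unfolding has_vector_derivative_def by (meson atLeastAtMost_iff has_derivative_subset le_less_trans order_trans)
      show "onorm (\<lambda>h. h *\<^sub>R f' x) \<le> B"
      proof (rule onorm_le)
        fix h :: real
        show "norm (h *\<^sub>R f' x) \<le> B * norm h"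
          using mult_right_mono[OF B[OF x], of "norm h"] by (simp add: mult.commute)
      qed
    qed (use uv in auto)
    then show "cmod (f v - f u) \<le> B * (v - u)" using uv by simp
  qed
qed

lemma has_vector_derivative_complex_of_real:
  "(g has_real_derivative d) F \<Longrightarrow> ((\<lambda>x. complex_of_real (g x)) has_vector_derivative complex_of_real d) F"
  unfolding has_real_derivative_iff_has_vector_derivative
  by (rule bounded_linear.has_vector_derivative[OF bounded_linear_of_real])

lemma has_real_derivative_inverse_power:
  fixes x :: real
  assumes "x < 1"
  shows "((\<lambda>x. c / (1 - x) ^ Suc n) has_real_derivative real (Suc n) * c / (1 - x) ^ Suc (Suc n)) (at x within S)"
proof -
  have "(1 - x) ^ Suc n \<noteq> 0" using assms by simp
  moreover have "((\<lambda>x. (1 - x) ^ Suc n) has_real_derivative real (Suc n) * (1 - x) ^ n * (0 - 1)) (at x within S)"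
  proof (rule DERIV_cong[OF DERIV_power])
    show "((\<lambda>x. 1 - x) has_real_derivative 0 - 1) (at x within S)"
      by (rule DERIV_diff DERIV_const DERIV_ident)+
  qed simp
  ultimately have "((\<lambda>x. c / (1 - x) ^ Suc n) has_real_derivative
      (0 * (1 - x) ^ Suc n - c * (real (Suc n) * (1 - x) ^ n * (0 - 1))) / ((1 - x) ^ Suc n * (1 - x) ^ Suc n)) (at x within S)"
    by (intro DERIV_divide DERIV_const)
  moreover have "(0 * (1 - x) ^ Suc n - c * (real (Suc n) * (1 - x) ^ n * (0 - 1))) / ((1 - x) ^ Suc n * (1 - x) ^ Suc n)
      = real (Suc n) * c / (1 - x) ^ Suc (Suc n)"
    using assms by (simp add: divide_simps)
  ultimately show ?thesis by (rule DERIV_cong)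
qed

definition potential :: "real \<Rightarrow> real \<Rightarrow> complex" where
  "potential \<alpha> x = complex_of_real ((\<alpha>\<^sup>2 - 1/4) / (1 - x)\<^sup>2)"

text \<open>\<open>\<tau>\<^sub>2 f = k\<close> as a first order system for \<open>(f, f')\<close>. The derivative is a separate
  argument because \<open>D01\<close> is controlled almost everywhere only: for \<open>\<tau>\<^sub>2 f\<close> with
  \<open>f\<close> in the domain of the fourth order operator, an explicit absolutely continuous function
  equals the derivative almost everywhere, but nothing is known about the value of \<open>D01\<close> at
  each single point.\<close>

definition weak_solution :: "real \<Rightarrow> (real \<Rightarrow> complex) \<Rightarrow> (real \<Rightarrow> complex) \<Rightarrow> (real \<Rightarrow> complex) \<Rightarrow> bool" where
  "weak_solution \<alpha> f f' k \<longleftrightarrow> AC_loc f \<and> AC_loc f' \<and>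
     (AE x in M01. (f has_vector_derivative f' x) (at x) \<and>
                   (f' has_vector_derivative (potential \<alpha> x * f x - k x)) (at x))"

lemma continuous_on_potential: "continuous_on {0..<1} (potential \<alpha>)"
  unfolding potential_def by (intro continuous_intros) auto

lemma weak_solutionI:
  assumes f: "\<And>x. 0 \<le> x \<Longrightarrow> x < 1 \<Longrightarrow> (f has_vector_derivative f' x) (at x within {0..<1})"
    and f': "\<And>x. 0 \<le> x \<Longrightarrow> x < 1 \<Longrightarrow> (f' has_vector_derivative (potential \<alpha> x * f x - k x)) (at x within {0..<1})"
    and k: "continuous_on {0..<1} k"
  shows "weak_solution \<alpha> f f' k"
  unfolding weak_solution_def
proof (intro conjI)
  have c: "continuous_on {0..<1} f" "continuous_on {0..<1} f'"
    using f f' by (auto simp: continuous_on_eq_continuous_within intro!: has_vector_derivative_continuous)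
  show "AC_loc f" using f c(2) by (rule continuously_differentiable_AC_loc)
  have "continuous_on {0..<1} (\<lambda>x. potential \<alpha> x * f x - k x)"
    by (intro continuous_intros continuous_on_potential c k)
  with f' show "AC_loc f'" by (rule continuously_differentiable_AC_loc)
  show "AE x in M01. (f has_vector_derivative f' x) (at x) \<and>
                   (f' has_vector_derivative (potential \<alpha> x * f x - k x)) (at x)"
    unfolding AE_M01_iff
    using f f' by (intro always_eventually) (auto simp: at_within_01[symmetric])
qed

text \<open>Integrate the derivative of the Wronskian \<open>f g' - f' g\<close>.\<close>

theorem weak_solution_Lagrange:
  assumes f: "weak_solution \<alpha> f f' k" and g: "weak_solution \<alpha> g g' h" and b: "0 \<le> b" "b < 1"
  shows "((\<lambda>x. k x * g x - f x * h x) has_integral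
          (f b * g' b - f' b * g b) - (f 0 * g' 0 - f' 0 * g 0)) {0..b}"
proof -
  have AC: "AC_on 0 b (\<lambda>x. f x * g' x - f' x * g x)"
    using AC_loc_diff[OF AC_loc_mult AC_loc_mult] f g b unfolding weak_solution_def AC_loc_def[of "\<lambda>x. _ x - _ x"]
    by blast
  have "AE x in M01. ((\<lambda>x. f x * g' x - f' x * g x) has_vector_derivative k x * g x - f x * h x) (at x)"
    using conjunct2[OF conjunct2[OF f[unfolded weak_solution_def]]]
      conjunct2[OF conjunct2[OF g[unfolded weak_solution_def]]]
  proof eventually_elim
    case (elim x)
    then have "((\<lambda>x. f x * g' x - f' x * g x) has_vector_derivative 
       (f x * (potential \<alpha> x * g x - h x) + f' x * g' x) - (f' x * g' x + (potential \<alpha> x * f x - k x) * g x)) (at x)"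
      by (intro has_vector_derivative_diff has_vector_derivative_mult) auto
    then show ?case by (simp add: algebra_simps)
  qed
  then have "AE x in lebesgue. x \<in> {0<..<b} \<longrightarrow> ((\<lambda>x. f x * g' x - f' x * g x) has_vector_derivative k x * g x - f x * h x) (at x)"
    unfolding AE_M01_iff by (rule eventually_mono) (use b in auto)
  from AC_on_has_integral[OF AC b(1) this] show ?thesis .
qed

section \<open>The maximal operators in terms of weak solutions\<close>

lemma T2maxE:
  assumes "(F, G) \<in> T2max \<alpha>"
  obtains f f' k where "F = abs_L2 f" "G = abs_L2 k" "square_integrable f" "square_integrable k" "weak_solution \<alpha> f f' k"
proof -
  obtain f where f: "F = abs_L2 f" "G = abs_L2 (tau2 \<alpha> f)" "square_integrable f" "AC_loc f" "AC_loc (D01 f)" "square_integrable (tau2 \<alpha> f)"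
    using assms by (auto simp: T2max_def)
  have "weak_solution \<alpha> f (D01 f) (tau2 \<alpha> f)"
    unfolding weak_solution_def using f(4,5) f(4,5)[THEN AC_loc_AE_has_vector_derivative]
    by (auto simp: tau2_def potential_def)
  then show ?thesis using f that by blast
qed

text \<open>\<open>\<tau>\<^sub>4 = \<tau>\<^sub>2 \<tau>\<^sub>2\<close> on the domain of the fourth order maximal
  operator. With \<open>Q\<close> the potential, \<open>\<tau>\<^sub>2\<^sup>2 f = f'''' - 2 Q f'' - 2 Q' f' +
  (Q\<^sup>2 - Q'') f\<close>, and \<open>Q\<^sup>2 - Q''\<close> is the zeroth order coefficient of
  \<open>\<tau>\<^sub>4\<close>.\<close>

lemma weak_solution_tau4:
  fixes \<alpha> :: real
  assumes "AC_loc f" "AC_loc (D01 f)" "AC_loc (D01 (D01 f))" "AC_loc (D01 (D01 (D01 f)))"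
  defines "p \<equiv> \<lambda>x. - D01 (D01 f) x + potential \<alpha> x * f x"
    and "p' \<equiv> \<lambda>x. - D01 (D01 (D01 f)) x + (complex_of_real (2 * (\<alpha>\<^sup>2 - 1/4) / (1 - x)^3) * f x + potential \<alpha> x * D01 f x)"
  shows "weak_solution \<alpha> f (D01 f) p" and "weak_solution \<alpha> p p' (tau4 \<alpha> f)"
proof -
  note AC = assms(1-4)
  note ae = AC[THEN AC_loc_AE_has_vector_derivative]
  show "weak_solution \<alpha> f (D01 f) p"
    unfolding weak_solution_def p_def using AC(1,2) ae(1,2) by auto
  define \<kappa> where "\<kappa> = \<alpha>\<^sup>2 - 1/4"
  define Q1 where "Q1 = (\<lambda>x. complex_of_real (2 * \<kappa> / (1 - x)^3))"
  have dQ0: "(potential \<alpha> has_vector_derivative Q1 x) (at x within S)" if "x < 1" for x S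
    unfolding potential_def \<kappa>_def[symmetric] Q1_def using that
    using has_vector_derivative_complex_of_real[OF has_real_derivative_inverse_power[of x \<kappa> 1]]
    by (simp add: numeral_eq_Suc)
  have dQ1: "(Q1 has_vector_derivative complex_of_real (6 * \<kappa> / (1 - x)^4)) (at x within S)" if "x < 1" for x S
    unfolding Q1_def using that
    using has_vector_derivative_complex_of_real[OF has_real_derivative_inverse_power[of x "2 * \<kappa>" 2]]
    by (simp add: numeral_eq_Suc)
  have "continuous_on {0..<1} Q1" "continuous_on {0..<1} (\<lambda>x. complex_of_real (6 * \<kappa> / (1 - x)^4))"
    unfolding Q1_def by (intro continuous_intros; auto)+
  then have ACQ: "AC_loc (potential \<alpha>)" "AC_loc Q1"
    using dQ0 dQ1 by (auto intro!: continuously_differentiable_AC_loc)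
  have p': "p' = (\<lambda>x. - D01 (D01 (D01 f)) x + (Q1 x * f x + potential \<alpha> x * D01 f x))"
    by (simp add: p'_def Q1_def \<kappa>_def)
  show "weak_solution \<alpha> p p' (tau4 \<alpha> f)"
    unfolding weak_solution_def
  proof (intro conjI)
    show "AC_loc p" unfolding p_def by (intro AC_loc_add AC_loc_uminus AC_loc_mult AC ACQ)
    show "AC_loc p'" unfolding p' by (intro AC_loc_add AC_loc_uminus AC_loc_mult AC ACQ)
    have x01: "AE x in M01. 0 < x \<and> x < 1" unfolding AE_M01_iff by auto
    show "AE x in M01. (p has_vector_derivative p' x) (at x) \<and>
                   (p' has_vector_derivative (potential \<alpha> x * p x - tau4 \<alpha> f x)) (at x)"
      using ae x01
    proof eventually_elim
      case (elim x)
      note d = elim(1-4)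
      note q = dQ0[of x UNIV] dQ1[of x UNIV]
      have "(p has_vector_derivative - D01 (D01 (D01 f)) x + (potential \<alpha> x * D01 f x + Q1 x * f x)) (at x)"
        unfolding p_def using d q elim(5)
        by (intro has_vector_derivative_add has_vector_derivative_minus has_vector_derivative_mult) auto
      then have 1: "(p has_vector_derivative p' x) (at x)" by (simp add: p' algebra_simps)
      have 2: "(p' has_vector_derivative - D01 (D01 (D01 (D01 f))) x + 
         ((Q1 x * D01 f x + complex_of_real (6 * \<kappa> / (1 - x)^4) * f x) + 
          (potential \<alpha> x * D01 (D01 f) x + Q1 x * D01 f x))) (at x)"
        unfolding p' using d q elim(5)
        by (intro has_vector_derivative_add has_vector_derivative_minus has_vector_derivative_mult) auto
      have eq: "(\<lambda>y. complex_of_real ((2 * \<alpha>\<^sup>2 - 1/2) / (1 - y)\<^sup>2) * D01 f y) = (\<lambda>y. 2 * (potential \<alpha> y * D01 f y))"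
      proof
        fix y
        have "(2 * \<alpha>\<^sup>2 - 1/2) / (1 - y)\<^sup>2 = 2 * ((\<alpha>\<^sup>2 - 1/4) / (1 - y)\<^sup>2)" by simp
        then show "complex_of_real ((2 * \<alpha>\<^sup>2 - 1/2) / (1 - y)\<^sup>2) * D01 f y = 2 * (potential \<alpha> y * D01 f y)"
          unfolding potential_def by (simp only: of_real_mult) simp
      qed
      have "((\<lambda>y. 2 * (potential \<alpha> y * D01 f y)) has_vector_derivative 
          2 * (potential \<alpha> x * D01 (D01 f) x + Q1 x * D01 f x)) (at x)"
        using d q elim(5) by (intro has_vector_derivative_mult_right has_vector_derivative_mult) auto
      then have "D01 (\<lambda>y. complex_of_real ((2 * \<alpha>\<^sup>2 - 1/2) / (1 - y)\<^sup>2) * D01 f y) x = 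
          2 * (potential \<alpha> x * D01 (D01 f) x + Q1 x * D01 f x)"
        unfolding eq using elim(5) by (intro D01_eq) (auto simp: at_within_01)
      then have tau: "tau4 \<alpha> f x = D01 (D01 (D01 (D01 f))) x - 2 * (potential \<alpha> x * D01 (D01 f) x + Q1 x * D01 f x)
         + complex_of_real ((\<alpha> ^ 4 - 13/2 * \<alpha>\<^sup>2 + (5/4)\<^sup>2) / (1 - x) ^ 4) * f x"
        by (simp add: tau4_def)
      have "(\<alpha> ^ 4 - 13/2 * \<alpha>\<^sup>2 + (5/4)\<^sup>2) / (1 - x) ^ 4 = (\<kappa> / (1 - x)\<^sup>2)\<^sup>2 - 6 * \<kappa> / (1 - x)^4"
      proof -
        have "(\<kappa> / (1 - x)\<^sup>2)\<^sup>2 - 6 * \<kappa> / (1 - x)^4 = (\<kappa>\<^sup>2 - 6 * \<kappa>) / (1 - x)^4"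
          by (simp add: power_divide diff_divide_distrib flip: power_mult)
        also have "\<kappa>\<^sup>2 - 6 * \<kappa> = \<alpha> ^ 4 - 13/2 * \<alpha>\<^sup>2 + (5/4)\<^sup>2"
          by (simp add: \<kappa>_def power2_eq_square power4_eq_xxxx algebra_simps)
        finally show ?thesis by simp
      qed
      then have coef: "complex_of_real ((\<alpha> ^ 4 - 13/2 * \<alpha>\<^sup>2 + (5/4)\<^sup>2) / (1 - x) ^ 4) 
         = potential \<alpha> x * potential \<alpha> x - complex_of_real (6 * \<kappa> / (1 - x)^4)"
        by (simp add: potential_def \<kappa>_def power2_eq_square)
      have "(p' has_vector_derivative (potential \<alpha> x * p x - tau4 \<alpha> f x)) (at x)"
        using 2 unfolding tau coef p_def by (simp add: algebra_simps)
      with 1 show ?case ..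
    qed
  qed
qed

lemma T4maxE:
  assumes "(F, G) \<in> T4max \<alpha>"
  obtains f f' p p' k where "F = abs_L2 f" "G = abs_L2 k" "square_integrable f" "square_integrable k"
    "weak_solution \<alpha> f f' p" "weak_solution \<alpha> p p' k"
proof -
  obtain f where f: "F = abs_L2 f" "G = abs_L2 (tau4 \<alpha> f)" "square_integrable f" "AC_loc f" "AC_loc (D01 f)" 
    "AC_loc (D01 (D01 f))" "AC_loc (D01 (D01 (D01 f)))" "square_integrable (tau4 \<alpha> f)"
    using assms by (auto simp: T4max_def)
  from weak_solution_tau4[OF f(4-7)] f show ?thesis by (intro that)
qed

section \<open>Square integrable functions and their classes\<close>

lemma abs_L2_eq_iff:
  assumes "square_integrable f" "square_integrable g"
  shows "abs_L2 f = abs_L2 g \<longleftrightarrow> (AE x in M01. f x = g x)"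
  using Quotient_rel[OF Quotient_L2, of f g] assms by (auto simp: L2_rel_def)

lemma L2_cases:
  obtains f where "F = abs_L2 f" "square_integrable f"
  using Quotient_abs_rep[OF Quotient_L2, of F] Quotient_rep_reflp[OF Quotient_L2, of F]
  by (metis L2_rel_def)

lemma inner_L2_abs:
  assumes "square_integrable f" "square_integrable g"
  shows "inner_L2 (abs_L2 f) (abs_L2 g) = (\<integral>x. f x * cnj (g x) \<partial>M01)"
  using assms by (intro inner_L2.abs_eq) (auto simp: L2_rel_def)

lemma scale_L2_abs:
  assumes "square_integrable f"
  shows "scale_L2 c (abs_L2 f) = abs_L2 (\<lambda>x. c * f x)"
  using assms by (intro scale_L2.abs_eq) (auto simp: L2_rel_def)

lemma plus_L2_abs:
  assumes "square_integrable f" "square_integrable g"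
  shows "abs_L2 f + abs_L2 g = abs_L2 (\<lambda>x. f x + g x)"
  using assms by (intro plus_L2.abs_eq) (auto simp: L2_rel_def)

lemma zero_L2_abs: "0 = abs_L2 (\<lambda>x. 0)"
  by (simp add: zero_L2_def)

lemma cnj_measurable: "f \<in> borel_measurable M \<Longrightarrow> (\<lambda>x. cnj (f x)) \<in> borel_measurable M"
  by (rule measurable_compose[of f M borel]) (auto intro!: borel_measurable_continuous_onI continuous_intros)

lemma square_integrable_cnj: "square_integrable f \<Longrightarrow> square_integrable (\<lambda>x. cnj (f x))"
  by (simp add: square_integrable_def cnj_measurable)

lemma square_integrable_cong_AE:
  assumes "square_integrable f" "g \<in> borel_measurable M01" "AE x in M01. f x = g x"
  shows "square_integrable g"
  unfolding square_integrable_def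
proof (intro conjI assms(2))
  have f: "integrable M01 (\<lambda>x. (cmod (f x))\<^sup>2)" "f \<in> borel_measurable M01"
    using assms by (auto simp: square_integrable_def)
  have "(\<lambda>x. (cmod (f x))\<^sup>2) \<in> borel_measurable M01" "(\<lambda>x. (cmod (g x))\<^sup>2) \<in> borel_measurable M01"
    using f(2) assms(2) by measurable
  moreover have "AE x in M01. (cmod (f x))\<^sup>2 = (cmod (g x))\<^sup>2"
    using assms(3) by eventually_elim simp
  ultimately show "integrable M01 (\<lambda>x. (cmod (g x))\<^sup>2)"
    using f(1) integrable_cong_AE by blast
qed

lemma square_integrable_cong:
  assumes "\<And>x. 0 < x \<Longrightarrow> x < 1 \<Longrightarrow> f x = g x"
  shows "square_integrable f \<longleftrightarrow> square_integrable g"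
  unfolding square_integrable_def
  by (intro arg_cong2[where f="(\<and>)"] measurable_cong Bochner_Integration.integrable_cong refl) (simp_all add: assms)

lemma integrable_mult_square_integrable:
  assumes "square_integrable f" "square_integrable g"
  shows "integrable M01 (\<lambda>x. f x * g x)"
proof (rule Bochner_Integration.integrable_bound)
  have m: "f \<in> borel_measurable M01" "g \<in> borel_measurable M01"
    using assms by (auto simp: square_integrable_def)
  show "integrable M01 (\<lambda>x. (cmod (f x))\<^sup>2 + (cmod (g x))\<^sup>2)"
    using assms by (auto simp: square_integrable_def)
  show "(\<lambda>x. f x * g x) \<in> borel_measurable M01" using m by measurable
  have "cmod (f x) * cmod (g x) \<le> (cmod (f x))\<^sup>2 + (cmod (g x))\<^sup>2" for x
    using sum_squares_bound[of "cmod (f x)" "cmod (g x)"] mult_nonneg_nonneg[of "cmod (f x)" "cmod (g x)"]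
      norm_ge_zero[of "f x"] norm_ge_zero[of "g x"] by linarith
  then show "AE x in M01. norm (f x * g x) \<le> norm ((cmod (f x))\<^sup>2 + (cmod (g x))\<^sup>2)"
    by (simp add: norm_mult)
qed

lemma integrable_const_M01 [simp]: "integrable M01 (\<lambda>x. c::'a::{banach, second_countable_topology})"
  by (rule finite_measure.integrable_const) (simp add: finite_measure_lebesgue_on)

lemma measurable_M01_continuous:
  fixes f :: "real \<Rightarrow> 'a::topological_space"
  assumes "continuous_on {0<..<1} f"
  shows "f \<in> borel_measurable M01"
  using assms by (rule continuous_imp_measurable_on_sets_lebesgue) simp

lemma square_integrable_bounded:
  assumes "f \<in> borel_measurable M01" "\<And>x. 0 < x \<Longrightarrow> x < 1 \<Longrightarrow> cmod (f x) \<le> B"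
  shows "square_integrable f"
  unfolding square_integrable_def
proof (intro conjI assms(1))
  show "integrable M01 (\<lambda>x. (cmod (f x))\<^sup>2)"
  proof (rule Bochner_Integration.integrable_bound[OF integrable_const_M01[of "B\<^sup>2"]])
    show "AE x in M01. norm ((cmod (f x))\<^sup>2) \<le> norm (B\<^sup>2)"
      using assms(2) by (intro AE_I2) (simp add: power_mono)
  qed (use assms(1) in measurable)
qed

lemma M01_integral_HK:
  fixes f :: "real \<Rightarrow> 'a::euclidean_space"
  assumes "integrable M01 f"
  shows "(f has_integral integral\<^sup>L M01 f) {0..1}"
proof -
  have "f integrable_on {0<..<1}" by (rule integrable_on_lebesgue_on[OF assms]) simp
  moreover have "integral\<^sup>L M01 f = integral {0<..<1} f" by (rule lebesgue_integral_eq_integral[OF assms]) simp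
  ultimately have "(f has_integral integral\<^sup>L M01 f) (box 0 1)" by (simp add: has_integral_integral)
  then show ?thesis by (simp add: has_integral_Icc_iff_Ioo)
qed

section \<open>Powers and logarithms\<close>

text \<open>The family of functions \<open>t\<^sup>s (A + B ln t)\<close>, \<open>t = 1 - x\<close>, is closed under
  differentiation and under multiplication by powers of \<open>t\<close>. It contains all solutions
  needed; the logarithm occurs only for \<open>\<alpha> = 1\<close>.\<close>

definition log_power :: "real \<Rightarrow> real \<Rightarrow> real \<Rightarrow> real \<Rightarrow> complex" where
  "log_power s A B x = complex_of_real ((1 - x) powr s * (A + B * ln (1 - x)))"

lemma log_power_has_vector_derivative:
  assumes "x < 1"
  shows "(log_power s A B has_vector_derivative log_power (s - 1) (- (s * A + B)) (- (s * B)) x) (at x within S)"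
  unfolding log_power_def[abs_def]
proof (rule has_vector_derivative_complex_of_real, rule DERIV_cong)
  show "((\<lambda>x. (1 - x) powr s * (A + B * ln (1 - x))) has_real_derivative
     - (s * (1 - x) powr (s - 1)) * (A + B * ln (1 - x)) + (1 - x) powr s * (- B / (1 - x))) (at x within S)"
  proof (rule DERIV_cong[OF DERIV_mult])
    have d: "((\<lambda>x. 1 - x) has_real_derivative - 1) (at x within S)"
      using DERIV_diff[OF DERIV_const DERIV_ident, of 1 x S] by simp
    show "((\<lambda>x. (1 - x) powr s) has_real_derivative s * (1 - x) powr (s - 1) * - 1) (at x within S)"
      by (rule DERIV_chain2[OF has_real_derivative_powr d]) (use assms in simp)
    show "((\<lambda>x. A + B * ln (1 - x)) has_real_derivative 0 + B * (1 / (1 - x) * - 1)) (at x within S)"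
      by (intro DERIV_add DERIV_const DERIV_cmult DERIV_chain2[OF DERIV_ln_divide d]) (use assms in simp)
  qed (use assms in \<open>simp add: algebra_simps\<close>)
  have e: "(1 - x) powr s / (1 - x) = (1 - x) powr (s - 1)"
    using assms by (simp add: powr_diff)
  have "(1 - x) powr s * (- B / (1 - x)) = - B * ((1 - x) powr s / (1 - x))" by simp
  also have "\<dots> = - B * (1 - x) powr (s - 1)" by (simp only: e)
  finally show "- (s * (1 - x) powr (s - 1)) * (A + B * ln (1 - x)) + (1 - x) powr s * (- B / (1 - x)) =
      (1 - x) powr (s - 1) * (- (s * A + B) + - (s * B) * ln (1 - x))"
    by (simp add: algebra_simps)
qed

lemma continuous_on_log_power: "S \<subseteq> {..<1} \<Longrightarrow> continuous_on S (log_power s A B)"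
  unfolding continuous_on_eq_continuous_within
  by (auto intro!: has_vector_derivative_continuous log_power_has_vector_derivative)

lemma inverse_power_mult_log_power:
  assumes "x < 1"
  shows "complex_of_real (c / (1 - x) ^ n) * log_power s A B x = log_power (s - real n) (c * A) (c * B) x"
  using assms unfolding log_power_def of_real_mult[symmetric]
  by (simp add: powr_diff powr_realpow algebra_simps)

lemma log_power_add: "log_power s A B x + log_power s A' B' x = log_power s (A + A') (B + B') x"
  by (simp add: log_power_def algebra_simps)

lemma log_power_minus: "- log_power s A B x = log_power s (- A) (- B) x"
  by (simp add: log_power_def algebra_simps)

lemma log_power_0 [simp]: "log_power s 0 0 x = 0"
  by (simp add: log_power_def)

lemma AC_loc_log_power: "AC_loc (log_power s A B)"
  by (rule continuously_differentiable_AC_loc[OF log_power_has_vector_derivative])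
     (auto intro: continuous_on_log_power)

lemma weak_solution_log_power:
  assumes "A' = (\<alpha>\<^sup>2 - 1/4 - s * (s - 1)) * A - (2 * s - 1) * B" "B' = (\<alpha>\<^sup>2 - 1/4 - s * (s - 1)) * B"
  shows "weak_solution \<alpha> (log_power s A B) (log_power (s - 1) (- (s * A + B)) (- (s * B))) (log_power (s - 2) A' B')"
proof (rule weak_solutionI)
  fix x :: real assume x: "0 \<le> x" "x < 1"
  show "(log_power s A B has_vector_derivative log_power (s - 1) (- (s * A + B)) (- (s * B)) x) (at x within {0..<1})"
    using x by (intro log_power_has_vector_derivative)
  have "potential \<alpha> x * log_power s A B x - log_power (s - 2) A' B' x = 
      log_power (s - 2) ((\<alpha>\<^sup>2 - 1/4) * A - A') ((\<alpha>\<^sup>2 - 1/4) * B - B') x"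
    unfolding potential_def using inverse_power_mult_log_power[OF x(2), of "\<alpha>\<^sup>2 - 1/4" 2 s A B] 
    by (simp add: log_power_def algebra_simps)
  moreover have "(\<alpha>\<^sup>2 - 1/4) * A - A' = - ((s - 1) * - (s * A + B) + - (s * B))"
    "(\<alpha>\<^sup>2 - 1/4) * B - B' = - ((s - 1) * - (s * B))"
    unfolding assms by (simp_all add: algebra_simps)
  ultimately show "(log_power (s - 1) (- (s * A + B)) (- (s * B)) has_vector_derivative 
      potential \<alpha> x * log_power s A B x - log_power (s - 2) A' B' x) (at x within {0..<1})"
    using log_power_has_vector_derivative[OF x(2), of "s - 1" "- (s * A + B)" "- (s * B)"] by simp
qed (auto intro: continuous_on_log_power)

lemma D01_cong:
  assumes "\<And>y. 0 \<le> y \<Longrightarrow> y < 1 \<Longrightarrow> f y = g y" "0 \<le> x" "x < 1"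
  shows "D01 f x = D01 g x"
proof -
  have x: "x \<in> {0..<1}" using assms by simp
  have "(f has_vector_derivative d) (at x within {0..<1}) \<longleftrightarrow> (g has_vector_derivative d) (at x within {0..<1})" for d
    using has_vector_derivative_transform[OF x, of f g d] has_vector_derivative_transform[OF x, of g f d] assms(1)
    by auto
  then show ?thesis unfolding D01_def vector_derivative_def by simp
qed

lemma D01_log_power:
  assumes "\<And>y. 0 \<le> y \<Longrightarrow> y < 1 \<Longrightarrow> f y = log_power s A B y" "0 \<le> x" "x < 1"
  shows "D01 f x = log_power (s - 1) (- (s * A + B)) (- (s * B)) x"
  by (rule trans[OF D01_cong[OF assms] D01_eq[OF assms(2,3) log_power_has_vector_derivative[OF assms(3)]]])

lemma log_power_in_T2max:
  assumes "square_integrable (log_power s A B)" "square_integrable (log_power (s - 2) A' B')"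
    and eq: "A' = (\<alpha>\<^sup>2 - 1/4 - s * (s - 1)) * A - (2 * s - 1) * B" "B' = (\<alpha>\<^sup>2 - 1/4 - s * (s - 1)) * B"
  shows "(abs_L2 (log_power s A B), abs_L2 (log_power (s - 2) A' B')) \<in> T2max \<alpha>"
proof -
  let ?f = "log_power s A B" and ?k = "log_power (s - 2) A' B'"
  have D1: "D01 ?f x = log_power (s - 1) (- (s * A + B)) (- (s * B)) x" if "0 \<le> x" "x < 1" for x
    by (rule D01_log_power[OF refl that])
  have D2: "D01 (D01 ?f) x = log_power (s - 2) (- ((s - 1) * - (s * A + B) + - (s * B))) (- ((s - 1) * - (s * B))) x"
    if "0 \<le> x" "x < 1" for x
    using D01_log_power[OF D1 that] by simp
  have tau: "tau2 \<alpha> ?f x = ?k x" if "0 < x" "x < 1" for x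
  proof -
    have "tau2 \<alpha> ?f x = - log_power (s - 2) (- ((s - 1) * - (s * A + B) + - (s * B))) (- ((s - 1) * - (s * B))) x
       + log_power (s - 2) ((\<alpha>\<^sup>2 - 1/4) * A) ((\<alpha>\<^sup>2 - 1/4) * B) x"
      unfolding tau2_def using that D2[of x] inverse_power_mult_log_power[OF that(2), of "\<alpha>\<^sup>2 - 1/4" 2 s A B]
      by simp
    also have "\<dots> = log_power (s - 2) (- (- ((s - 1) * - (s * A + B) + - (s * B))) + (\<alpha>\<^sup>2 - 1/4) * A)
        (- (- ((s - 1) * - (s * B))) + (\<alpha>\<^sup>2 - 1/4) * B) x"
      unfolding log_power_minus log_power_add ..
    also have "\<dots> = ?k x" unfolding eq by (rule arg_cong2[where f="\<lambda>a b. log_power (s - 2) a b x"]) (simp_all add: algebra_simps)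
    finally show ?thesis .
  qed
  have sq: "square_integrable (tau2 \<alpha> ?f)"
    using square_integrable_cong[of "tau2 \<alpha> ?f" ?k] tau assms(2) by blast
  have "AC_loc (D01 ?f)"
    by (rule AC_loc_cong[THEN iffD2, OF D1 AC_loc_log_power])
  moreover have "abs_L2 (tau2 \<alpha> ?f) = abs_L2 ?k"
    using sq assms(2) tau by (subst abs_L2_eq_iff) auto
  ultimately show ?thesis
    unfolding T2max_def using assms(1) sq AC_loc_log_power[of s A B] by (intro CollectI exI[of _ ?f] conjI) simp_all
qed

text \<open>The two last hypotheses say that the coefficients of \<open>\<tau>\<^sub>4\<close> applied to \<open>t\<^sup>s
  (A + B ln t)\<close> vanish.\<close>

lemma log_power_in_T4max:
  fixes \<alpha> s A B :: real
  defines "A1 \<equiv> - (s * A + B)" and "B1 \<equiv> - (s * B)"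
  defines "A2 \<equiv> - ((s - 1) * A1 + B1)" and "B2 \<equiv> - ((s - 1) * B1)"
  defines "A3 \<equiv> - ((s - 2) * A2 + B2)" and "B3 \<equiv> - ((s - 2) * B2)"
  assumes sqf: "square_integrable (log_power s A B)"
    and A0: "- ((s - 3) * A3 + B3) + (2 * \<alpha>\<^sup>2 - 1/2) * ((s - 3) * A1 + B1) + (\<alpha> ^ 4 - 13/2 * \<alpha>\<^sup>2 + (5/4)\<^sup>2) * A = 0"
    and B0: "- ((s - 3) * B3) + (2 * \<alpha>\<^sup>2 - 1/2) * ((s - 3) * B1) + (\<alpha> ^ 4 - 13/2 * \<alpha>\<^sup>2 + (5/4)\<^sup>2) * B = 0"
  shows "(abs_L2 (log_power s A B), 0) \<in> T4max \<alpha>"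
proof -
  let ?f = "log_power s A B"
  have D1: "D01 ?f x = log_power (s - 1) A1 B1 x" if "0 \<le> x" "x < 1" for x
    unfolding A1_def B1_def by (rule D01_log_power[OF refl that])
  have D2: "D01 (D01 ?f) x = log_power (s - 2) A2 B2 x" if "0 \<le> x" "x < 1" for x
    using D01_log_power[OF D1 that] by (simp add: A2_def B2_def)
  have D3: "D01 (D01 (D01 ?f)) x = log_power (s - 3) A3 B3 x" if "0 \<le> x" "x < 1" for x
    using D01_log_power[OF D2 that] by (simp add: A3_def B3_def)
  have D4: "D01 (D01 (D01 (D01 ?f))) x = log_power (s - 4) (- ((s - 3) * A3 + B3)) (- ((s - 3) * B3)) x" if "0 \<le> x" "x < 1" for x
    using D01_log_power[OF D3 that] by simp
  define c where "c = 2 * \<alpha>\<^sup>2 - 1/2"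
  define d where "d = \<alpha> ^ 4 - 13/2 * \<alpha>\<^sup>2 + (5/4)\<^sup>2"
  have E: "complex_of_real (c / (1 - x)\<^sup>2) * D01 ?f x = log_power (s - 3) (c * A1) (c * B1) x" if "0 \<le> x" "x < 1" for x
    using D1[OF that] inverse_power_mult_log_power[OF that(2), of c 2 "s - 1" A1 B1] by simp
  have tau: "tau4 \<alpha> ?f x = 0" if "0 < x" "x < 1" for x
  proof -
    have x: "0 \<le> x" "x < 1" using that by auto
    have "tau4 \<alpha> ?f x = log_power (s - 4) (- ((s - 3) * A3 + B3)) (- ((s - 3) * B3)) x
       + - log_power (s - 4) (- ((s - 3) * (c * A1) + c * B1)) (- ((s - 3) * (c * B1))) x
       + log_power (s - 4) (d * A) (d * B) x"
      unfolding tau4_def c_def[symmetric] d_def[symmetric] D4[OF x]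
      using D01_log_power[OF E x] inverse_power_mult_log_power[OF x(2), of d 4 s A B] by simp
    also have "\<dots> = log_power (s - 4) (- ((s - 3) * A3 + B3) + c * ((s - 3) * A1 + B1) + d * A)
        (- ((s - 3) * B3) + c * ((s - 3) * B1) + d * B) x"
      unfolding log_power_add log_power_minus
      by (rule arg_cong2[where f="\<lambda>a b. log_power (s - 4) a b x"]) (simp_all add: algebra_simps)
    also have "\<dots> = 0" unfolding c_def d_def A0 B0 by simp
    finally show ?thesis .
  qed
  have sq: "square_integrable (tau4 \<alpha> ?f)"
    using square_integrable_cong[of "tau4 \<alpha> ?f" "\<lambda>x. 0"] tau square_integrable_zero by blast
  have "AC_loc (D01 ?f)" by (rule AC_loc_cong[THEN iffD2, OF D1 AC_loc_log_power])
  moreover have "AC_loc (D01 (D01 ?f))" by (rule AC_loc_cong[THEN iffD2, OF D2 AC_loc_log_power])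
  moreover have "AC_loc (D01 (D01 (D01 ?f)))" by (rule AC_loc_cong[THEN iffD2, OF D3 AC_loc_log_power])
  moreover have "abs_L2 (tau4 \<alpha> ?f) = 0"
    unfolding zero_L2_abs using sq square_integrable_zero tau by (subst abs_L2_eq_iff) auto
  ultimately show ?thesis
    unfolding T4max_def using sqf sq AC_loc_log_power[of s A B] by (intro CollectI exI[of _ ?f] conjI) simp_all
qed

section \<open>Membership in the minimal operator\<close>

lemma measurable_M01_borel: "f \<in> borel_measurable borel \<Longrightarrow> f \<in> borel_measurable M01"
  by (intro measurable_restrict_space1 measurable_completion) simp

lemma AC_loc_imp_continuous_on:
  assumes "AC_loc f"
  shows "continuous_on {0..<1} f"
  unfolding continuous_on_eq_continuous_within
proof
  fix x :: real assume x: "x \<in> {0..<1}"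
  have "AC_on 0 ((x + 1) / 2) f" using assms x by (simp add: AC_loc_def)
  then have "continuous (at x within {0..(x + 1) / 2}) f"
    using AC_on_imp_continuous_on x by (simp add: continuous_on_eq_continuous_within)
  moreover have "at x within {0..(x + 1) / 2} = at x within {0..<1}"
    by (rule at_within_nhd[of _ "{..<(x + 1) / 2}"]) (use x in auto)
  ultimately show "continuous (at x within {0..<1}) f" by simp
qed

lemma AC_loc_measurable: "AC_loc f \<Longrightarrow> f \<in> borel_measurable M01"
  by (rule measurable_M01_continuous) (auto intro: continuous_on_subset[OF AC_loc_imp_continuous_on])

text \<open>A majorant, up to a constant, of the error produced by the cutoff function \<open>(1 -
  e/t)\<^sup>2\<close> on \<open>e \<le> t = 1 - x\<close>. It is bounded in \<open>L\<^sup>2\<close> uniformly in \<open>e\<close> and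
  tends to \<open>0\<close> pointwise.\<close>

definition cutoff_weight :: "real \<Rightarrow> real \<Rightarrow> real" where
  "cutoff_weight e x = (if x \<le> 1 - e then e * (1 - x) powr (- 3/2) else 0)"

lemma cutoff_weight_measurable: "cutoff_weight e \<in> borel_measurable M01"
  unfolding cutoff_weight_def[abs_def] by (intro measurable_M01_borel) measurable

lemma cutoff_weight_nonneg: "0 < e \<Longrightarrow> 0 \<le> cutoff_weight e x"
  by (simp add: cutoff_weight_def)

lemma cutoff_weight_square_integral:
  assumes e: "0 < e" "e < 1"
  shows "integrable M01 (\<lambda>x. (cutoff_weight e x)\<^sup>2)" "(\<integral>x. (cutoff_weight e x)\<^sup>2 \<partial>M01) \<le> 1"
proof -
  have sq: "(cutoff_weight e x)\<^sup>2 = (if x \<in> {0..1 - e} then e\<^sup>2 / (1 - x) ^ 3 else 0)" if "0 \<le> x" for x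
  proof (cases "x \<le> 1 - e")
    case True
    then have x: "0 < 1 - x" using e by simp
    have "((1 - x) powr (- 3/2))\<^sup>2 = (1 - x) powr (- 3)" using x by (simp add: powr_power)
    also have "\<dots> = inverse ((1 - x) ^ 3)" using powr_minus[of "1 - x" 3] powr_numeral[OF less_imp_le[OF x], of "num.Bit1 num.One"] by simp
    finally have "((1 - x) powr (- 3/2))\<^sup>2 = inverse ((1 - x) ^ 3)" .
    moreover have "(cutoff_weight e x)\<^sup>2 = e\<^sup>2 * ((1 - x) powr (- 3/2))\<^sup>2"
      using True by (simp only: cutoff_weight_def power_mult_distrib if_True)
    ultimately have "(cutoff_weight e x)\<^sup>2 = e\<^sup>2 / (1 - x) ^ 3" by (simp only: divide_inverse)
    then show ?thesis using True that by simp
  qed (use that in \<open>simp add: cutoff_weight_def\<close>)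
  show int: "integrable M01 (\<lambda>x. (cutoff_weight e x)\<^sup>2)"
  proof (rule Bochner_Integration.integrable_bound[OF integrable_const_M01[of "e\<^sup>2 / e ^ 3"]])
    show "(\<lambda>x. (cutoff_weight e x)\<^sup>2) \<in> borel_measurable M01"
      using cutoff_weight_measurable by measurable
    show "AE x in M01. norm ((cutoff_weight e x)\<^sup>2) \<le> norm (e\<^sup>2 / e ^ 3)"
      using e by (intro AE_I2) (auto simp: sq intro!: divide_left_mono power_mono mult_pos_pos)
  qed
  have "((\<lambda>x. e\<^sup>2 / (1 - x) ^ 3) has_integral (e\<^sup>2 / 2) / (1 - (1 - e)) ^ 2 - (e\<^sup>2 / 2) / (1 - 0) ^ 2) {0..1 - e}"
  proof (rule fundamental_theorem_of_calculus)
    show "((\<lambda>x. (e\<^sup>2 / 2) / (1 - x) ^ 2) has_vector_derivative e\<^sup>2 / (1 - x) ^ 3) (at x within {0..1 - e})"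
      if "x \<in> {0..1 - e}" for x
      using has_real_derivative_inverse_power[of x "e\<^sup>2 / 2" 1] that e
      by (simp add: has_real_derivative_iff_has_vector_derivative numeral_eq_Suc)
  qed (use e in auto)
  then have "((\<lambda>x. if x \<in> {0..1 - e} then e\<^sup>2 / (1 - x) ^ 3 else 0) has_integral 1/2 - e\<^sup>2 / 2) {0..1}"
    using e by (subst has_integral_restrict) (auto simp: power2_eq_square)
  then have "((\<lambda>x. (cutoff_weight e x)\<^sup>2) has_integral 1/2 - e\<^sup>2 / 2) {0..1}"
    by (rule has_integral_eq[rotated]) (auto simp: sq)
  from has_integral_unique[OF this M01_integral_HK[OF int]] zero_le_power2[of e]
  show "(\<integral>x. (cutoff_weight e x)\<^sup>2 \<partial>M01) \<le> 1" by linarith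
qed

text \<open>The weights do not tend to \<open>0\<close> in \<open>L\<^sup>2\<close>, but weakly. Where \<open>|f| \<le> \<delta> w\<close> the
  integrand is at most \<open>\<delta> w\<^sup>2\<close>, of integral at most \<open>\<delta>\<close>; elsewhere it is
  at most \<open>|f|\<^sup>2 / \<delta>\<close>, and dominated convergence applies to the minimum of the
  two.\<close>

lemma cutoff_weight_tendsto_0:
  assumes f: "square_integrable f" and e: "\<And>n. 0 < e n" "\<And>n. e n < 1" "e \<longlonglongrightarrow> 0"
  shows "integrable M01 (\<lambda>x. cmod (f x) * cutoff_weight (e n) x)"
    and "(\<lambda>n. \<integral>x. cmod (f x) * cutoff_weight (e n) x \<partial>M01) \<longlonglongrightarrow> 0"
proof -
  have fm [measurable]: "f \<in> borel_measurable M01" and f2: "integrable M01 (\<lambda>x. (cmod (f x))\<^sup>2)"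
    using f by (auto simp: square_integrable_def)
  note [measurable] = cutoff_weight_measurable
  note w0 = cutoff_weight_nonneg[OF e(1)]
  note w2 = cutoff_weight_square_integral[OF e(1,2)]
  have int: "integrable M01 (\<lambda>x. cmod (f x) * cutoff_weight (e n) x)" for n
  proof (rule Bochner_Integration.integrable_bound)
    show "integrable M01 (\<lambda>x. (cmod (f x))\<^sup>2 + (cutoff_weight (e n) x)\<^sup>2)" using f2 w2 by auto
    show "(\<lambda>x. cmod (f x) * cutoff_weight (e n) x) \<in> borel_measurable M01" by measurable
    have "cmod (f x) * cutoff_weight (e n) x \<le> (cmod (f x))\<^sup>2 + (cutoff_weight (e n) x)\<^sup>2" for x
      using sum_squares_bound[of "cmod (f x)" "cutoff_weight (e n) x"] w0[of n x]
        mult_nonneg_nonneg[of "cmod (f x)" "cutoff_weight (e n) x"] norm_ge_zero[of "f x"] by linarith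
    then show "AE x in M01. norm (cmod (f x) * cutoff_weight (e n) x) \<le> norm ((cmod (f x))\<^sup>2 + (cutoff_weight (e n) x)\<^sup>2)"
      using w0 by simp
  qed
  then show "integrable M01 (\<lambda>x. cmod (f x) * cutoff_weight (e n) x)" .
  have nonneg: "0 \<le> (\<integral>x. cmod (f x) * cutoff_weight (e n) x \<partial>M01)" for n
    using w0 by (intro integral_nonneg_AE) auto
  show "(\<lambda>n. \<integral>x. cmod (f x) * cutoff_weight (e n) x \<partial>M01) \<longlonglongrightarrow> 0"
  proof (rule tendstoI)
    fix r :: real assume "0 < r"
    define \<delta> where "\<delta> = r / 2"
    have \<delta>: "0 < \<delta>" using \<open>0 < r\<close> by (simp add: \<delta>_def)
    define m where "m = (\<lambda>n x. min (cmod (f x) * cutoff_weight (e n) x) ((cmod (f x))\<^sup>2 / \<delta>))"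
    have m0: "0 \<le> m n x" for n x using w0 \<delta> by (simp add: m_def)
    have mm: "m n \<in> borel_measurable M01" for n unfolding m_def by measurable
    have "(\<lambda>n. \<integral>x. m n x \<partial>M01) \<longlonglongrightarrow> (\<integral>x. 0 \<partial>M01)"
    proof (rule integral_dominated_convergence[where w="\<lambda>x. (cmod (f x))\<^sup>2 / \<delta>"])
      show "integrable M01 (\<lambda>x. (cmod (f x))\<^sup>2 / \<delta>)" using f2 by simp
      show "AE x in M01. (\<lambda>n. m n x) \<longlonglongrightarrow> 0"
      proof (rule AE_I2)
        fix x
        have lim: "(\<lambda>n. cmod (f x) * (e n * (1 - x) powr (- 3/2))) \<longlonglongrightarrow> 0"
          using tendsto_mult_left[OF tendsto_mult_right[OF e(3), of "(1 - x) powr (- 3/2)"], of "cmod (f x)"] by simp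
        have up: "m n x \<le> cmod (f x) * (e n * (1 - x) powr (- 3/2))" for n
        proof -
          have "cutoff_weight (e n) x \<le> e n * (1 - x) powr (- 3/2)"
            using e(1)[of n] by (auto simp: cutoff_weight_def)
          then have "cmod (f x) * cutoff_weight (e n) x \<le> cmod (f x) * (e n * (1 - x) powr (- 3/2))"
            by (intro mult_left_mono) auto
          then show ?thesis by (simp add: m_def min.coboundedI1)
        qed
        show "(\<lambda>n. m n x) \<longlonglongrightarrow> 0"
          by (rule tendsto_sandwich[OF _ _ tendsto_const lim]) (use m0 up in auto)
      qed
      show "AE x in M01. norm (m n x) \<le> (cmod (f x))\<^sup>2 / \<delta>" for n
        using m0 by (intro AE_I2) (simp add: m_def)
    qed (use mm in auto)
    then have "\<forall>\<^sub>F n in sequentially. (\<integral>x. m n x \<partial>M01) < \<delta>"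
      using \<delta> by (intro order_tendstoD) auto
    then show "\<forall>\<^sub>F n in sequentially. dist (\<integral>x. cmod (f x) * cutoff_weight (e n) x \<partial>M01) 0 < r"
    proof eventually_elim
      case (elim n)
      have mint: "integrable M01 (m n)"
        by (rule Bochner_Integration.integrable_bound[OF int[of n] mm]) (use m0 w0 in \<open>simp add: m_def\<close>)
      have "(\<integral>x. cmod (f x) * cutoff_weight (e n) x \<partial>M01) \<le> (\<integral>x. m n x + \<delta> * (cutoff_weight (e n) x)\<^sup>2 \<partial>M01)"
      proof (rule integral_mono[OF int])
        show "integrable M01 (\<lambda>x. m n x + \<delta> * (cutoff_weight (e n) x)\<^sup>2)" using mint w2 by auto
        fix x
        show "cmod (f x) * cutoff_weight (e n) x \<le> m n x + \<delta> * (cutoff_weight (e n) x)\<^sup>2"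
        proof (cases "cmod (f x) \<le> \<delta> * cutoff_weight (e n) x")
          case True
          from mult_right_mono[OF this w0[of n x]] m0[of n x] show ?thesis by (simp add: power2_eq_square)
        next
          case False
          then have "cutoff_weight (e n) x \<le> cmod (f x) / \<delta>" using \<delta> by (simp add: field_simps)
          from mult_left_mono[OF this norm_ge_zero[of "f x"]] \<delta> show ?thesis
            by (simp add: m_def power2_eq_square min_def)
        qed
      qed
      also have "\<dots> = (\<integral>x. m n x \<partial>M01) + \<delta> * (\<integral>x. (cutoff_weight (e n) x)\<^sup>2 \<partial>M01)"
        using mint w2 by simp
      also have "\<dots> < \<delta> + \<delta> * 1"
        using elim mult_left_mono[OF w2(2)[of n], of \<delta>] \<delta> by linarith
      finally show ?case using nonneg[of n] by (simp add: \<delta>_def dist_real_def)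
    qed
  qed
qed

lemma weak_solution_mult_smooth:
  assumes g: "weak_solution \<alpha> g g' h"
    and \<psi>: "\<And>x. 0 \<le> x \<Longrightarrow> x < 1 \<Longrightarrow> (\<psi> has_vector_derivative \<psi>' x) (at x within {0..<1})"
    and \<psi>': "\<And>x. 0 \<le> x \<Longrightarrow> x < 1 \<Longrightarrow> (\<psi>' has_vector_derivative \<psi>'' x) (at x within {0..<1})"
    and \<psi>'': "continuous_on {0..<1} \<psi>''"
  shows "weak_solution \<alpha> (\<lambda>x. \<psi> x * g x) (\<lambda>x. \<psi> x * g' x + \<psi>' x * g x)
           (\<lambda>x. \<psi> x * h x - (2 * \<psi>' x * g' x + \<psi>'' x * g x))"
  unfolding weak_solution_def
proof (intro conjI)
  have "continuous_on {0..<1} \<psi>'"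
    using \<psi>' by (auto simp: continuous_on_eq_continuous_within intro!: has_vector_derivative_continuous)
  then have AC: "AC_loc \<psi>" "AC_loc \<psi>'"
    using \<psi> \<psi>' \<psi>'' by (auto intro: continuously_differentiable_AC_loc)
  have g': "AC_loc g" "AC_loc g'" using g by (auto simp: weak_solution_def)
  show "AC_loc (\<lambda>x. \<psi> x * g x)" "AC_loc (\<lambda>x. \<psi> x * g' x + \<psi>' x * g x)"
    by (intro AC_loc_add AC_loc_mult AC g')+
  have "AE x in M01. 0 < x \<and> x < 1" unfolding AE_M01_iff by auto
  with conjunct2[OF conjunct2[OF g[unfolded weak_solution_def]]]
  show "AE x in M01. ((\<lambda>x. \<psi> x * g x) has_vector_derivative \<psi> x * g' x + \<psi>' x * g x) (at x) \<and>
     ((\<lambda>x. \<psi> x * g' x + \<psi>' x * g x) has_vector_derivative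
       (potential \<alpha> x * (\<psi> x * g x) - (\<psi> x * h x - (2 * \<psi>' x * g' x + \<psi>'' x * g x)))) (at x)"
  proof eventually_elim
    case (elim x)
    have d: "(\<psi> has_vector_derivative \<psi>' x) (at x)" "(\<psi>' has_vector_derivative \<psi>'' x) (at x)"
      using \<psi>[of x] \<psi>'[of x] elim by (auto simp: at_within_01)
    have "((\<lambda>x. \<psi> x * g x) has_vector_derivative \<psi> x * g' x + \<psi>' x * g x) (at x)"
      using d elim by (intro has_vector_derivative_mult) auto
    moreover have "((\<lambda>x. \<psi> x * g' x + \<psi>' x * g x) has_vector_derivative
        (\<psi> x * (potential \<alpha> x * g x - h x) + \<psi>' x * g' x) + (\<psi>' x * g' x + \<psi>'' x * g x)) (at x)"
      using d elim by (intro has_vector_derivative_add has_vector_derivative_mult) auto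
    ultimately show ?case by (simp add: algebra_simps)
  qed
qed

text \<open>This is where \<open>\<alpha> \<ge> 1\<close> enters: the worst power \<open>t^(\<alpha> - 5/2)\<close> is then at
  most \<open>t^(-3/2)\<close>, the power in the weight.\<close>

lemma cutoff_derivative_bounds:
  fixes e t :: real
  assumes e: "0 < e" and t: "e \<le> t" "t \<le> 1" and \<alpha>: "1 \<le> \<alpha>"
    and G: "cmod G \<le> C * t powr (\<alpha> + 1/2)" and G': "cmod G' \<le> C * t powr (\<alpha> - 1/2)" and C: "0 \<le> C"
    and P1: "\<bar>P1\<bar> \<le> 2 * e / t\<^sup>2" and P2: "\<bar>P2\<bar> \<le> 6 * e / t ^ 3"
  shows "cmod (2 * complex_of_real P1 * G' + complex_of_real P2 * G) \<le> 10 * C * (e * t powr (- 3/2))"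
proof -
  have t0: "0 < t" using e t by simp
  have p: "t powr (\<alpha> - 1/2) / t\<^sup>2 \<le> t powr (- 3/2)" "t powr (\<alpha> + 1/2) / t ^ 3 \<le> t powr (- 3/2)"
  proof -
    have "t powr 2 = t\<^sup>2" "t powr 3 = t ^ 3" using t0 by simp_all
    then have "t powr (\<alpha> - 1/2) / t\<^sup>2 = t powr (\<alpha> - 1/2 - 2)" "t powr (\<alpha> + 1/2) / t ^ 3 = t powr (\<alpha> + 1/2 - 3)"
      by (simp_all only: powr_diff)
    then have "t powr (\<alpha> - 1/2) / t\<^sup>2 = t powr (\<alpha> - 5/2)" "t powr (\<alpha> + 1/2) / t ^ 3 = t powr (\<alpha> - 5/2)"
      by simp_all
    moreover have "t powr (\<alpha> - 5/2) \<le> t powr (- 3/2)"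
      using t0 t \<alpha> by (intro powr_mono') auto
    ultimately show "t powr (\<alpha> - 1/2) / t\<^sup>2 \<le> t powr (- 3/2)" "t powr (\<alpha> + 1/2) / t ^ 3 \<le> t powr (- 3/2)"
      by simp_all
  qed
  have "cmod (2 * complex_of_real P1 * G' + complex_of_real P2 * G) \<le> 2 * \<bar>P1\<bar> * cmod G' + \<bar>P2\<bar> * cmod G"
    by (rule order_trans[OF norm_triangle_ineq]) (simp add: norm_mult)
  also have "\<dots> \<le> 2 * (2 * e / t\<^sup>2) * (C * t powr (\<alpha> - 1/2)) + (6 * e / t ^ 3) * (C * t powr (\<alpha> + 1/2))"
    using e t0 C by (intro add_mono mult_mono P1 P2 G G') auto
  also have "\<dots> = 4 * (e * C) * (t powr (\<alpha> - 1/2) / t\<^sup>2) + 6 * (e * C) * (t powr (\<alpha> + 1/2) / t ^ 3)"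
    by simp
  also have "\<dots> \<le> 4 * (e * C) * t powr (- 3/2) + 6 * (e * C) * t powr (- 3/2)"
    using e C by (intro add_mono mult_left_mono p) auto
  finally show ?thesis by (simp add: algebra_simps)
qed

text \<open>Let \<open>f\<close> be in the domain of the maximal operator. The Lagrange identity on \<open>[0, 1 - e]\<close> with
  \<open>g\<close> multiplied by \<open>(1 - e/(1 - x))\<^sup>2\<close> has no boundary terms at all, for this factor
  has a double zero at the right end, and \<open>g\<close> has one at \<open>0\<close>. As \<open>e\<close> tends to \<open>0\<close>, the terms
  containing derivatives of the factor disappear, and what remains is the defining identity
  of the adjoint. The conjugates are forced by the sesquilinear inner product.\<close>

theorem decaying_solution_in_T2min:
  assumes \<alpha>: "1 \<le> \<alpha>" and sol: "weak_solution \<alpha> g g' h"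
    and sq: "square_integrable g" "square_integrable h"
    and init: "g 0 = 0" "g' 0 = 0"
    and decay: "\<And>x. 0 \<le> x \<Longrightarrow> x < 1 \<Longrightarrow> cmod (g x) \<le> C * (1 - x) powr (\<alpha> + 1/2)"
      "\<And>x. 0 \<le> x \<Longrightarrow> x < 1 \<Longrightarrow> cmod (g' x) \<le> C * (1 - x) powr (\<alpha> - 1/2)"
  shows "(abs_L2 (\<lambda>x. cnj (g x)), abs_L2 (\<lambda>x. cnj (h x))) \<in> T2min \<alpha>"
  unfolding T2min_def adjoint_L2_def
proof (clarify)
  fix F G assume "(F, G) \<in> T2max \<alpha>"
  then obtain f f' k where f: "F = abs_L2 f" "G = abs_L2 k" "square_integrable f" "square_integrable k"
    and fsol: "weak_solution \<alpha> f f' k" by (rule T2maxE)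
  define K where "K = (\<lambda>x. k x * g x - f x * h x)"
  have K: "integrable M01 K"
    unfolding K_def by (intro Bochner_Integration.integrable_diff integrable_mult_square_integrable f sq)
  define e where "e = (\<lambda>n::nat. inverse (real (Suc (Suc n))))"
  have e: "0 < e n" "e n < 1" for n by (simp_all add: e_def inverse_less_1_iff)
  have e_lim: "e \<longlonglongrightarrow> 0"
    unfolding e_def by (rule LIMSEQ_Suc[OF LIMSEQ_inverse_real_of_nat])
  \<comment> \<open>\<open>P0\<close> is the cutoff function on the part \<open>e \<le> 1 - x\<close>; \<open>P1\<close> and \<open>P2\<close> are its
    derivatives.\<close>
  define P0 where "P0 = (\<lambda>n x. (1 - e n / (1 - x))\<^sup>2)"
  define P1 where "P1 = (\<lambda>n x. - 2 * (1 - e n / (1 - x)) * (e n / (1 - x)\<^sup>2))"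
  define P2 where "P2 = (\<lambda>n x. 2 * (e n / (1 - x)\<^sup>2)\<^sup>2 - 2 * (1 - e n / (1 - x)) * (2 * e n / (1 - x) ^ 3))"
  have d0: "(P0 n has_real_derivative P1 n x) (at x within S)" if "x < 1" for n x S
  proof -
    have z: "((\<lambda>x. 1 - e n / (1 - x)) has_real_derivative 0 - e n / (1 - x)\<^sup>2) (at x within S)"
      using has_real_derivative_inverse_power[OF that, of "e n" 0 S]
      by (intro DERIV_diff DERIV_const) (simp add: numeral_eq_Suc)
    have eq: "real 2 * ((0 - s) * z ^ (2 - Suc 0)) = - 2 * z * s" for s z :: real by simp
    show ?thesis unfolding P0_def P1_def
      by (rule DERIV_cong[OF DERIV_power[OF z]]) (rule eq)
  qed
  have d1: "(P1 n has_real_derivative P2 n x) (at x within S)" if "x < 1" for n x S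
  proof -
    have z: "((\<lambda>x. - 2 * (1 - e n / (1 - x))) has_real_derivative - 2 * (0 - e n / (1 - x)\<^sup>2)) (at x within S)"
      using has_real_derivative_inverse_power[OF that, of "e n" 0 S]
      by (intro DERIV_cmult DERIV_diff DERIV_const) (simp add: numeral_eq_Suc)
    have z2: "((\<lambda>x. e n / (1 - x)\<^sup>2) has_real_derivative 2 * e n / (1 - x) ^ 3) (at x within S)"
      using has_real_derivative_inverse_power[OF that, of "e n" 1 S] by (simp add: numeral_eq_Suc)
    have eq: "- 2 * (0 - s) * s + r * (- 2 * z) = 2 * s\<^sup>2 - 2 * z * r" for r s z :: real
      by (simp add: power2_eq_square)
    show ?thesis unfolding P1_def P2_def
      by (rule DERIV_cong[OF DERIV_mult[OF z z2]]) (rule eq)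
  qed
  have cP2: "continuous_on {0..<1} (P2 n)" for n
    unfolding P2_def by (intro continuous_intros) auto
  have bounds: "0 \<le> P0 n x \<and> P0 n x \<le> 1 \<and> \<bar>P1 n x\<bar> \<le> 2 * e n / (1 - x)\<^sup>2 \<and> \<bar>P2 n x\<bar> \<le> 6 * e n / (1 - x) ^ 3"
    if x: "0 \<le> x" "x \<le> 1 - e n" for n x
  proof -
    define t where "t = 1 - x"
    define z where "z = e n / t"
    have t: "0 < t" using x e[of n] by (simp add: t_def)
    have z: "0 \<le> z" "z \<le> 1" using x e[of n] t by (simp_all add: z_def t_def divide_le_eq)
    have "P1 n x = - ((1 - z) * (2 * (e n / t\<^sup>2)))"
      unfolding P1_def t_def[symmetric] z_def[symmetric] by (simp only: mult.commute mult.left_commute mult_minus_left)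
    moreover have "0 \<le> (1 - z) * (2 * (e n / t\<^sup>2))" using z t e[of n] by (intro mult_nonneg_nonneg) auto
    ultimately have "\<bar>P1 n x\<bar> = (1 - z) * (2 * (e n / t\<^sup>2))" by (simp only: abs_minus_cancel abs_of_nonneg)
    also have "\<dots> \<le> 1 * (2 * (e n / t\<^sup>2))" using z e[of n] t by (intro mult_right_mono) auto
    finally have 1: "\<bar>P1 n x\<bar> \<le> 2 * e n / (1 - x)\<^sup>2" by (simp add: t_def)
    define d where "d = e n / t ^ 3"
    have "(e n / t\<^sup>2)\<^sup>2 = z * d" "2 * e n / t ^ 3 = 2 * d"
      by (simp_all add: z_def d_def power2_eq_square power3_eq_cube)
    then have "P2 n x = 2 * (z * d) - 2 * (1 - z) * (2 * d)"
      unfolding P2_def t_def[symmetric] z_def[symmetric] by (simp only:)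
    also have "\<dots> = (6 * z - 4) * d" by (simp add: algebra_simps)
    also have "d = e n / t ^ 3" by (rule d_def)
    finally have "\<bar>P2 n x\<bar> = \<bar>6 * z - 4\<bar> * (e n / t ^ 3)" using t e[of n] by (simp add: abs_mult)
    also have "\<dots> \<le> 6 * (e n / t ^ 3)" using z t e[of n] by (intro mult_right_mono) auto
    finally have 2: "\<bar>P2 n x\<bar> \<le> 6 * e n / (1 - x) ^ 3" by (simp add: t_def)
    have "P0 n x = (1 - z)\<^sup>2" by (simp add: P0_def z_def t_def)
    then have "0 \<le> P0 n x" "P0 n x \<le> 1" using z by (auto intro: power_le_one)
    with 1 2 show ?thesis by blast
  qed
  define p0 where "p0 = (\<lambda>n x. complex_of_real (P0 n x))"
  define p1 where "p1 = (\<lambda>n x. complex_of_real (P1 n x))"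
  define p2 where "p2 = (\<lambda>n x. complex_of_real (P2 n x))"
  define R where "R = (\<lambda>n x. f x * (2 * p1 n x * g' x + p2 n x * g x))"
  define Kn where "Kn = (\<lambda>n x. if x \<le> 1 - e n then p0 n x * K x else 0)"
  define Rn where "Rn = (\<lambda>n x. if x \<le> 1 - e n then R n x else 0)"
  have fm: "f \<in> borel_measurable M01" "K \<in> borel_measurable M01" using f K by (auto simp: square_integrable_def)
  have gm: "g \<in> borel_measurable M01" "g' \<in> borel_measurable M01"
    using sol by (auto simp: weak_solution_def intro: AC_loc_measurable)
  have Pm: "P0 n \<in> borel_measurable M01" "P1 n \<in> borel_measurable M01" "P2 n \<in> borel_measurable M01" for n
    unfolding P0_def P1_def P2_def by (intro measurable_M01_borel; measurable)+
  have cm: "(\<lambda>x. complex_of_real (u x)) \<in> borel_measurable M01" if "u \<in> borel_measurable M01" for u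
    by (rule measurable_compose[OF that]) (auto intro!: borel_measurable_continuous_onI continuous_intros)
  have lm: "{x \<in> space M01. x \<le> c} \<in> sets M01" for c :: real
  proof -
    have [measurable]: "(\<lambda>x::real. x) \<in> borel_measurable M01" by (rule measurable_M01_borel) simp
    show ?thesis by measurable
  qed
  have Knm: "Kn n \<in> borel_measurable M01" for n
    unfolding Kn_def p0_def by (intro measurable_If borel_measurable_times cm Pm fm lm borel_measurable_const)
  have Rnm: "Rn n \<in> borel_measurable M01" for n
    unfolding Rn_def R_def p1_def p2_def
    by (intro measurable_If borel_measurable_times borel_measurable_add cm Pm fm gm lm borel_measurable_const)
  have C0: "0 \<le> C" using decay(1)[of 0] by (simp add: init)
  have Kn_le: "cmod (Kn n x) \<le> cmod (K x)" if "0 < x" "x < 1" for n x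
    using bounds[of x n] that by (auto simp: Kn_def p0_def norm_mult intro!: mult_left_le_one_le)
  have Rn_le: "cmod (Rn n x) \<le> 10 * C * (cmod (f x) * cutoff_weight (e n) x)" if "0 < x" "x < 1" for n x
  proof (cases "x \<le> 1 - e n")
    case True
    have "cmod (2 * complex_of_real (P1 n x) * g' x + complex_of_real (P2 n x) * g x) \<le> 10 * C * (e n * (1 - x) powr (- 3/2))"
      using bounds[of x n] True that decay[of x] e[of n] C0 \<alpha> by (intro cutoff_derivative_bounds) auto
    note le = mult_left_mono[OF this norm_ge_zero[of "f x"]]
    have e1: "Rn n x = f x * (2 * complex_of_real (P1 n x) * g' x + complex_of_real (P2 n x) * g x)"
      using True by (simp add: Rn_def R_def p1_def p2_def)
    have e2: "cutoff_weight (e n) x = e n * (1 - x) powr (- 3/2)"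
      using True by (simp add: cutoff_weight_def)
    show ?thesis
      unfolding e1 e2 norm_mult[of "f x"] using le by (simp only: mult.left_commute[of "cmod (f x)" "10 * C"])
  qed (simp add: Rn_def cutoff_weight_def)
  note w = cutoff_weight_tendsto_0[OF f(3) e e_lim]
  have Kn_int: "integrable M01 (Kn n)" for n
    by (rule Bochner_Integration.integrable_bound[OF K Knm]) (use Kn_le in \<open>intro AE_I2, simp\<close>)
  have Rn_int: "integrable M01 (Rn n)" for n
  proof (rule Bochner_Integration.integrable_bound[OF _ Rnm])
    show "integrable M01 (\<lambda>x. 10 * C * (cmod (f x) * cutoff_weight (e n) x))" using w(1) by simp
    show "AE x in M01. norm (Rn n x) \<le> norm (10 * C * (cmod (f x) * cutoff_weight (e n) x))"
      using Rn_le order_trans[OF _ abs_ge_self] by (intro AE_I2) (simp, blast)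
  qed
  have sum0: "(\<integral>x. Kn n x \<partial>M01) = - (\<integral>x. Rn n x \<partial>M01)" for n
  proof -
    have p: "weak_solution \<alpha> (\<lambda>x. p0 n x * g x) (\<lambda>x. p0 n x * g' x + p1 n x * g x)
           (\<lambda>x. p0 n x * h x - (2 * p1 n x * g' x + p2 n x * g x))"
      using d0 d1 cP2 unfolding p0_def p1_def p2_def
      by (intro weak_solution_mult_smooth[OF sol] has_vector_derivative_complex_of_real continuous_intros) auto
    have end0: "p0 n (1 - e n) = 0" "p1 n (1 - e n) = 0" using e[of n] by (simp_all add: p0_def p1_def P0_def P1_def)
    have "((\<lambda>x. k x * (p0 n x * g x) - f x * (p0 n x * h x - (2 * p1 n x * g' x + p2 n x * g x))) has_integral 0) {0..1 - e n}"
      using weak_solution_Lagrange[OF fsol p, of "1 - e n"] e[of n] end0 init by simp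
    then have "((\<lambda>x. p0 n x * K x + R n x) has_integral 0) {0..1 - e n}"
      by (rule has_integral_eq[rotated]) (simp add: K_def R_def algebra_simps)
    then have "((\<lambda>x. if x \<in> {0..1 - e n} then p0 n x * K x + R n x else 0) has_integral 0) {0..1}"
      using e[of n] by (subst has_integral_restrict) auto
    then have "((\<lambda>x. Kn n x + Rn n x) has_integral 0) {0..1}"
      by (rule has_integral_eq[rotated]) (auto simp: Kn_def Rn_def)
    from has_integral_unique[OF this M01_integral_HK[OF Bochner_Integration.integrable_add[OF Kn_int Rn_int]]]
    have "(\<integral>x. Kn n x \<partial>M01) + (\<integral>x. Rn n x \<partial>M01) = 0" using Kn_int Rn_int by simp
    then show ?thesis by (simp add: eq_neg_iff_add_eq_0)
  qed
  have "(\<lambda>n. \<integral>x. Kn n x \<partial>M01) \<longlonglongrightarrow> 0"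
  proof (rule Lim_null_comparison)
    show "\<forall>\<^sub>F n in sequentially. norm (\<integral>x. Kn n x \<partial>M01) \<le> 10 * C * (\<integral>x. cmod (f x) * cutoff_weight (e n) x \<partial>M01)"
    proof (intro always_eventually allI)
      fix n
      have "norm (\<integral>x. Kn n x \<partial>M01) \<le> (\<integral>x. norm (Rn n x) \<partial>M01)"
        unfolding sum0 norm_minus_cancel by (rule integral_norm_bound)
      also have "\<dots> \<le> (\<integral>x. 10 * C * (cmod (f x) * cutoff_weight (e n) x) \<partial>M01)"
        using Rn_le w(1) Rn_int by (intro integral_mono) auto
      finally show "norm (\<integral>x. Kn n x \<partial>M01) \<le> 10 * C * (\<integral>x. cmod (f x) * cutoff_weight (e n) x \<partial>M01)" by simp
    qed
    show "(\<lambda>n. 10 * C * (\<integral>x. cmod (f x) * cutoff_weight (e n) x \<partial>M01)) \<longlonglongrightarrow> 0"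
      using tendsto_mult_left[OF w(2), of "10 * C"] by simp
  qed
  moreover have "(\<lambda>n. \<integral>x. Kn n x \<partial>M01) \<longlonglongrightarrow> (\<integral>x. K x \<partial>M01)"
  proof (rule integral_dominated_convergence[where w="\<lambda>x. cmod (K x)"])
    show "AE x in M01. (\<lambda>n. Kn n x) \<longlonglongrightarrow> K x"
    proof (rule AE_I2)
      fix x assume "x \<in> space M01"
      then have x: "0 < x" "x < 1" by auto
      have "(\<lambda>n. complex_of_real ((1 - e n / (1 - x))\<^sup>2) * K x) \<longlonglongrightarrow> complex_of_real ((1 - 0 / (1 - x))\<^sup>2) * K x"
        using x by (intro tendsto_intros e_lim) auto
      then have lim: "(\<lambda>n. p0 n x * K x) \<longlonglongrightarrow> K x" by (simp add: p0_def P0_def)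
      have "\<forall>\<^sub>F n in sequentially. e n < 1 - x" using e_lim x by (intro order_tendstoD) auto
      then have "\<forall>\<^sub>F n in sequentially. p0 n x * K x = Kn n x"
        by (rule eventually_mono) (simp add: Kn_def)
      then show "(\<lambda>n. Kn n x) \<longlonglongrightarrow> K x" using lim by (rule Lim_transform_eventually[rotated])
    qed
    show "AE x in M01. norm (Kn n x) \<le> cmod (K x)" for n using Kn_le by (intro AE_I2) simp
  qed (use K Knm fm in auto)
  ultimately have "(\<integral>x. K x \<partial>M01) = 0" by (rule LIMSEQ_unique[rotated])
  then have "(\<integral>x. k x * g x \<partial>M01) = (\<integral>x. f x * h x \<partial>M01)"
    unfolding K_def using integrable_mult_square_integrable f sq by (subst (asm) Bochner_Integration.integral_diff) auto
  then show "inner_L2 G (abs_L2 (\<lambda>x. cnj (g x))) = inner_L2 F (abs_L2 (\<lambda>x. cnj (h x)))"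
    using f sq by (simp add: inner_L2_abs square_integrable_cnj)
qed

section \<open>Solving the inhomogeneous equation\<close>

text \<open>The solutions \<open>u\<close> and \<open>w\<close> of \<open>\<tau>\<^sub>2 f = 0\<close>; their Wronskian \<open>u' w - u w'\<close> is \<open>-2
  \<alpha>\<close>.\<close>

definition u_sol :: "real \<Rightarrow> real \<Rightarrow> real" where
  "u_sol \<alpha> x = (1 - x) powr (\<alpha> + 1/2)"

definition w_sol :: "real \<Rightarrow> real \<Rightarrow> real" where
  "w_sol \<alpha> x = (1 - x) powr (1/2 - \<alpha>)"

text \<open>Variation of constants: the solution of \<open>\<tau>\<^sub>2 g = H\<close> with \<open>g(0) = g'(0) = 0\<close>.\<close>

definition green :: "real \<Rightarrow> (real \<Rightarrow> real) \<Rightarrow> real \<Rightarrow> real" where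
  "green \<alpha> H x = (u_sol \<alpha> x * integral {0..x} (\<lambda>y. w_sol \<alpha> y * H y)
                 - w_sol \<alpha> x * integral {0..x} (\<lambda>y. u_sol \<alpha> y * H y)) / (2 * \<alpha>)"

text \<open>The derivative of \<open>green\<close>; the terms from differentiating the integrals cancel.\<close>

definition green' :: "real \<Rightarrow> (real \<Rightarrow> real) \<Rightarrow> real \<Rightarrow> real" where
  "green' \<alpha> H x = (- ((\<alpha> + 1/2) * (1 - x) powr (\<alpha> - 1/2)) * integral {0..x} (\<lambda>y. w_sol \<alpha> y * H y)
                 - (\<alpha> - 1/2) * (1 - x) powr (- \<alpha> - 1/2) * integral {0..x} (\<lambda>y. u_sol \<alpha> y * H y)) / (2 * \<alpha>)"

lemma continuous_on_sol: "continuous_on {0..<1} (u_sol \<alpha>)" "continuous_on {0..<1} (w_sol \<alpha>)"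
  unfolding u_sol_def[abs_def] w_sol_def[abs_def] by (intro continuous_intros; auto)+

lemma power_has_real_derivative:
  assumes "x < 1"
  shows "((\<lambda>x. (1 - x) powr s) has_real_derivative - (s * (1 - x) powr (s - 1))) (at x within S)"
proof -
  have d: "((\<lambda>x. 1 - x) has_real_derivative - 1) (at x within S)"
    using DERIV_diff[OF DERIV_const DERIV_ident, of 1 x S] by simp
  show ?thesis
    by (rule DERIV_cong[OF DERIV_chain2[OF has_real_derivative_powr d]]) (use assms in simp_all)
qed

lemma integral_has_real_derivative_01:
  assumes f: "continuous_on {0..<1} f" and x: "0 \<le> x" "x < 1"
  shows "((\<lambda>x. integral {0..x} f) has_real_derivative f x) (at x within {0..<1})"
proof -
  have "continuous_on {0..(x + 1) / 2} f" by (rule continuous_on_subset[OF f]) (use x in auto)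
  then have "((\<lambda>x. integral {0..x} f) has_real_derivative f x) (at x within {0..(x + 1) / 2})"
    using x by (intro integral_has_real_derivative) auto
  moreover have "at x within {0..(x + 1) / 2} = at x within {0..<1}"
    by (rule at_within_nhd[of _ "{..<(x + 1) / 2}"]) (use x in auto)
  ultimately show ?thesis by simp
qed

theorem green_solution:
  assumes \<alpha>: "0 < \<alpha>" and H: "continuous_on {0..<1} H"
  shows "weak_solution \<alpha> (\<lambda>x. complex_of_real (green \<alpha> H x)) (\<lambda>x. complex_of_real (green' \<alpha> H x)) (\<lambda>x. complex_of_real (H x))"
proof (rule weak_solutionI)
  show "continuous_on {0..<1} (\<lambda>x. complex_of_real (H x))" by (intro continuous_intros H)
  fix x :: real assume x: "0 \<le> x" "x < 1"
  let ?F = "at x within {0..<1}"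
  define t where "t = 1 - x"
  have t: "0 < t" using x by (simp add: t_def)
  define W where "W = (\<lambda>x. integral {0..x} (\<lambda>y. w_sol \<alpha> y * H y))"
  define U where "U = (\<lambda>x. integral {0..x} (\<lambda>y. u_sol \<alpha> y * H y))"
  have "continuous_on {0..<1} (\<lambda>y. w_sol \<alpha> y * H y)" "continuous_on {0..<1} (\<lambda>y. u_sol \<alpha> y * H y)"
    by (intro continuous_intros continuous_on_sol H)+
  from this[THEN integral_has_real_derivative_01, OF x]
  have dW: "(W has_real_derivative w_sol \<alpha> x * H x) ?F" and dU: "(U has_real_derivative u_sol \<alpha> x * H x) ?F"
    unfolding W_def U_def by blast+
  note d = power_has_real_derivative[OF x(2), of _ "{0..<1}"]
  have du: "(u_sol \<alpha> has_real_derivative - ((\<alpha> + 1/2) * t powr (\<alpha> - 1/2))) ?F"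
    using d[of "\<alpha> + 1/2"] by (simp add: u_sol_def[abs_def] t_def)
  have dw: "(w_sol \<alpha> has_real_derivative (\<alpha> - 1/2) * t powr (- \<alpha> - 1/2)) ?F"
    using d[of "1/2 - \<alpha>"] by (simp add: w_sol_def[abs_def] t_def algebra_simps)
  have "((\<lambda>x. u_sol \<alpha> x * W x - w_sol \<alpha> x * U x) has_real_derivative 
      (- ((\<alpha> + 1/2) * t powr (\<alpha> - 1/2)) * W x + w_sol \<alpha> x * H x * u_sol \<alpha> x)
      - ((\<alpha> - 1/2) * t powr (- \<alpha> - 1/2) * U x + u_sol \<alpha> x * H x * w_sol \<alpha> x)) ?F"
    by (intro DERIV_diff DERIV_mult du dw dU dW)
  then have "((\<lambda>x. u_sol \<alpha> x * W x - w_sol \<alpha> x * U x) has_real_derivative 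
      - ((\<alpha> + 1/2) * t powr (\<alpha> - 1/2)) * W x - (\<alpha> - 1/2) * t powr (- \<alpha> - 1/2) * U x) ?F"
  proof (rule DERIV_cong)
    have "a + p * q * r - (b + r * q * p) = a - b" for a b p q r :: real by simp
    then show "- ((\<alpha> + 1/2) * t powr (\<alpha> - 1/2)) * W x + w_sol \<alpha> x * H x * u_sol \<alpha> x
      - ((\<alpha> - 1/2) * t powr (- \<alpha> - 1/2) * U x + u_sol \<alpha> x * H x * w_sol \<alpha> x) =
      - ((\<alpha> + 1/2) * t powr (\<alpha> - 1/2)) * W x - (\<alpha> - 1/2) * t powr (- \<alpha> - 1/2) * U x" .
  qed
  from DERIV_cdivide[OF this, of "2 * \<alpha>"] have "(green \<alpha> H has_real_derivative green' \<alpha> H x) ?F"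
    unfolding green_def[abs_def] green'_def W_def U_def t_def .
  then show "((\<lambda>x. complex_of_real (green \<alpha> H x)) has_vector_derivative complex_of_real (green' \<alpha> H x)) ?F"
    by (rule has_vector_derivative_complex_of_real)
  have gr: "green' \<alpha> H = (\<lambda>x. (- ((\<alpha> + 1/2) * (1 - x) powr (\<alpha> - 1/2)) * W x
                 - (\<alpha> - 1/2) * (1 - x) powr (- \<alpha> - 1/2) * U x) / (2 * \<alpha>))"
    by (simp add: fun_eq_iff green'_def W_def U_def)
  have "(green' \<alpha> H has_real_derivative 
       ((- ((\<alpha> + 1/2) * - ((\<alpha> - 1/2) * t powr (\<alpha> - 1/2 - 1)))) * W x + w_sol \<alpha> x * H x * (- ((\<alpha> + 1/2) * t powr (\<alpha> - 1/2)))
       - ((\<alpha> - 1/2) * - ((- \<alpha> - 1/2) * t powr (- \<alpha> - 1/2 - 1)) * U x + u_sol \<alpha> x * H x * ((\<alpha> - 1/2) * t powr (- \<alpha> - 1/2)))) / (2 * \<alpha>)) ?F"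
    unfolding gr t_def
    by (intro DERIV_cdivide DERIV_diff DERIV_mult DERIV_minus DERIV_cmult d dW dU)
  moreover have "((- ((\<alpha> + 1/2) * - ((\<alpha> - 1/2) * t powr (\<alpha> - 1/2 - 1)))) * W x + w_sol \<alpha> x * H x * (- ((\<alpha> + 1/2) * t powr (\<alpha> - 1/2)))
       - ((\<alpha> - 1/2) * - ((- \<alpha> - 1/2) * t powr (- \<alpha> - 1/2 - 1)) * U x + u_sol \<alpha> x * H x * ((\<alpha> - 1/2) * t powr (- \<alpha> - 1/2)))) / (2 * \<alpha>)
       = (\<alpha>\<^sup>2 - 1/4) / (1 - x)\<^sup>2 * green \<alpha> H x - H x" (is "?L / _ = ?R")
  proof -
    have p1: "t powr (\<alpha> - 1/2 - 1) = u_sol \<alpha> x / t\<^sup>2" "t powr (- \<alpha> - 1/2 - 1) = w_sol \<alpha> x / t\<^sup>2"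
    proof -
      have "t\<^sup>2 = t powr 2" using t by simp
      then show "t powr (\<alpha> - 1/2 - 1) = u_sol \<alpha> x / t\<^sup>2" "t powr (- \<alpha> - 1/2 - 1) = w_sol \<alpha> x / t\<^sup>2"
        unfolding u_sol_def w_sol_def t_def[symmetric] by (simp_all flip: powr_diff)
    qed
    have p2: "w_sol \<alpha> x * t powr (\<alpha> - 1/2) = 1" "u_sol \<alpha> x * t powr (- \<alpha> - 1/2) = 1"
      unfolding u_sol_def w_sol_def t_def[symmetric] using t by (simp_all flip: powr_add)
    have "?L = (\<alpha> + 1/2) * (\<alpha> - 1/2) * ((u_sol \<alpha> x / t\<^sup>2) * W x) - (\<alpha> + 1/2) * H x * (w_sol \<alpha> x * t powr (\<alpha> - 1/2))
       - (\<alpha> + 1/2) * (\<alpha> - 1/2) * ((w_sol \<alpha> x / t\<^sup>2) * U x) - (\<alpha> - 1/2) * H x * (u_sol \<alpha> x * t powr (- \<alpha> - 1/2))"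
    proof -
      have "(- (a * - (b * A))) * X + w * h * (- (a * p)) - (b * - (c * B) * Y + u * h * (b * q))
         = a * b * (A * X) - a * h * (w * p) - a * b * (B * Y) - b * h * (u * q)"
        if "c = - a" for a b c A B X Y w u h p q :: real
        unfolding that by (simp add: algebra_simps)
      then show ?thesis unfolding p1 by this simp
    qed
    also have "\<dots> = (\<alpha> + 1/2) * (\<alpha> - 1/2) * ((u_sol \<alpha> x * W x - w_sol \<alpha> x * U x) / t\<^sup>2) - 2 * \<alpha> * H x"
    proof -
      have "a * b * (u / s * X) - a * h * 1 - a * b * (w / s * Y) - b * h * 1 = a * b * ((u * X - w * Y) / s) - (a + b) * h"
        for a b u s X w Y h :: real
        by (simp add: algebra_simps diff_divide_distrib)
      from this[of "\<alpha> + 1/2" "\<alpha> - 1/2" "u_sol \<alpha> x" "t\<^sup>2" "W x" "H x" "w_sol \<alpha> x" "U x"]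
      show ?thesis unfolding p2 by simp
    qed
    also have "\<dots> = (2 * \<alpha>) * ?R"
    proof -
      have "2 * \<alpha> * green \<alpha> H x = u_sol \<alpha> x * W x - w_sol \<alpha> x * U x"
        using \<alpha> by (simp add: green_def W_def U_def)
      moreover have "(\<alpha> + 1/2) * (\<alpha> - 1/2) = \<alpha>\<^sup>2 - 1/4" by (simp add: power2_eq_square algebra_simps)
      ultimately show ?thesis by (simp add: t_def[symmetric] right_diff_distrib mult.left_commute[of "2 * \<alpha>"])
    qed
    finally show ?thesis using \<alpha> by simp
  qed
  ultimately have "(green' \<alpha> H has_real_derivative (\<alpha>\<^sup>2 - 1/4) / (1 - x)\<^sup>2 * green \<alpha> H x - H x) ?F" by simp
  from has_vector_derivative_complex_of_real[OF this]
  show "((\<lambda>x. complex_of_real (green' \<alpha> H x)) has_vector_derivative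
      potential \<alpha> x * complex_of_real (green \<alpha> H x) - complex_of_real (H x)) ?F"
    by (simp add: potential_def)
qed

lemma green_at_0: "green \<alpha> H 0 = 0" "green' \<alpha> H 0 = 0"
  by (simp_all add: green_def green'_def)

lemma continuous_on_green:
  assumes "0 < \<alpha>" "continuous_on {0..<1} H"
  shows "continuous_on {0..<1} (green \<alpha> H)"
  using AC_loc_imp_continuous_on[of "\<lambda>x. complex_of_real (green \<alpha> H x)"] green_solution[OF assms]
  by (simp add: weak_solution_def continuous_on_of_real_o_iff)

text \<open>Orthogonality to \<open>u\<close> turns the coefficient of \<open>w\<close> into an integral over \<open>[x, 1]\<close>, which is
  \<open>O(t^(2 \<alpha> + 2))\<close> and outweighs the growth of \<open>w\<close>. The bound on the solution has the
  same form as the one on \<open>H\<close>, so the estimate can be iterated.\<close>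

lemma green_decay:
  assumes \<alpha>: "1 \<le> \<alpha>" and H: "continuous_on {0..<1} H"
    and bound: "\<And>x. 0 \<le> x \<Longrightarrow> x < 1 \<Longrightarrow> \<bar>H x\<bar> \<le> C * u_sol \<alpha> x"
    and orth: "((\<lambda>x. u_sol \<alpha> x * H x) has_integral 0) {0..1}"
    and x: "0 \<le> x" "x < 1"
  shows "\<bar>green \<alpha> H x\<bar> \<le> C * u_sol \<alpha> x" and "\<bar>green' \<alpha> H x\<bar> \<le> C * (1 - x) powr (\<alpha> - 1/2)"
proof -
  define t where "t = 1 - x"
  have t: "0 < t" "t \<le> 1" using x by (simp_all add: t_def)
  have C: "0 \<le> C" using bound[of 0] by (simp add: u_sol_def)
  define W where "W = integral {0..x} (\<lambda>y. w_sol \<alpha> y * H y)"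
  define U where "U = integral {0..x} (\<lambda>y. u_sol \<alpha> y * H y)"
  have W: "\<bar>W\<bar> \<le> C"
  proof -
    have sub: "{0..x} \<subseteq> {0..<1}" using x by auto
    have "norm (integral {0..x} (\<lambda>y. w_sol \<alpha> y * H y)) \<le> C * (x - 0)"
    proof (rule integral_bound)
      show "continuous_on {0..x} (\<lambda>y. w_sol \<alpha> y * H y)"
        by (intro continuous_intros continuous_on_subset[OF continuous_on_sol(2) sub] continuous_on_subset[OF H sub])
      fix y assume y: "y \<in> {0..x}"
      have "norm (w_sol \<alpha> y * H y) \<le> w_sol \<alpha> y * (C * u_sol \<alpha> y)"
        using bound[of y] y x by (simp add: abs_mult w_sol_def mult_left_mono)
      also have "\<dots> = C * (1 - y)"
        using y x by (simp add: w_sol_def u_sol_def flip: powr_add)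
      also have "\<dots> \<le> C * 1" using C y by (intro mult_left_mono) auto
      finally show "norm (w_sol \<alpha> y * H y) \<le> C" by simp
    qed (use x in auto)
    also have "\<dots> \<le> C * 1" using C x by (intro mult_left_mono) auto
    finally show ?thesis by (simp add: W_def)
  qed
  have U: "\<bar>U\<bar> \<le> C * t powr (2 * \<alpha> + 2)"
  proof -
    have int: "(\<lambda>y. u_sol \<alpha> y * H y) integrable_on {0..1}" using orth by blast
    have "U + integral {x..1} (\<lambda>y. u_sol \<alpha> y * H y) = 0"
      using Henstock_Kurzweil_Integration.integral_combine[OF _ _ int, of x] x orth by (simp add: U_def integral_unique)
    moreover have "norm (integral {x..1} (\<lambda>y. u_sol \<alpha> y * H y)) \<le> (C * t powr (2 * \<alpha> + 1)) * measure lborel (cbox x 1)"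
    proof (rule has_integral_bound)
      show "0 \<le> C * t powr (2 * \<alpha> + 1)" using C by simp
      have "(\<lambda>y. u_sol \<alpha> y * H y) integrable_on {x..1}"
        by (rule integrable_on_subinterval[OF int]) (use x in auto)
      then show "((\<lambda>y. u_sol \<alpha> y * H y) has_integral integral {x..1} (\<lambda>y. u_sol \<alpha> y * H y)) (cbox x 1)" by (simp add: has_integral_integral)
      fix y assume "y \<in> cbox x 1"
      then have y: "x \<le> y" "y \<le> 1" by auto
      show "norm (u_sol \<alpha> y * H y) \<le> C * t powr (2 * \<alpha> + 1)"
      proof (cases "y = 1")
        case True
        then show ?thesis using C by (simp add: u_sol_def)
      next
        case False
        then have y1: "y < 1" using y by simp
        have "norm (u_sol \<alpha> y * H y) \<le> u_sol \<alpha> y * (C * u_sol \<alpha> y)"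
          using bound[of y] y1 y x by (simp add: abs_mult u_sol_def mult_left_mono)
        also have "\<dots> = C * (1 - y) powr (2 * \<alpha> + 1)" by (simp add: u_sol_def algebra_simps flip: powr_add)
        also have "\<dots> \<le> C * t powr (2 * \<alpha> + 1)"
          using y y1 \<alpha> C by (intro mult_left_mono powr_mono2) (auto simp: t_def)
        finally show ?thesis .
      qed
    qed
    ultimately have "\<bar>U\<bar> \<le> (C * t powr (2 * \<alpha> + 1)) * t" using x by (simp add: t_def)
    also have "\<dots> = C * t powr (2 * \<alpha> + 2)"
    proof -
      have "t powr (2 * \<alpha> + 2) = t powr (2 * \<alpha> + 1) * t powr 1" by (subst powr_add[symmetric]) (simp add: add.commute)
      then show ?thesis using t by simp
    qed
    finally show ?thesis .
  qed
  have "\<bar>green \<alpha> H x\<bar> * (2 * \<alpha>) = \<bar>u_sol \<alpha> x * W - w_sol \<alpha> x * U\<bar>"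
    using \<alpha> by (simp add: green_def W_def U_def abs_divide)
  also have "\<dots> \<le> u_sol \<alpha> x * C + w_sol \<alpha> x * (C * t powr (2 * \<alpha> + 2))"
  proof -
    have "\<bar>u_sol \<alpha> x * W\<bar> \<le> u_sol \<alpha> x * C" "\<bar>w_sol \<alpha> x * U\<bar> \<le> w_sol \<alpha> x * (C * t powr (2 * \<alpha> + 2))"
      using W U by (simp_all add: abs_mult u_sol_def w_sol_def mult_left_mono)
    then show ?thesis by linarith
  qed
  also have "w_sol \<alpha> x * (C * t powr (2 * \<alpha> + 2)) \<le> C * u_sol \<alpha> x"
  proof -
    have "w_sol \<alpha> x * (C * t powr (2 * \<alpha> + 2)) = C * t powr (\<alpha> + 5/2)"
      by (simp add: w_sol_def t_def[symmetric] algebra_simps flip: powr_add)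
    also have "\<dots> \<le> C * t powr (\<alpha> + 1/2)" using t C by (intro mult_left_mono powr_mono') auto
    finally show ?thesis by (simp add: u_sol_def t_def)
  qed
  also have "u_sol \<alpha> x * C + C * u_sol \<alpha> x = C * u_sol \<alpha> x * 2" by simp
  also have "\<dots> \<le> C * u_sol \<alpha> x * (2 * \<alpha>)" using \<alpha> C by (intro mult_left_mono) (auto simp: u_sol_def)
  finally show "\<bar>green \<alpha> H x\<bar> \<le> C * u_sol \<alpha> x" using \<alpha> by simp
  have "\<bar>green' \<alpha> H x\<bar> * (2 * \<alpha>) = \<bar>- ((\<alpha> + 1/2) * t powr (\<alpha> - 1/2)) * W - (\<alpha> - 1/2) * t powr (- \<alpha> - 1/2) * U\<bar>"
    using \<alpha> by (simp add: green'_def W_def U_def abs_divide t_def)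
  also have "\<dots> \<le> (\<alpha> + 1/2) * t powr (\<alpha> - 1/2) * C + (\<alpha> - 1/2) * t powr (- \<alpha> - 1/2) * (C * t powr (2 * \<alpha> + 2))"
  proof -
    have "\<bar>- ((\<alpha> + 1/2) * t powr (\<alpha> - 1/2)) * W\<bar> \<le> (\<alpha> + 1/2) * t powr (\<alpha> - 1/2) * C"
      using W \<alpha> by (simp add: abs_mult mult_left_mono)
    moreover have "\<bar>(\<alpha> - 1/2) * t powr (- \<alpha> - 1/2) * U\<bar> \<le> (\<alpha> - 1/2) * t powr (- \<alpha> - 1/2) * (C * t powr (2 * \<alpha> + 2))"
      using mult_left_mono[OF U, of "(\<alpha> - 1/2) * t powr (- \<alpha> - 1/2)"] \<alpha> by (simp add: abs_mult)
    ultimately show ?thesis by linarith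
  qed
  also have "(\<alpha> - 1/2) * t powr (- \<alpha> - 1/2) * (C * t powr (2 * \<alpha> + 2)) \<le> (\<alpha> - 1/2) * (C * t powr (\<alpha> - 1/2))"
  proof -
    have "t powr (- \<alpha> - 1/2) * t powr (2 * \<alpha> + 2) = t powr (\<alpha> + 3/2)"
      by (simp flip: powr_add)
    also have "\<dots> \<le> t powr (\<alpha> - 1/2)" using t by (intro powr_mono') auto
    finally have "C * (t powr (- \<alpha> - 1/2) * t powr (2 * \<alpha> + 2)) \<le> C * t powr (\<alpha> - 1/2)" using C by (rule mult_left_mono)
    from mult_left_mono[OF this, of "\<alpha> - 1/2"] \<alpha> show ?thesis by (simp only: mult.assoc mult.left_commute)
  qed
  also have "(\<alpha> + 1/2) * t powr (\<alpha> - 1/2) * C + (\<alpha> - 1/2) * (C * t powr (\<alpha> - 1/2)) = C * t powr (\<alpha> - 1/2) * (2 * \<alpha>)"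
    by (simp add: algebra_simps)
  finally show "\<bar>green' \<alpha> H x\<bar> \<le> C * (1 - x) powr (\<alpha> - 1/2)" using \<alpha> by (simp add: t_def)
qed

text \<open>Beyond the support of \<open>H\<close> both integrals in the Green formula have reached their final
  value.\<close>

lemma green_compact_support:
  assumes orth: "((\<lambda>x. u_sol \<alpha> x * H x) has_integral 0) {0..1}" "((\<lambda>x. w_sol \<alpha> x * H x) has_integral 0) {0..1}"
    and H: "\<And>x. b \<le> x \<Longrightarrow> H x = 0" and x: "0 \<le> b" "b \<le> x" "x < 1"
  shows "green \<alpha> H x = 0" "green' \<alpha> H x = 0"
proof -
  have z: "integral {0..x} (\<lambda>y. s y * H y) = 0" if s: "((\<lambda>y. s y * H y) has_integral 0) {0..1}" for s :: "real \<Rightarrow> real"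
  proof -
    have "integral {x..1} (\<lambda>y. s y * H y) = integral {x..1} (\<lambda>y. 0)"
      by (rule Henstock_Kurzweil_Integration.integral_cong) (use H x in auto)
    moreover have "(\<lambda>y. s y * H y) integrable_on {0..1}" using s by blast
    ultimately show ?thesis
      using Henstock_Kurzweil_Integration.integral_combine[of 0 x 1 "\<lambda>y. s y * H y"] x s by (simp add: integral_unique)
  qed
  show "green \<alpha> H x = 0" "green' \<alpha> H x = 0"
    unfolding green_def green'_def z[OF orth(1)] z[OF orth(2)] by simp_all
qed

section \<open>Annihilators of finitely many moment conditions\<close>

definition test_functions :: "(real \<Rightarrow> real) set" where
  "test_functions = {H. continuous_on UNIV H \<and> (\<exists>b<1. \<forall>x\<ge>b. H x = 0)}"

lemma test_functions_lincomb:
  assumes "H \<in> test_functions" "H' \<in> test_functions"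
  shows "(\<lambda>x. a * H x + b * H' x) \<in> test_functions"
proof -
  obtain c d where "c < 1" "\<forall>x\<ge>c. H x = 0" "d < 1" "\<forall>x\<ge>d. H' x = 0"
    using assms by (auto simp: test_functions_def)
  then have "max c d < 1 \<and> (\<forall>x\<ge>max c d. a * H x + b * H' x = 0)" by auto
  moreover have "continuous_on UNIV (\<lambda>x. a * H x + b * H' x)"
    using assms by (auto simp: test_functions_def intro!: continuous_intros)
  ultimately show ?thesis unfolding test_functions_def by blast
qed

lemma test_functions_bound:
  fixes s :: "real \<Rightarrow> real"
  assumes "H \<in> test_functions" and s: "continuous_on {0..<1} s"
  obtains B where "\<And>x. 0 \<le> x \<Longrightarrow> x < 1 \<Longrightarrow> \<bar>s x * H x\<bar> \<le> B"
proof -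
  obtain c where c: "c < 1" "\<And>x. c \<le> x \<Longrightarrow> H x = 0" using assms by (auto simp: test_functions_def)
  define b where "b = max 0 c"
  have b: "0 \<le> b" "b < 1" using c by (auto simp: b_def)
  have "continuous_on {0..b} (\<lambda>x. s x * H x)"
    using assms b by (auto simp: test_functions_def intro!: continuous_intros elim!: continuous_on_subset)
  from compact_imp_bounded[OF compact_continuous_image[OF this compact_Icc]]
  obtain B where B: "\<forall>x\<in>{0..b}. \<bar>s x * H x\<bar> \<le> B"
    unfolding bounded_iff ball_simps real_norm_def by blast
  have "\<bar>s x * H x\<bar> \<le> max B 0" if "0 \<le> x" "x < 1" for x
  proof (cases "x \<le> b")
    case True
    then have "\<bar>s x * H x\<bar> \<le> B" using B that by auto
    then show ?thesis by simp
  next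
    case False
    then have "H x = 0" by (intro c(2)) (simp add: b_def)
    then show ?thesis by simp
  qed
  then show ?thesis using that by blast
qed

lemma test_functions_square_integrable:
  assumes "H \<in> test_functions"
  shows "square_integrable (\<lambda>x. complex_of_real (H x))"
proof -
  obtain B where "\<And>x. 0 \<le> x \<Longrightarrow> x < 1 \<Longrightarrow> \<bar>1 * H x\<bar> \<le> B"
    using test_functions_bound[where s="\<lambda>_. 1", OF assms continuous_on_const] by blast
  moreover have "continuous_on {0<..<1} H"
    using assms by (auto simp: test_functions_def elim: continuous_on_subset)
  ultimately show ?thesis
    by (intro square_integrable_bounded[of _ B] measurable_M01_continuous continuous_intros) auto
qed

lemma test_functions_integrable:
  fixes s :: "real \<Rightarrow> real"
  assumes "H \<in> test_functions" and s: "continuous_on {0..<1} s"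
  shows "integrable M01 (\<lambda>x. s x * H x)"
proof -
  obtain B where B: "\<And>x. 0 \<le> x \<Longrightarrow> x < 1 \<Longrightarrow> \<bar>s x * H x\<bar> \<le> B"
    using test_functions_bound[OF assms] by blast
  show ?thesis
  proof (rule Bochner_Integration.integrable_bound[OF integrable_const_M01[of B]])
    have "continuous_on {0<..<1} H"
      using assms by (auto simp: test_functions_def elim: continuous_on_subset)
    moreover have "continuous_on {0<..<1} s" by (rule continuous_on_subset[OF s]) auto
    ultimately show "(\<lambda>x. s x * H x) \<in> borel_measurable M01"
      by (intro measurable_M01_continuous continuous_intros)
    have "\<bar>s x * H x\<bar> \<le> \<bar>B\<bar>" if "0 < x" "x < 1" for x using B[of x] that by linarith
    then show "AE x in M01. norm (s x * H x) \<le> norm B" by (intro AE_I2) simp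
  qed
qed

text \<open>Approximate the indicator of \<open>K\<close> by \<open>max 0 (1 - n dist(x, K))\<close>, which is a test function as
  soon as \<open>1/n\<close> is smaller than the distance of \<open>K\<close> from \<open>1\<close>.\<close>

lemma integral_compact_eq_0:
  fixes r :: "real \<Rightarrow> complex"
  assumes r: "r \<in> borel_measurable M01"
    and int: "\<And>H. H \<in> test_functions \<Longrightarrow> integrable M01 (\<lambda>x. r x * complex_of_real (H x))"
    and zero: "\<And>H. H \<in> test_functions \<Longrightarrow> (\<integral>x. r x * complex_of_real (H x) \<partial>M01) = 0"
    and K: "compact K" "K \<subseteq> {0<..<1}" "K \<noteq> {}"
  shows "integrable M01 (\<lambda>x. r x * indicator K x)" and "(\<integral>x. r x * indicator K x \<partial>M01) = 0"
proof -
  obtain b where b: "b \<in> K" "\<And>x. x \<in> K \<Longrightarrow> x \<le> b" using compact_attains_sup[OF K(1,3)] by blast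
  have "b < 1" using b(1) K(2) by auto
  then obtain N where N: "inverse (real (Suc N)) < 1 - b" using reals_Archimedean[of "1 - b"] by auto
  define n where "n = (\<lambda>j. real (Suc N + j))"
  define H where "H = (\<lambda>j x. max 0 (1 - n j * infdist x K))"
  have n: "0 < n j" "real (Suc N) \<le> n j" for j by (simp_all add: n_def)
  have H_test: "H j \<in> test_functions" for j
    unfolding test_functions_def
  proof (intro CollectI conjI exI[of _ "b + inverse (real (Suc N))"] allI impI)
    show "continuous_on UNIV (H j)" unfolding H_def by (intro continuous_intros continuous_on_infdist)
    show "b + inverse (real (Suc N)) < 1" using N by simp
    fix x assume x: "b + inverse (real (Suc N)) \<le> x"
    have "inverse (real (Suc N)) \<le> infdist x K"
      unfolding infdist_notempty[OF K(3)]
    proof (rule cINF_greatest[OF K(3)])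
      fix y assume "y \<in> K"
      then have "y \<le> b" by (rule b(2))
      then show "inverse (real (Suc N)) \<le> dist x y" using x by (simp add: dist_real_def)
    qed
    then have "n j * inverse (real (Suc N)) \<le> n j * infdist x K" using n(1)[of j] by (intro mult_left_mono) auto
    moreover have "1 \<le> n j * inverse (real (Suc N))" using n(2)[of j] by (simp add: field_simps)
    ultimately have "1 \<le> n j * infdist x K" by linarith
    then show "H j x = 0" by (simp add: H_def)
  qed
  have H_le: "0 \<le> H j x" "H j x \<le> H 0 x" for j x
  proof -
    have "n 0 * infdist x K \<le> n j * infdist x K" by (intro mult_right_mono infdist_nonneg) (simp add: n_def)
    then show "0 \<le> H j x" "H j x \<le> H 0 x" by (auto simp: H_def)
  qed
  have ind: "indicator K x \<le> H j x" for j x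
    by (auto simp: H_def indicator_def)
  have Km: "(\<lambda>x. r x * indicator K x) \<in> borel_measurable M01"
    by (intro borel_measurable_times[OF r] measurable_M01_borel borel_measurable_indicator borel_compact K(1))
  show "integrable M01 (\<lambda>x. r x * indicator K x)"
  proof (rule Bochner_Integration.integrable_bound[OF int[OF H_test[of 0]] Km])
    have "cmod (r x * indicator K x) \<le> cmod (r x * complex_of_real (H 0 x))" for x
      using ind[of x 0] mult_left_mono[of 1 "H 0 x" "cmod (r x)"]
      by (auto simp: norm_mult indicator_def split: if_splits)
    then show "AE x in M01. cmod (r x * indicator K x) \<le> cmod (r x * complex_of_real (H 0 x))" by simp
  qed
  have "(\<lambda>j. \<integral>x. r x * complex_of_real (H j x) \<partial>M01) \<longlonglongrightarrow> (\<integral>x. r x * indicator K x \<partial>M01)"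
  proof (rule integral_dominated_convergence[where w="\<lambda>x. norm (r x * complex_of_real (H 0 x))"])
    show "AE x in M01. (\<lambda>j. r x * complex_of_real (H j x)) \<longlonglongrightarrow> r x * indicator K x"
    proof (rule AE_I2)
      fix x
      have "(\<lambda>j. H j x) \<longlonglongrightarrow> indicator K x"
      proof (cases "x \<in> K")
        case True
        then show ?thesis by (simp add: H_def)
      next
        case False
        then have d: "0 < infdist x K"
          using in_closed_iff_infdist_zero[OF compact_imp_closed[OF K(1)] K(3)] infdist_nonneg[of x K] by (simp add: less_le)
        obtain J :: nat where J: "1 / infdist x K < real J" using reals_Archimedean2 by blast
        have "H j x = 0" if "J \<le> j" for j
        proof -
          have "1 / infdist x K < n j" using J that by (simp add: n_def)
          then have "1 < n j * infdist x K" using d by (simp add: divide_less_eq)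
          then show ?thesis by (simp add: H_def)
        qed
        then have "\<forall>\<^sub>F j in sequentially. H j x = indicator K x"
          using False by (auto simp: eventually_sequentially)
        then show ?thesis by (rule tendsto_eventually)
      qed
      then have "(\<lambda>j. r x * complex_of_real (H j x)) \<longlonglongrightarrow> r x * complex_of_real (indicator K x)"
        by (intro tendsto_intros)
      moreover have "complex_of_real (indicator K x) = indicator K x" by (simp add: indicator_def)
      ultimately show "(\<lambda>j. r x * complex_of_real (H j x)) \<longlonglongrightarrow> r x * indicator K x" by simp
    qed
    show "AE x in M01. norm (r x * complex_of_real (H j x)) \<le> norm (r x * complex_of_real (H 0 x))" for j
    proof (rule AE_I2)
      fix x
      show "norm (r x * complex_of_real (H j x)) \<le> norm (r x * complex_of_real (H 0 x))"
        using H_le[of j x] H_le[of 0 x] by (simp add: norm_mult mult_left_mono)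
    qed
    show "integrable M01 (\<lambda>x. norm (r x * complex_of_real (H 0 x)))" using int[OF H_test[of 0]] by simp
    show "(\<lambda>x. r x * complex_of_real (H j x)) \<in> borel_measurable M01" for j using int[OF H_test[of j]] by simp
  qed (rule Km)
  then have "(\<lambda>j::nat. 0) \<longlonglongrightarrow> (\<integral>x. r x * indicator K x \<partial>M01)" by (simp only: zero[OF H_test])
  then show "(\<integral>x. r x * indicator K x \<partial>M01) = 0" by (metis LIMSEQ_unique tendsto_const)
qed

text \<open>If \<open>q > 0\<close> on a set of positive measure, then also on a compact set of positive measure,
  over which the integral of \<open>q\<close> could not vanish.\<close>

lemma AE_nonpos_if_compact_integrals_0:
  fixes q :: "real \<Rightarrow> real"
  assumes q: "q \<in> borel_measurable M01"
    and K: "\<And>K. compact K \<Longrightarrow> K \<subseteq> {0<..<1} \<Longrightarrow> K \<noteq> {} \<Longrightarrow>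
       integrable M01 (\<lambda>x. q x * indicator K x) \<and> (\<integral>x. q x * indicator K x \<partial>M01) = 0"
  shows "AE x in M01. q x \<le> 0"
proof -
  define A where "A = {x \<in> space M01. 0 < q x}"
  have A01: "A \<subseteq> {0<..<1}" by (auto simp: A_def)
  have "A \<in> sets M01" unfolding A_def using q by measurable
  then have As: "A \<in> sets lebesgue" by (simp add: sets_restrict_space_iff)
  have "emeasure lebesgue A = 0"
  proof (rule ccontr)
    assume nz: "emeasure lebesgue A \<noteq> 0"
    have "emeasure lebesgue A \<le> emeasure lebesgue {0<..<1::real}" by (rule emeasure_mono[OF A01]) simp
    then have "emeasure lebesgue A \<noteq> \<infinity>" by (auto simp: top_unique)
    then have fin: "emeasure lebesgue A = ennreal (measure lebesgue A)" by (simp add: emeasure_eq_ennreal_measure)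
    then have pos: "0 < measure lebesgue A" using nz by (simp add: zero_less_measure_iff less_le)
    obtain T where T: "closed T" "T \<subseteq> A" "emeasure lebesgue (A - T) < ennreal (measure lebesgue A)"
      using sets_lebesgue_inner_closed[OF As pos] .
    have Tnz: "emeasure lebesgue T \<noteq> 0"
    proof
      assume "emeasure lebesgue T = 0"
      then have "T \<in> null_sets lebesgue" using T(1) by (simp add: null_sets_def)
      then have "emeasure lebesgue (A - T) = emeasure lebesgue A" using As by (rule emeasure_Diff_null_set)
      then show False using T(3) fin by simp
    qed
    have cT: "compact T"
      using T A01 by (intro compact_eq_bounded_closed[THEN iffD2] conjI bounded_subset[OF compact_imp_bounded[OF compact_Icc[of 0 1]]]) auto
    have "T \<subseteq> {0<..<1}" "T \<noteq> {}" using T A01 Tnz by auto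
    from K[OF cT this] have int: "integrable M01 (\<lambda>x. q x * indicator T x)" and z: "(\<integral>x. q x * indicator T x \<partial>M01) = 0" by auto
    have "AE x in M01. 0 \<le> q x * indicator T x"
      using T(2) by (intro AE_I2) (auto simp: A_def indicator_def)
    with integral_nonneg_eq_0_iff_AE[OF int] z have "AE x in M01. q x * indicator T x = 0" by simp
    then have "AE x in M01. x \<notin> T"
      by (rule eventually_mono) (use T(2) in \<open>auto simp: A_def indicator_def\<close>)
    then have "AE x in lebesgue. x \<notin> T" unfolding AE_M01_iff
      by (rule eventually_mono) (use \<open>T \<subseteq> {0<..<1}\<close> in blast)
    then have "emeasure lebesgue {x \<in> space lebesgue. x \<in> T} = 0" by (intro emeasure_eq_0_AE)
    then show False using Tnz by simp
  qed
  then have "A \<in> null_sets lebesgue" using As by (simp add: null_sets_def)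
  then have "AE x in lebesgue. x \<notin> A" by (rule AE_not_in)
  then show ?thesis unfolding AE_M01_iff by (rule eventually_mono) (auto simp: A_def not_less)
qed

lemma AE_0_if_test_integrals_0:
  fixes r :: "real \<Rightarrow> complex"
  assumes r: "r \<in> borel_measurable M01"
    and int: "\<And>H. H \<in> test_functions \<Longrightarrow> integrable M01 (\<lambda>x. r x * complex_of_real (H x))"
    and zero: "\<And>H. H \<in> test_functions \<Longrightarrow> (\<integral>x. r x * complex_of_real (H x) \<partial>M01) = 0"
  shows "AE x in M01. r x = 0"
proof -
  have K: "integrable M01 (\<lambda>x. r x * indicator K x)" "(\<integral>x. r x * indicator K x \<partial>M01) = 0"
    if "compact K" "K \<subseteq> {0<..<1}" "K \<noteq> {}" for K
    by (intro integral_compact_eq_0 r int zero that; assumption)+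
  have nonpos: "AE x in M01. \<phi> (r x) \<le> 0" if \<phi>: "bounded_linear \<phi>" for \<phi> :: "complex \<Rightarrow> real"
  proof (rule AE_nonpos_if_compact_integrals_0)
    show "(\<lambda>x. \<phi> (r x)) \<in> borel_measurable M01"
      by (rule measurable_compose[OF r borel_measurable_continuous_onI[OF linear_continuous_on[OF \<phi>]]])
    fix K :: "real set" assume "compact K" "K \<subseteq> {0<..<1}" "K \<noteq> {}"
    note KK = K[OF this]
    have eq: "\<phi> (r x * indicator K x) = \<phi> (r x) * indicator K x" for x
      using linear_0[OF bounded_linear.linear[OF \<phi>]] by (simp add: indicator_def)
    show "integrable M01 (\<lambda>x. \<phi> (r x) * indicator K x) \<and> (\<integral>x. \<phi> (r x) * indicator K x \<partial>M01) = 0"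
      using integrable_bounded_linear[OF \<phi> KK(1)] integral_bounded_linear[OF \<phi> KK(1)] KK(2)
        linear_0[OF bounded_linear.linear[OF \<phi>]] by (simp add: eq)
  qed
  have "AE x in M01. Re (r x) \<le> 0" "AE x in M01. - Re (r x) \<le> 0" "AE x in M01. Im (r x) \<le> 0" "AE x in M01. - Im (r x) \<le> 0"
    by (rule nonpos, intro bounded_linear_minus bounded_linear_Re bounded_linear_Im)+
  then show ?thesis by eventually_elim (auto intro: complex_eqI)
qed

text \<open>In the induction step one restricts to the kernel of the last functional. The functional \<open>L\<close>
  is complex valued because it comes from an element of the complex \<open>L\<^sup>2\<close>, while test
  functions are real.\<close>

lemma functional_in_span:
  fixes V :: "('a \<Rightarrow> real) set" and l :: "nat \<Rightarrow> ('a \<Rightarrow> real) \<Rightarrow> real" and L :: "('a \<Rightarrow> real) \<Rightarrow> complex"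
  assumes V: "\<And>h h' a b. h \<in> V \<Longrightarrow> h' \<in> V \<Longrightarrow> (\<lambda>x. a * h x + b * h' x) \<in> V"
    and l: "\<And>i h h' a b. i < n \<Longrightarrow> h \<in> V \<Longrightarrow> h' \<in> V \<Longrightarrow> l i (\<lambda>x. a * h x + b * h' x) = a * l i h + b * l i h'"
    and L: "\<And>h h' a b. h \<in> V \<Longrightarrow> h' \<in> V \<Longrightarrow> L (\<lambda>x. a * h x + b * h' x) = of_real a * L h + of_real b * L h'"
    and ker: "\<And>h. h \<in> V \<Longrightarrow> (\<And>i. i < n \<Longrightarrow> l i h = 0) \<Longrightarrow> L h = 0"
  shows "\<exists>c. \<forall>h\<in>V. L h = (\<Sum>i<n. c i * of_real (l i h))"
  using assms
proof (induction n arbitrary: V)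
  case 0
  then show ?case by simp
next
  case (Suc n)
  define V' where "V' = {h\<in>V. l n h = 0}"
  have "\<exists>c. \<forall>h\<in>V'. L h = (\<Sum>i<n. c i * of_real (l i h))"
  proof (rule Suc.IH)
    show "(\<lambda>x. a * h x + b * h' x) \<in> V'" if "h \<in> V'" "h' \<in> V'" for h h' a b
      using that Suc.prems(1)[of h h' a b] Suc.prems(2)[of n h h' a b] by (simp add: V'_def)
    show "l i (\<lambda>x. a * h x + b * h' x) = a * l i h + b * l i h'" if "i < n" "h \<in> V'" "h' \<in> V'" for i h h' a b
      using that by (intro Suc.prems(2)) (auto simp: V'_def)
    show "L (\<lambda>x. a * h x + b * h' x) = of_real a * L h + of_real b * L h'" if "h \<in> V'" "h' \<in> V'" for h h' a b
      using that by (intro Suc.prems(3)) (auto simp: V'_def)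
    show "L h = 0" if "h \<in> V'" "\<And>i. i < n \<Longrightarrow> l i h = 0" for h
      using that by (intro Suc.prems(4)) (auto simp: V'_def less_Suc_eq)
  qed
  then obtain c where c: "\<And>h. h \<in> V' \<Longrightarrow> L h = (\<Sum>i<n. c i * of_real (l i h))" by blast
  show ?case
  proof (cases "V' = V")
    case True
    then have "\<forall>h\<in>V. L h = (\<Sum>i<Suc n. (c(n := 0)) i * of_real (l i h))" using c by simp
    then show ?thesis by blast
  next
    case False
    then obtain h0 where h0: "h0 \<in> V" "l n h0 \<noteq> 0" by (auto simp: V'_def)
    define d where "d = (L h0 - (\<Sum>i<n. c i * of_real (l i h0))) / of_real (l n h0)"
    have "L h = (\<Sum>i<Suc n. (c(n := d)) i * of_real (l i h))" if h: "h \<in> V" for h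
    proof -
      define a where "a = - (l n h / l n h0)"
      define k where "k = (\<lambda>x. 1 * h x + a * h0 x)"
      have k: "k \<in> V" unfolding k_def by (rule Suc.prems(1)[OF h h0(1)])
      have lk: "l i k = l i h + a * l i h0" if "i < Suc n" for i
        unfolding k_def using Suc.prems(2)[OF that h h0(1), of 1 a] by simp
      have "l n k = 0" using lk[of n] h0(2) by (simp add: a_def)
      then have "L k = (\<Sum>i<n. c i * of_real (l i k))" using k by (intro c) (simp add: V'_def)
      also have "\<dots> = (\<Sum>i<n. c i * of_real (l i h)) + of_real a * (\<Sum>i<n. c i * of_real (l i h0))"
        by (simp add: lk algebra_simps sum.distrib sum_distrib_left)
      finally have "L k = (\<Sum>i<n. c i * of_real (l i h)) + of_real a * (\<Sum>i<n. c i * of_real (l i h0))" .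
      moreover have "L k = L h + of_real a * L h0"
        unfolding k_def using Suc.prems(3)[OF h h0(1), of 1 a] by simp
      ultimately have "L h = (\<Sum>i<n. c i * of_real (l i h)) - of_real a * (L h0 - (\<Sum>i<n. c i * of_real (l i h0)))"
        by (simp add: algebra_simps)
      also have "- of_real a * (L h0 - (\<Sum>i<n. c i * of_real (l i h0))) = d * of_real (l n h)"
        by (simp add: a_def d_def)
      then have "(\<Sum>i<n. c i * of_real (l i h)) - of_real a * (L h0 - (\<Sum>i<n. c i * of_real (l i h0)))
         = (\<Sum>i<n. c i * of_real (l i h)) + d * of_real (l n h)"
        by (simp only: diff_conv_add_uminus mult_minus_left)
      finally show ?thesis by simp
    qed
    then show ?thesis by blast
  qed
qed

text \<open>By the preceding lemma there are \<open>c\<^sub>i\<close> such that \<open>k - \<Sum> c\<^sub>i s\<^sub>i\<close>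
  annihilates every test function. Moments are taken against functions vanishing near \<open>1\<close>,
  so that \<open>w\<close> is admitted among the \<open>s\<^sub>i\<close>.\<close>

theorem annihilator_eq_lincomb:
  fixes s :: "nat \<Rightarrow> real \<Rightarrow> real"
  assumes k: "square_integrable k" and s: "\<And>i. i < n \<Longrightarrow> continuous_on {0..<1} (s i)"
    and ann: "\<And>H. H \<in> test_functions \<Longrightarrow> (\<And>i. i < n \<Longrightarrow> (\<integral>x. s i x * H x \<partial>M01) = 0) \<Longrightarrow>
       (\<integral>x. k x * complex_of_real (H x) \<partial>M01) = 0"
  shows "\<exists>c. AE x in M01. k x = (\<Sum>i<n. c i * complex_of_real (s i x))"
proof -
  have ks: "integrable M01 (\<lambda>x. k x * complex_of_real (H x))" if "H \<in> test_functions" for H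
    by (rule integrable_mult_square_integrable[OF k test_functions_square_integrable[OF that]])
  note si = test_functions_integrable[OF _ s]
  have "\<exists>c. \<forall>H\<in>test_functions. (\<integral>x. k x * complex_of_real (H x) \<partial>M01) = (\<Sum>i<n. c i * of_real (\<integral>x. s i x * H x \<partial>M01))"
  proof (rule functional_in_span)
    fix H H' a b assume H: "H \<in> test_functions" "H' \<in> test_functions"
    then show "(\<lambda>x. a * H x + b * H' x) \<in> test_functions" by (rule test_functions_lincomb)
    have "(\<integral>x. k x * complex_of_real (a * H x + b * H' x) \<partial>M01)
       = (\<integral>x. of_real a * (k x * complex_of_real (H x)) + of_real b * (k x * complex_of_real (H' x)) \<partial>M01)"
      by (simp add: algebra_simps)
    also have "\<dots> = of_real a * (\<integral>x. k x * complex_of_real (H x) \<partial>M01) + of_real b * (\<integral>x. k x * complex_of_real (H' x) \<partial>M01)"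
      using ks[OF H(1)] ks[OF H(2)] by simp
    finally show "(\<integral>x. k x * complex_of_real (a * H x + b * H' x) \<partial>M01)
       = of_real a * (\<integral>x. k x * complex_of_real (H x) \<partial>M01) + of_real b * (\<integral>x. k x * complex_of_real (H' x) \<partial>M01)" .
    fix i assume "i < n"
    have "(\<integral>x. s i x * (a * H x + b * H' x) \<partial>M01) = (\<integral>x. a * (s i x * H x) + b * (s i x * H' x) \<partial>M01)"
      by (simp add: algebra_simps)
    also have "\<dots> = a * (\<integral>x. s i x * H x \<partial>M01) + b * (\<integral>x. s i x * H' x \<partial>M01)"
      using si[OF H(1) \<open>i < n\<close>] si[OF H(2) \<open>i < n\<close>] by simp
    finally show "(\<integral>x. s i x * (a * H x + b * H' x) \<partial>M01) = a * (\<integral>x. s i x * H x \<partial>M01) + b * (\<integral>x. s i x * H' x \<partial>M01)" .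
  qed (rule ann)
  then obtain c where c: "\<And>H. H \<in> test_functions \<Longrightarrow>
      (\<integral>x. k x * complex_of_real (H x) \<partial>M01) = (\<Sum>i<n. c i * of_real (\<integral>x. s i x * H x \<partial>M01))" by blast
  define r where "r = (\<lambda>x. k x - (\<Sum>i<n. c i * complex_of_real (s i x)))"
  have expand: "r x * complex_of_real (H x) = k x * complex_of_real (H x) - (\<Sum>i<n. c i * complex_of_real (s i x * H x))" for x H
    by (simp add: r_def left_diff_distrib sum_distrib_right mult.assoc)
  have int_s: "integrable M01 (\<lambda>x. c i * complex_of_real (s i x * H x))" if "i < n" "H \<in> test_functions" for i H
    using si[OF that(2,1)] by (intro Bochner_Integration.integrable_mult_right integrable_of_real)
  have "AE x in M01. r x = 0"
  proof (rule AE_0_if_test_integrals_0)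
    have "s i \<in> borel_measurable M01" if "i < n" for i
      by (rule measurable_M01_continuous[OF continuous_on_subset[OF s[OF that]]]) auto
    then have "(\<lambda>x. \<Sum>i<n. c i * complex_of_real (s i x)) \<in> borel_measurable M01"
      by (intro borel_measurable_sum borel_measurable_times borel_measurable_const borel_measurable_of_real) auto
    moreover have "k \<in> borel_measurable M01" using k by (simp add: square_integrable_def)
    ultimately show "r \<in> borel_measurable M01" unfolding r_def by (intro borel_measurable_diff)
    fix H assume H: "H \<in> test_functions"
    show "integrable M01 (\<lambda>x. r x * complex_of_real (H x))"
      unfolding expand using int_s[OF _ H] by (intro Bochner_Integration.integrable_diff ks[OF H] Bochner_Integration.integrable_sum) auto
    have "(\<integral>x. r x * complex_of_real (H x) \<partial>M01) = (\<integral>x. k x * complex_of_real (H x) \<partial>M01) - (\<integral>x. (\<Sum>i<n. c i * complex_of_real (s i x * H x)) \<partial>M01)"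
      unfolding expand using int_s[OF _ H] by (intro Bochner_Integration.integral_diff ks[OF H] Bochner_Integration.integrable_sum) auto
    also have "(\<integral>x. (\<Sum>i<n. c i * complex_of_real (s i x * H x)) \<partial>M01) = (\<Sum>i<n. \<integral>x. c i * complex_of_real (s i x * H x) \<partial>M01)"
      using int_s[OF _ H] by (intro Bochner_Integration.integral_sum) auto
    also have "\<dots> = (\<Sum>i<n. c i * of_real (\<integral>x. s i x * H x \<partial>M01))"
      by (intro sum.cong refl) (simp only: integral_mult_right_zero integral_complex_of_real)
    finally show "(\<integral>x. r x * complex_of_real (H x) \<partial>M01) = 0" using c[OF H] by simp
  qed
  then have "AE x in M01. k x = (\<Sum>i<n. c i * complex_of_real (s i x))"
    by (rule eventually_mono) (simp add: r_def)
  then show ?thesis by blast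
qed

section \<open>Solutions of the homogeneous equations\<close>

lemma log_power_real: "complex_of_real (Re (log_power s A B x)) = log_power s A B x"
  by (simp add: log_power_def)

lemma log_power_u_sol: "log_power (\<alpha> + 1/2) 1 0 = (\<lambda>x. complex_of_real (u_sol \<alpha> x))"
  and log_power_w_sol: "log_power (1/2 - \<alpha>) 1 0 = (\<lambda>x. complex_of_real (w_sol \<alpha> x))"
  by (simp_all add: fun_eq_iff log_power_def u_sol_def w_sol_def)

lemma measurable_log_power: "log_power s A B \<in> borel_measurable M01"
  by (rule measurable_M01_continuous) (rule continuous_on_log_power, auto)

lemma powr_square: "(t powr s)\<^sup>2 = t powr (2 * s)" for t s :: real
proof -
  have "2 * s = s + s" by simp
  then show ?thesis by (simp only: power2_eq_square powr_add)
qed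

lemma square_integrable_power:
  assumes s: "- 1/2 < s"
  shows "square_integrable (log_power s A 0)"
proof -
  have "((\<lambda>x. x powr (2 * s)) has_integral 1 powr (2 * s + 1) / (2 * s + 1)) {0..1}"
    using s by (intro has_integral_powr_from_0) auto
  then have "((\<lambda>x. x powr (2 * s)) has_integral 1 powr (2 * s + 1) / (2 * s + 1)) (cbox 0 1)" by simp
  from has_integral_affinity[OF this, of "- 1" 1]
  have "(\<lambda>x. (1 - x) powr (2 * s)) integrable_on ((\<lambda>x. 1 - x) ` {0..1::real})" by (auto simp: integrable_on_def)
  moreover have "(\<lambda>x. 1 - x) ` {0..1::real} = {0..1}" by (simp add: image_diff_atLeastAtMost)
  ultimately have "(\<lambda>x. (1 - x) powr (2 * s)) integrable_on {0..1}" by simp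
  then have "(\<lambda>x. (1 - x) powr (2 * s)) integrable_on box 0 1" by (simp add: integrable_on_Icc_iff_Ioo)
  then have "(\<lambda>x. (1 - x) powr (2 * s)) absolutely_integrable_on {0<..<1}"
    by (intro nonnegative_absolutely_integrable_1) auto
  then have "integrable M01 (\<lambda>x. (1 - x) powr (2 * s))"
    by (simp add: set_integrable_def integrable_restrict_space)
  then have "integrable M01 (\<lambda>x. A\<^sup>2 * (1 - x) powr (2 * s))" by simp
  moreover have "A\<^sup>2 * (1 - x) powr (2 * s) = (cmod (log_power s A 0 x))\<^sup>2" for x
    by (simp add: log_power_def norm_mult power_mult_distrib powr_square)
  ultimately show ?thesis unfolding square_integrable_def using measurable_log_power by simp
qed

lemma square_integrable_log:
  assumes s: "1 \<le> s"
  shows "square_integrable (log_power s A B)"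
proof (rule square_integrable_bounded[OF measurable_log_power])
  fix x :: real assume x: "0 < x" "x < 1"
  define t where "t = 1 - x"
  have t: "0 < t" "t < 1" using x by (auto simp: t_def)
  have p: "t powr s \<le> t" using powr_mono'[of 1 s t] t s by simp
  have "- ln t \<le> 1 / t - 1" using ln_le_minus_one[of "1 / t"] t by (simp add: ln_div)
  then have "t * - ln t \<le> t * (1 / t - 1)" using t by (intro mult_left_mono) auto
  then have l: "t * \<bar>ln t\<bar> \<le> 1" using t by (simp add: algebra_simps)
  have "cmod (log_power s A B x) = t powr s * \<bar>A + B * ln t\<bar>"
    unfolding log_power_def norm_of_real t_def by (simp add: abs_mult)
  also have "\<dots> \<le> t * \<bar>A + B * ln t\<bar>" using p by (intro mult_right_mono) auto
  also have "\<dots> \<le> t * (\<bar>A\<bar> + \<bar>B\<bar> * \<bar>ln t\<bar>)"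
    using t abs_triangle_ineq[of A "B * ln t"] by (intro mult_left_mono) (auto simp: abs_mult)
  also have "\<dots> = \<bar>A\<bar> * t + \<bar>B\<bar> * (t * \<bar>ln t\<bar>)" by (simp add: algebra_simps)
  also have "\<dots> \<le> \<bar>A\<bar> * 1 + \<bar>B\<bar> * 1" using t l by (intro add_mono mult_left_mono) auto
  finally show "cmod (log_power s A B x) \<le> \<bar>A\<bar> + \<bar>B\<bar>" by simp
qed

text \<open>\<open>w\<^sup>2 = t^(1 - 2 \<alpha>)\<close> is at least \<open>1/t\<close>, whose integral up to \<open>b\<close> is \<open>-ln (1 -
  b)\<close>.\<close>

lemma w_sol_not_square_integrable:
  assumes \<alpha>: "1 \<le> \<alpha>"
  shows "\<not> square_integrable (\<lambda>x. complex_of_real (w_sol \<alpha> x))"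
proof
  assume "square_integrable (\<lambda>x. complex_of_real (w_sol \<alpha> x))"
  then have "integrable M01 (\<lambda>x. (w_sol \<alpha> x)\<^sup>2)" by (simp add: square_integrable_def)
  from M01_integral_HK[OF this] obtain I where I: "((\<lambda>x. (w_sol \<alpha> x)\<^sup>2) has_integral I) {0..1}" by blast
  have I0: "0 \<le> I" by (rule has_integral_nonneg[OF I]) simp
  define b where "b = 1 - exp (- (I + 1))"
  have b: "0 \<le> b" "b < 1" using I0 by (auto simp: b_def)
  have "((\<lambda>x. 1 / (1 - x)) has_integral (- ln (1 - b)) - (- ln (1 - 0))) {0..b}"
  proof (rule fundamental_theorem_of_calculus[OF b(1)])
    fix x assume x: "x \<in> {0..b}"
    have d: "((\<lambda>x. 1 - x) has_real_derivative - 1) (at x within {0..b})"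
      using DERIV_diff[OF DERIV_const DERIV_ident, of 1 x "{0..b}"] by simp
    have "((\<lambda>x. - ln (1 - x)) has_real_derivative - (1 / (1 - x) * - 1)) (at x within {0..b})"
      by (intro DERIV_minus DERIV_chain2[OF DERIV_ln_divide d]) (use x b in simp)
    then show "((\<lambda>x. - ln (1 - x)) has_vector_derivative 1 / (1 - x)) (at x within {0..b})"
      by (simp add: has_real_derivative_iff_has_vector_derivative)
  qed
  then have "((\<lambda>x. 1 / (1 - x)) has_integral I + 1) {0..b}" by (simp add: b_def add.commute)
  then have "((\<lambda>x. if x \<in> {0..b} then 1 / (1 - x) else 0) has_integral I + 1) {0..1}"
    using b by (subst has_integral_restrict) auto
  then have "I + 1 \<le> I"
  proof (rule has_integral_le[OF _ I])
    fix x :: real assume "x \<in> {0..1}"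
    show "(if x \<in> {0..b} then 1 / (1 - x) else 0) \<le> (w_sol \<alpha> x)\<^sup>2"
    proof (cases "x \<in> {0..b}")
      case True
      then have t: "0 < 1 - x" "1 - x \<le> 1" using b by auto
      have "1 / (1 - x) = (1 - x) powr (- 1)" using t by (simp add: powr_minus_divide)
      also have "\<dots> \<le> (1 - x) powr (2 * (1/2 - \<alpha>))" using t \<alpha> by (intro powr_mono') auto
      also have "\<dots> = (w_sol \<alpha> x)\<^sup>2" by (simp add: w_sol_def powr_square)
      finally show ?thesis using True by simp
    next
      case False
      then show ?thesis by (simp only: if_False zero_le_power2)
    qed
  qed
  then show False by simp
qed

text \<open>\<open>\<tau>\<^sub>2 u\<^sub>2 = u\<close>, since \<open>\<tau>\<^sub>2\<close> maps \<open>t^(\<alpha> + 5/2)\<close> to \<open>-4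
  (\<alpha> + 1) u\<close>.\<close>

definition u2_sol :: "real \<Rightarrow> real \<Rightarrow> complex" where
  "u2_sol \<alpha> = log_power (\<alpha> + 5/2) (- 1 / (4 * (\<alpha> + 1))) 0"

text \<open>\<open>\<tau>\<^sub>2 u\<^sub>3 = w\<close>, since \<open>\<tau>\<^sub>2\<close> maps \<open>t^(5/2 - \<alpha>)\<close> to \<open>4
  (\<alpha> - 1) w\<close>. For \<open>\<alpha> = 1\<close> that power is \<open>u\<close> itself, and the resonance produces
  the logarithm: \<open>\<tau>\<^sub>2\<close> maps \<open>t^(3/2) ln t\<close> to \<open>-2 w\<close>.\<close>

definition u3_sol :: "real \<Rightarrow> real \<Rightarrow> complex" where
  "u3_sol \<alpha> = (if \<alpha> = 1 then log_power (3/2) 0 (- 1/2) else log_power (5/2 - \<alpha>) (1 / (4 * (\<alpha> - 1))) 0)"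

lemma u2_sol_real: "complex_of_real (Re (u2_sol \<alpha> x)) = u2_sol \<alpha> x"
  and u3_sol_real: "complex_of_real (Re (u3_sol \<alpha> x)) = u3_sol \<alpha> x"
  by (simp_all add: u2_sol_def u3_sol_def log_power_real)

lemma continuous_on_u23: "continuous_on {0..<1} (u2_sol \<alpha>)" "continuous_on {0..<1} (u3_sol \<alpha>)"
  by (auto simp: u2_sol_def u3_sol_def intro!: continuous_on_log_power)

text \<open>The bound \<open>\<alpha> < 3\<close> is needed exactly for \<open>u\<^sub>3\<close>.\<close>

lemma square_integrable_solutions:
  assumes "1 \<le> \<alpha>" "\<alpha> < 3"
  shows "square_integrable (\<lambda>x. complex_of_real (u_sol \<alpha> x))" "square_integrable (u2_sol \<alpha>)" "square_integrable (u3_sol \<alpha>)"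
  using square_integrable_power[of "\<alpha> + 1/2" 1] square_integrable_power[of "\<alpha> + 5/2"] square_integrable_power[of "5/2 - \<alpha>"] 
    square_integrable_log[of "3/2"] assms
  by (auto simp: u2_sol_def u3_sol_def log_power_u_sol)

lemma u_sol_weak: "\<exists>u'. weak_solution \<alpha> (\<lambda>x. complex_of_real (u_sol \<alpha> x)) u' (\<lambda>x. 0)"
proof -
  have "weak_solution \<alpha> (log_power (\<alpha> + 1/2) 1 0) (log_power (\<alpha> + 1/2 - 1) (- ((\<alpha> + 1/2) * 1 + 0)) (- ((\<alpha> + 1/2) * 0))) 
      (log_power (\<alpha> + 1/2 - 2) 0 0)"
    by (rule weak_solution_log_power) (simp_all add: power2_eq_square algebra_simps)
  then show ?thesis by (auto simp: log_power_u_sol log_power_0[abs_def])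
qed

lemma u2_sol_coefficient:
  fixes \<alpha> :: real
  assumes "\<alpha> \<noteq> - 1"
  shows "1 = (\<alpha>\<^sup>2 - 1/4 - (\<alpha> + 5/2) * (\<alpha> + 5/2 - 1)) * (- 1 / (4 * (\<alpha> + 1))) - (2 * (\<alpha> + 5/2) - 1) * 0"
proof -
  have "\<alpha>\<^sup>2 - 1/4 - (\<alpha> + 5/2) * (\<alpha> + 5/2 - 1) = - (4 * (\<alpha> + 1))" by (simp add: power2_eq_square algebra_simps)
  moreover have "4 * (\<alpha> + 1) \<noteq> 0" using assms by simp
  moreover have "1 = - c * (- 1 / c) - d * 0" if "c \<noteq> 0" for c d :: real using that by simp
  ultimately show ?thesis by presburger
qed

lemma u3_sol_coefficient:
  fixes \<alpha> :: real
  assumes "\<alpha> \<noteq> 1"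
  shows "1 = (\<alpha>\<^sup>2 - 1/4 - (5/2 - \<alpha>) * (5/2 - \<alpha> - 1)) * (1 / (4 * (\<alpha> - 1))) - (2 * (5/2 - \<alpha>) - 1) * 0"
proof -
  have "\<alpha>\<^sup>2 - 1/4 - (5/2 - \<alpha>) * (5/2 - \<alpha> - 1) = 4 * (\<alpha> - 1)" by (simp add: power2_eq_square algebra_simps)
  moreover have "4 * (\<alpha> - 1) \<noteq> 0" using assms by simp
  ultimately show ?thesis by simp
qed

lemma u2_sol_weak:
  assumes "1 \<le> \<alpha>"
  shows "\<exists>u'. weak_solution \<alpha> (u2_sol \<alpha>) u' (\<lambda>x. complex_of_real (u_sol \<alpha> x))"
proof -
  have "weak_solution \<alpha> (u2_sol \<alpha>) (log_power (\<alpha> + 5/2 - 1) (- ((\<alpha> + 5/2) * (- 1 / (4 * (\<alpha> + 1))) + 0)) (- ((\<alpha> + 5/2) * 0))) 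
      (log_power (\<alpha> + 5/2 - 2) 1 0)"
    unfolding u2_sol_def
    by (rule weak_solution_log_power, rule u2_sol_coefficient) (use assms in auto)
  moreover have "\<alpha> + 5/2 - 2 = \<alpha> + 1/2" by simp
  ultimately show ?thesis unfolding log_power_u_sol[symmetric] by metis
qed

lemma u3_sol_weak:
  shows "\<exists>u'. weak_solution \<alpha> (u3_sol \<alpha>) u' (\<lambda>x. complex_of_real (w_sol \<alpha> x))"
proof (cases "\<alpha> = 1")
  case True
  have "weak_solution \<alpha> (u3_sol \<alpha>) (log_power (3/2 - 1) (- ((3/2) * 0 + (- 1/2))) (- ((3/2) * (- 1/2)))) 
      (log_power (3/2 - 2) 1 0)"
    unfolding u3_sol_def if_P[OF True]
    by (rule weak_solution_log_power) (simp_all add: True)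
  moreover have "(3/2 - 2 :: real) = 1/2 - \<alpha>" using True by simp
  ultimately show ?thesis unfolding log_power_w_sol[symmetric] by metis
next
  case False
  have "weak_solution \<alpha> (u3_sol \<alpha>) (log_power (5/2 - \<alpha> - 1) (- ((5/2 - \<alpha>) * (1 / (4 * (\<alpha> - 1))) + 0)) (- ((5/2 - \<alpha>) * 0))) 
      (log_power (5/2 - \<alpha> - 2) 1 0)"
    unfolding u3_sol_def if_not_P[OF False]
    by (rule weak_solution_log_power, rule u3_sol_coefficient) (use False in auto)
  moreover have "5/2 - \<alpha> - 2 = 1/2 - \<alpha>" by simp
  ultimately show ?thesis unfolding log_power_w_sol[symmetric] by metis
qed

lemma solutions_in_T2max:
  assumes "1 \<le> \<alpha>" "\<alpha> < 3"
  shows "(abs_L2 (\<lambda>x. complex_of_real (u_sol \<alpha> x)), 0) \<in> T2max \<alpha>"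
    and "(abs_L2 (u2_sol \<alpha>), abs_L2 (\<lambda>x. complex_of_real (u_sol \<alpha> x))) \<in> T2max \<alpha>"
proof -
  note sq = square_integrable_solutions[OF assms]
  have "(abs_L2 (log_power (\<alpha> + 1/2) 1 0), abs_L2 (log_power (\<alpha> + 1/2 - 2) 0 0)) \<in> T2max \<alpha>"
    using sq square_integrable_zero
    by (intro log_power_in_T2max) (simp_all add: log_power_u_sol log_power_0[abs_def] power2_eq_square algebra_simps)
  then show "(abs_L2 (\<lambda>x. complex_of_real (u_sol \<alpha> x)), 0) \<in> T2max \<alpha>"
    by (simp add: log_power_u_sol log_power_0[abs_def] zero_L2_abs)
  have e: "\<alpha> + 5/2 - 2 = \<alpha> + 1/2" by simp
  have "(abs_L2 (log_power (\<alpha> + 5/2) (- 1 / (4 * (\<alpha> + 1))) 0), abs_L2 (log_power (\<alpha> + 5/2 - 2) 1 0)) \<in> T2max \<alpha>"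
    using assms by (intro log_power_in_T2max sq[unfolded u2_sol_def] u2_sol_coefficient) 
      (auto simp only: e log_power_u_sol intro: sq)
  then show "(abs_L2 (u2_sol \<alpha>), abs_L2 (\<lambda>x. complex_of_real (u_sol \<alpha> x))) \<in> T2max \<alpha>"
    by (simp only: e log_power_u_sol u2_sol_def)
qed

text \<open>The polynomial \<open>c(s)\<close> in \<open>\<tau>\<^sub>4 t\<^sup>s = c(s) t^(s - 4)\<close> factors because
  \<open>\<tau>\<^sub>4 = \<tau>\<^sub>2\<^sup>2\<close>; its roots are the exponents \<open>1/2 \<plusminus>
  \<alpha>\<close> and \<open>5/2 \<plusminus> \<alpha>\<close>.\<close>

lemma solutions_in_T4max:
  assumes "1 \<le> \<alpha>" "\<alpha> < 3"
  shows "(abs_L2 (\<lambda>x. complex_of_real (u_sol \<alpha> x)), 0) \<in> T4max \<alpha>"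
    and "(abs_L2 (u2_sol \<alpha>), 0) \<in> T4max \<alpha>" and "(abs_L2 (u3_sol \<alpha>), 0) \<in> T4max \<alpha>"
proof -
  note sq = square_integrable_solutions[OF assms]
  have poly: "s * (s - 1) * (s - 2) * (s - 3) - (2 * \<alpha>\<^sup>2 - 1/2) * s * (s - 3) + (\<alpha> ^ 4 - 13/2 * \<alpha>\<^sup>2 + (5/4)\<^sup>2)
      = (s * (s - 1) - (\<alpha>\<^sup>2 - 1/4)) * ((s - 2) * (s - 3) - (\<alpha>\<^sup>2 - 1/4))" for s
    by (simp add: power2_eq_square power4_eq_xxxx field_simps)
  have pow: "(abs_L2 (log_power s A 0), 0) \<in> T4max \<alpha>"
    if "square_integrable (log_power s A 0)" "(s * (s - 1) - (\<alpha>\<^sup>2 - 1/4)) * ((s - 2) * (s - 3) - (\<alpha>\<^sup>2 - 1/4)) = 0" for s A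
  proof (rule log_power_in_T4max[OF that(1)])
    have z: "A * (s * (s - 1) * (s - 2) * (s - 3) - (2 * \<alpha>\<^sup>2 - 1/2) * s * (s - 3) + (\<alpha> ^ 4 - 13/2 * \<alpha>\<^sup>2 + (5/4)\<^sup>2)) = 0"
      unfolding poly that(2) by simp
    show "- ((s - 3) * - ((s - 2) * - ((s - 1) * - (s * A + 0) + - (s * 0)) + - ((s - 1) * - (s * 0))) + - ((s - 2) * - ((s - 1) * - (s * 0)))) +
      (2 * \<alpha>\<^sup>2 - 1/2) * ((s - 3) * - (s * A + 0) + - (s * 0)) + (\<alpha> ^ 4 - 13/2 * \<alpha>\<^sup>2 + (5/4)\<^sup>2) * A = 0"
    proof -
      have "A * (s * (s - 1) * (s - 2) * (s - 3) - c * s * (s - 3) + d) =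
        - ((s - 3) * - ((s - 2) * - ((s - 1) * - (s * A + 0) + - (s * 0)) + - ((s - 1) * - (s * 0))) + - ((s - 2) * - ((s - 1) * - (s * 0)))) +
        c * ((s - 3) * - (s * A + 0) + - (s * 0)) + d * A" for c d
        by (simp add: algebra_simps)
      then show ?thesis using z by (simp only:)
    qed
  qed simp
  show "(abs_L2 (\<lambda>x. complex_of_real (u_sol \<alpha> x)), 0) \<in> T4max \<alpha>"
    unfolding log_power_u_sol[symmetric]
    by (rule pow) (use sq(1) in \<open>simp_all add: log_power_u_sol power2_eq_square algebra_simps\<close>)
  show "(abs_L2 (u2_sol \<alpha>), 0) \<in> T4max \<alpha>"
    unfolding u2_sol_def
    by (rule pow) (use sq(2) in \<open>simp_all add: u2_sol_def power2_eq_square algebra_simps\<close>)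
  show "(abs_L2 (u3_sol \<alpha>), 0) \<in> T4max \<alpha>"
  proof (cases "\<alpha> = 1")
    case True
    show ?thesis
      unfolding u3_sol_def if_P[OF True]
      by (rule log_power_in_T4max) (use sq(3) in \<open>simp_all add: True u3_sol_def power2_eq_square\<close>)
  next
    case False
    show ?thesis
      unfolding u3_sol_def if_not_P[OF False]
      by (rule pow) (use sq(3) False in \<open>simp_all add: u3_sol_def power2_eq_square algebra_simps\<close>)
  qed
qed

section \<open>The ranges of the minimal operators\<close>

lemma inner_L2_commute: "inner_L2 F G = cnj (inner_L2 G F)"
proof -
  obtain f g where fg: "F = abs_L2 f" "square_integrable f" "G = abs_L2 g" "square_integrable g"
    by (metis L2_cases)
  have "cnj (\<integral>x. g x * cnj (f x) \<partial>M01) = (\<integral>x. cnj (g x * cnj (f x)) \<partial>M01)"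
    by (intro integral_bounded_linear[symmetric] bounded_linear_cnj integrable_mult_square_integrable
          square_integrable_cnj fg)
  then show ?thesis using fg by (simp add: inner_L2_abs mult.commute)
qed

lemma inner_L2_zero_left [simp]: "inner_L2 0 G = 0"
proof -
  obtain g where "G = abs_L2 g" "square_integrable g" by (rule L2_cases)
  then show ?thesis using inner_L2_abs[OF square_integrable_zero, of g] by (simp add: zero_L2_abs)
qed

lemma inner_L2_zero_right [simp]: "inner_L2 F 0 = 0"
  using inner_L2_commute[of F 0] by simp

lemma inner_L2_add_right: "inner_L2 F (G + H) = inner_L2 F G + inner_L2 F H"
proof -
  obtain f where f: "F = abs_L2 f" "square_integrable f" by (rule L2_cases)
  obtain g where g: "G = abs_L2 g" "square_integrable g" by (rule L2_cases)
  obtain h where h: "H = abs_L2 h" "square_integrable h" by (rule L2_cases)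
  have i: "integrable M01 (\<lambda>x. f x * cnj (g x))" "integrable M01 (\<lambda>x. f x * cnj (h x))"
    by (intro integrable_mult_square_integrable square_integrable_cnj f g h)+
  have "inner_L2 F (G + H) = (\<integral>x. f x * cnj (g x) + f x * cnj (h x) \<partial>M01)"
    using f g h by (simp add: plus_L2_abs inner_L2_abs square_integrable_add algebra_simps)
  also have "\<dots> = inner_L2 F G + inner_L2 F H"
    using i f g h by (simp add: inner_L2_abs)
  finally show ?thesis .
qed

lemma inner_L2_scale_right: "inner_L2 F (scale_L2 c G) = cnj c * inner_L2 F G"
proof -
  obtain f where f: "F = abs_L2 f" "square_integrable f" by (rule L2_cases)
  obtain g where g: "G = abs_L2 g" "square_integrable g" by (rule L2_cases)
  have "inner_L2 F (scale_L2 c G) = (\<integral>x. cnj c * (f x * cnj (g x)) \<partial>M01)"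
    using f g by (simp add: scale_L2_abs inner_L2_abs square_integrable_scale algebra_simps)
  then show ?thesis using f g by (simp add: inner_L2_abs)
qed

lemma subspace_orth_complement: "L2.subspace (orth_complement_L2 S)"
  unfolding L2.subspace_def orth_complement_L2_def
  by (auto simp: inner_L2_add_right inner_L2_scale_right)

lemma adjoint_L2D: "(g, h) \<in> adjoint_L2 T \<Longrightarrow> (f, Tf) \<in> T \<Longrightarrow> inner_L2 Tf g = inner_L2 f h"
  unfolding adjoint_L2_def by blast

lemma kernel_orthogonal_Range_adjoint:
  assumes "(f, 0) \<in> T"
  shows "f \<in> orth_complement_L2 (Range (adjoint_L2 T))"
  unfolding orth_complement_L2_def
proof (intro CollectI ballI)
  fix h assume "h \<in> Range (adjoint_L2 T)"
  then obtain g where "(g, h) \<in> adjoint_L2 T" by blast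
  from adjoint_L2D[OF this assms] have "inner_L2 f h = 0" by simp
  then show "inner_L2 h f = 0" using inner_L2_commute[of h f] by simp
qed

text \<open>Move the adjoint to the other side twice: \<open>\<langle>f, k\<rangle> = \<langle>f\<^sub>1,
  h\<rangle> = \<langle>0, g\<rangle>\<close>.\<close>

lemma iterated_kernel_orthogonal_Range_adjoint_square:
  assumes "(f, f1) \<in> T" "(f1, 0) \<in> T"
  shows "f \<in> orth_complement_L2 (Range (adjoint_L2 T O adjoint_L2 T))"
  unfolding orth_complement_L2_def
proof (intro CollectI ballI)
  fix k assume "k \<in> Range (adjoint_L2 T O adjoint_L2 T)"
  then obtain g h where gh: "(g, h) \<in> adjoint_L2 T" "(h, k) \<in> adjoint_L2 T" by blast
  have "inner_L2 f k = inner_L2 f1 h" using adjoint_L2D[OF gh(2) assms(1)] by simp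
  also have "\<dots> = 0" using adjoint_L2D[OF gh(1) assms(2)] by simp
  finally show "inner_L2 k f = 0" using inner_L2_commute[of k f] by simp
qed

lemma M01_real_integral_0_iff:
  fixes f :: "real \<Rightarrow> real"
  assumes "integrable M01 f"
  shows "(\<integral>x. f x \<partial>M01) = 0 \<longleftrightarrow> (f has_integral 0) {0..1}"
  using M01_integral_HK[OF assms] has_integral_unique by metis

lemma inner_L2_real:
  assumes "square_integrable (\<lambda>x. complex_of_real (f x))" "square_integrable (\<lambda>x. complex_of_real (g x))"
  shows "inner_L2 (abs_L2 (\<lambda>x. complex_of_real (f x))) (abs_L2 (\<lambda>x. complex_of_real (g x))) =
         complex_of_real (\<integral>x. f x * g x \<partial>M01)"
  using inner_L2_abs[OF assms] by (simp flip: of_real_mult)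

lemma integrable_real_mult:
  assumes "square_integrable (\<lambda>x. complex_of_real (f x))" "square_integrable (\<lambda>x. complex_of_real (g x))"
  shows "integrable M01 (\<lambda>x. f x * g x)"
proof -
  have "integrable M01 (\<lambda>x. Re (complex_of_real (f x) * complex_of_real (g x)))"
    by (rule integrable_Re[OF integrable_mult_square_integrable[OF assms]])
  then show ?thesis by simp
qed

lemma square_integrable_u_bounded:
  assumes "0 < \<alpha>" "continuous_on {0..<1} g" "\<And>x. 0 \<le> x \<Longrightarrow> x < 1 \<Longrightarrow> \<bar>g x\<bar> \<le> C * u_sol \<alpha> x"
  shows "square_integrable (\<lambda>x. complex_of_real (g x))"
proof (rule square_integrable_bounded[of _ C])
  show "(\<lambda>x. complex_of_real (g x)) \<in> borel_measurable M01"
    by (intro measurable_M01_continuous continuous_intros continuous_on_subset[OF assms(2)]) auto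
  fix x :: real assume x: "0 < x" "x < 1"
  have C: "0 \<le> C" using assms(3)[of 0] by (simp add: u_sol_def)
  have "u_sol \<alpha> x \<le> 1" using x assms(1) by (simp add: u_sol_def powr_le1)
  then have "C * u_sol \<alpha> x \<le> C * 1" using C by (rule mult_left_mono)
  then show "cmod (complex_of_real (g x)) \<le> C" using assms(3)[of x] x by simp
qed

lemma test_function_le_u_sol:
  assumes "H \<in> test_functions"
  obtains C where "\<And>x. 0 \<le> x \<Longrightarrow> x < 1 \<Longrightarrow> \<bar>H x\<bar> \<le> C * u_sol \<alpha> x"
proof -
  have "continuous_on {0..<1} (\<lambda>x. 1 / u_sol \<alpha> x)"
    by (intro continuous_intros continuous_on_sol) (auto simp: u_sol_def)
  from test_functions_bound[OF assms this]
  obtain C where C: "\<And>x. 0 \<le> x \<Longrightarrow> x < 1 \<Longrightarrow> \<bar>1 / u_sol \<alpha> x * H x\<bar> \<le> C" by blast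
  have "\<bar>H x\<bar> \<le> C * u_sol \<alpha> x" if "0 \<le> x" "x < 1" for x
  proof -
    have "0 < u_sol \<alpha> x" using that by (simp add: u_sol_def)
    then show ?thesis using C[OF that] by (simp add: abs_mult divide_le_eq)
  qed
  then show ?thesis by (rule that)
qed

text \<open>The bound assumed for \<open>H\<close> holds again for \<open>green \<alpha> H\<close>, which makes the lemma
  applicable a second time.\<close>

lemma green_in_T2min:
  assumes \<alpha>: "1 \<le> \<alpha>" and H: "continuous_on {0..<1} H"
    and bound: "\<And>x. 0 \<le> x \<Longrightarrow> x < 1 \<Longrightarrow> \<bar>H x\<bar> \<le> C * u_sol \<alpha> x"
    and orth: "((\<lambda>x. u_sol \<alpha> x * H x) has_integral 0) {0..1}"
  shows "(abs_L2 (\<lambda>x. complex_of_real (green \<alpha> H x)), abs_L2 (\<lambda>x. complex_of_real (H x))) \<in> T2min \<alpha>"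
proof -
  have \<alpha>0: "0 < \<alpha>" using \<alpha> by simp
  have dec: "\<bar>green \<alpha> H x\<bar> \<le> C * u_sol \<alpha> x" "\<bar>green' \<alpha> H x\<bar> \<le> C * (1 - x) powr (\<alpha> - 1/2)"
    if "0 \<le> x" "x < 1" for x
    by (rule green_decay[OF \<alpha> H _ orth that], rule bound, assumption+)+
  have "(abs_L2 (\<lambda>x. cnj (complex_of_real (green \<alpha> H x))), abs_L2 (\<lambda>x. cnj (complex_of_real (H x)))) \<in> T2min \<alpha>"
  proof (rule decaying_solution_in_T2min[OF \<alpha> green_solution[OF \<alpha>0 H]])
    show "square_integrable (\<lambda>x. complex_of_real (green \<alpha> H x))"
      by (rule square_integrable_u_bounded[OF \<alpha>0 continuous_on_green[OF \<alpha>0 H] dec(1)])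
    show "square_integrable (\<lambda>x. complex_of_real (H x))"
      by (rule square_integrable_u_bounded[OF \<alpha>0 H bound])
    show "cmod (complex_of_real (green \<alpha> H x)) \<le> C * (1 - x) powr (\<alpha> + 1/2)" if "0 \<le> x" "x < 1" for x
      using dec(1)[OF that] by (simp add: u_sol_def)
    show "cmod (complex_of_real (green' \<alpha> H x)) \<le> C * (1 - x) powr (\<alpha> - 1/2)" if "0 \<le> x" "x < 1" for x
      using dec(2)[OF that] by simp
  qed (simp_all add: green_at_0)
  then show ?thesis by simp
qed

lemma test_function_in_Range_T2min:
  assumes \<alpha>: "1 \<le> \<alpha>" and H: "H \<in> test_functions" and orth: "(\<integral>x. u_sol \<alpha> x * H x \<partial>M01) = 0"
  shows "abs_L2 (\<lambda>x. complex_of_real (H x)) \<in> Range (T2min \<alpha>)"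
proof -
  have c: "continuous_on {0..<1} H" using H by (auto simp: test_functions_def elim: continuous_on_subset)
  obtain C where C: "\<And>x. 0 \<le> x \<Longrightarrow> x < 1 \<Longrightarrow> \<bar>H x\<bar> \<le> C * u_sol \<alpha> x"
    using test_function_le_u_sol[OF H] by blast
  have "((\<lambda>x. u_sol \<alpha> x * H x) has_integral 0) {0..1}"
    using orth M01_real_integral_0_iff[OF test_functions_integrable[OF H continuous_on_sol(1)]] by simp
  from green_in_T2min[OF \<alpha> c C this] show ?thesis by blast
qed

text \<open>Solve twice. The second step needs the first solution \<open>g\<close> to be orthogonal to \<open>u =
  \<tau>\<^sub>2 u\<^sub>2\<close>; as \<open>(g, H)\<close> is already known to lie in the adjoint of the
  maximal operator, this is the same as orthogonality of \<open>H\<close> to \<open>u\<^sub>2\<close>.\<close>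

lemma test_function_in_Range_T2min_square:
  assumes \<alpha>: "1 \<le> \<alpha>" "\<alpha> < 3" and H: "H \<in> test_functions" and orth: "(\<integral>x. u_sol \<alpha> x * H x \<partial>M01) = 0"
    "(\<integral>x. Re (u2_sol \<alpha> x) * H x \<partial>M01) = 0"
  shows "abs_L2 (\<lambda>x. complex_of_real (H x)) \<in> Range (T2min \<alpha> O T2min \<alpha>)"
proof -
  have \<alpha>0: "0 < \<alpha>" using \<alpha> by simp
  have c: "continuous_on {0..<1} H" using H by (auto simp: test_functions_def elim: continuous_on_subset)
  obtain C where C: "\<And>x. 0 \<le> x \<Longrightarrow> x < 1 \<Longrightarrow> \<bar>H x\<bar> \<le> C * u_sol \<alpha> x"
    using test_function_le_u_sol[OF H] by blast
  have o1: "((\<lambda>x. u_sol \<alpha> x * H x) has_integral 0) {0..1}"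
    using orth M01_real_integral_0_iff[OF test_functions_integrable[OF H continuous_on_sol(1)]] by simp
  let ?g = "green \<alpha> H"
  have dec: "\<bar>?g x\<bar> \<le> C * u_sol \<alpha> x" if "0 \<le> x" "x < 1" for x
    by (rule green_decay(1)[OF \<alpha>(1) c _ o1 that], rule C, assumption+)
  have cg: "continuous_on {0..<1} ?g" by (rule continuous_on_green[OF \<alpha>0 c])
  note sq = square_integrable_solutions[OF \<alpha>]
  have sqg: "square_integrable (\<lambda>x. complex_of_real (?g x))"
    by (rule square_integrable_u_bounded[OF \<alpha>0 cg dec])
  have gH: "(abs_L2 (\<lambda>x. complex_of_real (?g x)), abs_L2 (\<lambda>x. complex_of_real (H x))) \<in> T2min \<alpha>"
    by (rule green_in_T2min[OF \<alpha>(1) c C o1])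
  from adjoint_L2D[OF this[unfolded T2min_def] solutions_in_T2max(2)[OF \<alpha>]]
  have "inner_L2 (abs_L2 (\<lambda>x. complex_of_real (u_sol \<alpha> x))) (abs_L2 (\<lambda>x. complex_of_real (?g x))) =
      inner_L2 (abs_L2 (\<lambda>x. complex_of_real (Re (u2_sol \<alpha> x)))) (abs_L2 (\<lambda>x. complex_of_real (H x)))"
    by (simp only: u2_sol_real)
  also have "\<dots> = 0"
    using sq(2) by (subst inner_L2_real) (simp_all add: u2_sol_real test_functions_square_integrable[OF H] orth)
  finally have "(\<integral>x. u_sol \<alpha> x * ?g x \<partial>M01) = 0"
    by (simp add: inner_L2_real[OF sq(1) sqg])
  then have "((\<lambda>x. u_sol \<alpha> x * ?g x) has_integral 0) {0..1}"
    using M01_real_integral_0_iff[OF integrable_real_mult[OF sq(1) sqg]] by simp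
  from green_in_T2min[OF \<alpha>(1) cg dec this] gH show ?thesis by blast
qed

text \<open>Lagrange identity for \<open>p\<close> and \<open>green \<alpha> H\<close>: both boundary terms vanish, the right one
  because \<open>H\<close> is orthogonal to \<open>u\<close> and to \<open>w\<close>. The solution is cut off at \<open>b\<close>, as its
  defining formula has no meaning beyond \<open>1\<close>.\<close>

lemma green_moment:
  assumes \<alpha>: "0 < \<alpha>" and c: "continuous_on {0..<1} H"
    and orth: "((\<lambda>x. u_sol \<alpha> x * H x) has_integral 0) {0..1}" "((\<lambda>x. w_sol \<alpha> x * H x) has_integral 0) {0..1}"
    and b: "0 \<le> b" "b < 1" "\<And>x. b \<le> x \<Longrightarrow> H x = 0"
    and p: "weak_solution \<alpha> (\<lambda>x. complex_of_real (p x)) p' (\<lambda>x. complex_of_real (k x))"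
    and pH: "((\<lambda>x. p x * H x) has_integral 0) {0..1}"
  shows "((\<lambda>x. k x * (if x \<in> {0..b} then green \<alpha> H x else 0)) has_integral 0) {0..1}"
proof -
  note z = green_compact_support[OF orth b(3) b(1) order_refl b(2)]
  have "((\<lambda>x. complex_of_real (k x) * complex_of_real (green \<alpha> H x) - complex_of_real (p x) * complex_of_real (H x)) has_integral 0) {0..b}"
    using weak_solution_Lagrange[OF p green_solution[OF \<alpha> c] b(1,2)] by (simp add: z green_at_0)
  then have "((\<lambda>x. Re (complex_of_real (k x) * complex_of_real (green \<alpha> H x) - complex_of_real (p x) * complex_of_real (H x))) has_integral Re 0) {0..b}"
    by (rule has_integral_Re)
  then have 1: "((\<lambda>x. k x * green \<alpha> H x - p x * H x) has_integral 0) {0..b}" by simp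
  have "((\<lambda>x. p x * H x) has_integral 0) {0..1} \<longleftrightarrow> ((\<lambda>x. if x \<in> {0..b} then p x * H x else 0) has_integral 0) {0..1}"
    by (rule has_integral_cong) (use b(3) in auto)
  then have "((\<lambda>x. if x \<in> {0..b} then p x * H x else 0) has_integral 0) {0..1}" using pH by blast
  then have "((\<lambda>x. p x * H x) has_integral 0) {0..b}"
    using b by (subst (asm) has_integral_restrict) auto
  from has_integral_add[OF 1 this] have "((\<lambda>x. k x * green \<alpha> H x) has_integral 0) {0..b}" by simp
  then have "((\<lambda>x. if x \<in> {0..b} then k x * green \<alpha> H x else 0) has_integral 0) {0..1}"
    using b by (subst has_integral_restrict) auto
  then show ?thesis by (rule has_integral_eq[rotated]) auto
qed

text \<open>With all four orthogonality conditions both successive solutions \<open>g\<close> and \<open>green \<alpha> g\<close>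
  have compact support in \<open>[0, 1)\<close>, and two applications of the Lagrange identity suffice,
  without any estimate at the singular end point.\<close>

lemma test_function_in_Range_T4min:
  assumes \<alpha>: "1 \<le> \<alpha>" and H: "H \<in> test_functions" and orth: "(\<integral>x. u_sol \<alpha> x * H x \<partial>M01) = 0"
    "(\<integral>x. Re (u2_sol \<alpha> x) * H x \<partial>M01) = 0" "(\<integral>x. Re (u3_sol \<alpha> x) * H x \<partial>M01) = 0"
    "(\<integral>x. w_sol \<alpha> x * H x \<partial>M01) = 0"
  shows "abs_L2 (\<lambda>x. complex_of_real (H x)) \<in> Range (T4min \<alpha>)"
proof -
  have \<alpha>0: "0 < \<alpha>" using \<alpha> by simp
  have c: "continuous_on {0..<1} H" using H by (auto simp: test_functions_def elim: continuous_on_subset)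
  obtain b0 where b0: "b0 < 1" "\<And>x. b0 \<le> x \<Longrightarrow> H x = 0" using H by (auto simp: test_functions_def)
  define b where "b = max 0 b0"
  have b: "0 \<le> b" "b < 1" "\<And>x. b \<le> x \<Longrightarrow> H x = 0" using b0 by (auto simp: b_def)
  have cRe: "continuous_on {0..<1} (\<lambda>x. Re (u2_sol \<alpha> x))" "continuous_on {0..<1} (\<lambda>x. Re (u3_sol \<alpha> x))"
    by (intro continuous_intros continuous_on_u23)+
  note HK = M01_real_integral_0_iff[OF test_functions_integrable[OF H], THEN iffD1]
  have o: "((\<lambda>x. u_sol \<alpha> x * H x) has_integral 0) {0..1}" "((\<lambda>x. w_sol \<alpha> x * H x) has_integral 0) {0..1}"
    "((\<lambda>x. Re (u2_sol \<alpha> x) * H x) has_integral 0) {0..1}" "((\<lambda>x. Re (u3_sol \<alpha> x) * H x) has_integral 0) {0..1}"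
    by (intro HK continuous_on_sol cRe orth)+
  let ?g = "green \<alpha> H"
  have g0: "?g x = 0" if "b \<le> x" "x < 1" for x
    by (rule green_compact_support(1)[OF o(1,2) _ b(1) that]) (rule b(3))
  \<comment> \<open>\<open>G\<close> agrees with \<open>g\<close> on \<open>[0, 1)\<close> and vanishes on all of \<open>[b, \<infinity>)\<close>.\<close>
  define G where "G = (\<lambda>x. if x \<in> {0..b} then ?g x else 0)"
  have Gg: "G x = ?g x" if "0 \<le> x" "x < 1" for x using g0[of x] that by (auto simp: G_def)
  have G0: "G x = 0" if "b \<le> x" for x using g0[of b] b that by (auto simp: G_def)
  have cG: "continuous_on {0..<1} G"
    using continuous_on_green[OF \<alpha>0 c] by (rule continuous_on_eq) (simp add: Gg)
  obtain u2' where "weak_solution \<alpha> (\<lambda>x. complex_of_real (Re (u2_sol \<alpha> x))) u2' (\<lambda>x. complex_of_real (u_sol \<alpha> x))"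
    using u2_sol_weak[OF \<alpha>] by (auto simp only: u2_sol_real)
  from green_moment[OF \<alpha>0 c o(1,2) b this o(3)]
  have oG1: "((\<lambda>x. u_sol \<alpha> x * G x) has_integral 0) {0..1}" unfolding G_def .
  obtain u3' where "weak_solution \<alpha> (\<lambda>x. complex_of_real (Re (u3_sol \<alpha> x))) u3' (\<lambda>x. complex_of_real (w_sol \<alpha> x))"
    using u3_sol_weak[of \<alpha>] by (auto simp only: u3_sol_real)
  from green_moment[OF \<alpha>0 c o(1,2) b this o(4)]
  have oG2: "((\<lambda>x. w_sol \<alpha> x * G x) has_integral 0) {0..1}" unfolding G_def .
  let ?gg = "green \<alpha> G"
  have gg0: "?gg x = 0" "green' \<alpha> G x = 0" if "b \<le> x" "x < 1" for x
    by (rule green_compact_support[OF oG1 oG2 _ b(1) that], rule G0, assumption)+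
  have gb0: "?g b = 0" "green' \<alpha> H b = 0"
    by (rule green_compact_support[OF o(1,2) _ b(1) order_refl b(2)], rule b(3), assumption)+
  have sqgg: "square_integrable (\<lambda>x. complex_of_real (?gg x))"
  proof -
    have cgg: "continuous_on {0..<1} ?gg" by (rule continuous_on_green[OF \<alpha>0 cG])
    then have "continuous_on {0..b} ?gg" by (rule continuous_on_subset) (use b in auto)
    from compact_imp_bounded[OF compact_continuous_image[OF this compact_Icc]]
    obtain B where B: "\<forall>x\<in>{0..b}. \<bar>?gg x\<bar> \<le> B"
      unfolding bounded_iff ball_simps real_norm_def by blast
    have "\<bar>?gg x\<bar> \<le> max B 0" if "0 < x" "x < 1" for x
    proof (cases "x \<le> b")
      case True
      then have "\<bar>?gg x\<bar> \<le> B" using B that by auto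
      then show ?thesis by simp
    next
      case False
      then show ?thesis using gg0(1)[of x] that by simp
    qed
    then show ?thesis
      by (intro square_integrable_bounded[of _ "max B 0"] measurable_M01_continuous continuous_intros
            continuous_on_subset[OF cgg]) auto
  qed
  note sqH = test_functions_square_integrable[OF H]
  have "(abs_L2 (\<lambda>x. complex_of_real (?gg x)), abs_L2 (\<lambda>x. complex_of_real (H x))) \<in> T4min \<alpha>"
    unfolding T4min_def adjoint_L2_def
  proof clarify
    fix F F4 assume "(F, F4) \<in> T4max \<alpha>"
    then obtain f f' p p' k where f: "F = abs_L2 f" "F4 = abs_L2 k" "square_integrable f" "square_integrable k"
      "weak_solution \<alpha> f f' p" "weak_solution \<alpha> p p' k" by (rule T4maxE)
    have 1: "((\<lambda>x. k x * complex_of_real (?gg x) - p x * complex_of_real (G x)) has_integral 0) {0..b}"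
      using weak_solution_Lagrange[OF f(6) green_solution[OF \<alpha>0 cG] b(1,2)] gg0[of b] b(2) by (simp add: green_at_0)
    have "((\<lambda>x. p x * complex_of_real (?g x) - f x * complex_of_real (H x)) has_integral 0) {0..b}"
      using weak_solution_Lagrange[OF f(5) green_solution[OF \<alpha>0 c] b(1,2)] gb0 by (simp add: green_at_0)
    then have "((\<lambda>x. p x * complex_of_real (G x) - f x * complex_of_real (H x)) has_integral 0) {0..b}"
      by (rule has_integral_eq[rotated]) (simp add: G_def)
    from has_integral_add[OF 1 this]
    have "((\<lambda>x. k x * complex_of_real (?gg x) - f x * complex_of_real (H x)) has_integral 0) {0..b}" by simp
    then have "((\<lambda>x. if x \<in> {0..b} then k x * complex_of_real (?gg x) - f x * complex_of_real (H x) else 0) has_integral 0) {0..1}"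
      using b by (subst has_integral_restrict) auto
    then have 2: "((\<lambda>x. k x * complex_of_real (?gg x) - f x * complex_of_real (H x)) has_integral 0) {0..1}"
      by (rule has_integral_spike_finite[rotated 2, where S="{1}"]) (use gg0(1) b(3) in auto)
    have i: "integrable M01 (\<lambda>x. k x * complex_of_real (?gg x))" "integrable M01 (\<lambda>x. f x * complex_of_real (H x))"
      by (intro integrable_mult_square_integrable f sqgg sqH)+
    from has_integral_unique[OF 2 M01_integral_HK[OF Bochner_Integration.integrable_diff[OF i]]]
    have "(\<integral>x. k x * complex_of_real (?gg x) \<partial>M01) = (\<integral>x. f x * complex_of_real (H x) \<partial>M01)"
      using i by simp
    then show "inner_L2 F4 (abs_L2 (\<lambda>x. complex_of_real (?gg x))) = inner_L2 F (abs_L2 (\<lambda>x. complex_of_real (H x)))"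
      using f sqgg sqH by (simp add: inner_L2_abs)
  qed
  then show ?thesis by blast
qed

section \<open>Linear independence\<close>

text \<open>Nonempty open sets are not negligible.\<close>

lemma continuous_AE_0:
  fixes f :: "real \<Rightarrow> complex"
  assumes c: "continuous_on {0<..<1} f" and z: "AE x in M01. f x = 0" and x: "0 < x" "x < 1"
  shows "f x = 0"
proof (rule ccontr)
  assume nz: "f x \<noteq> 0"
  define S where "S = {0<..<1} \<inter> f -` (- {0})"
  have "open S" unfolding S_def by (rule continuous_open_preimage[OF c]) auto
  moreover have "x \<in> S" using nz x by (simp add: S_def)
  ultimately have "\<not> negligible S" by (metis open_not_negligible empty_iff)
  moreover have "AE x in lebesgue. x \<notin> S" using z unfolding AE_M01_iff by (rule eventually_mono) (auto simp: S_def)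
  then have "emeasure lebesgue {x \<in> space lebesgue. x \<in> S} = 0" by (intro emeasure_eq_0_AE)
  then have "negligible S" using \<open>open S\<close> by (simp add: negligible_iff_null_sets null_sets_def)
  ultimately show False by blast
qed

lemma weak_solution_lincomb:
  assumes "weak_solution \<alpha> f f' k" "weak_solution \<alpha> g g' h"
  shows "weak_solution \<alpha> (\<lambda>x. a * f x + b * g x) (\<lambda>x. a * f' x + b * g' x) (\<lambda>x. a * k x + b * h x)"
  unfolding weak_solution_def
proof (intro conjI)
  have const: "AC_loc (\<lambda>x. c)" for c :: complex
    by (rule continuously_differentiable_AC_loc[of _ "\<lambda>x. 0"]) auto
  show "AC_loc (\<lambda>x. a * f x + b * g x)" "AC_loc (\<lambda>x. a * f' x + b * g' x)"
    using assms by (auto simp: weak_solution_def intro!: AC_loc_add AC_loc_mult const)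
  from conjunct2[OF conjunct2[OF assms(1)[unfolded weak_solution_def]]] conjunct2[OF conjunct2[OF assms(2)[unfolded weak_solution_def]]]
  show "AE x in M01. ((\<lambda>x. a * f x + b * g x) has_vector_derivative a * f' x + b * g' x) (at x) \<and>
     ((\<lambda>x. a * f' x + b * g' x) has_vector_derivative potential \<alpha> x * (a * f x + b * g x) - (a * k x + b * h x)) (at x)"
  proof eventually_elim
    case (elim x)
    then have "((\<lambda>x. a * f x + b * g x) has_vector_derivative a * f' x + b * g' x) (at x)"
      "((\<lambda>x. a * f' x + b * g' x) has_vector_derivative a * (potential \<alpha> x * f x - k x) + b * (potential \<alpha> x * g x - h x)) (at x)"
      by (auto intro!: has_vector_derivative_add has_vector_derivative_mult_right)
    then show ?case by (simp add: algebra_simps)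
  qed
qed

text \<open>The derivative \<open>f'\<close> is \<open>0\<close> almost everywhere, hence everywhere by continuity, and so the
  equation reduces to \<open>k = 0\<close>.\<close>

lemma weak_solution_0_imp_0:
  assumes sol: "weak_solution \<alpha> f f' k" and k: "continuous_on {0..<1} k" and f: "AE x in M01. f x = 0" and x: "0 < x" "x < 1"
  shows "k x = 0"
proof -
  have AC: "AC_loc f" "AC_loc f'" using sol by (auto simp: weak_solution_def)
  have cont: "continuous_on {0<..<1} h" if "continuous_on {0..<1} h" for h :: "real \<Rightarrow> complex"
    by (rule continuous_on_subset[OF that]) auto
  have f0: "f y = 0" if "0 < y" "y < 1" for y
    by (rule continuous_AE_0[OF cont[OF AC_loc_imp_continuous_on[OF AC(1)]] f that])
  have d0: "h' = 0" if "(h has_vector_derivative h') (at y)" "\<And>z. 0 < z \<Longrightarrow> z < 1 \<Longrightarrow> h z = 0" "0 < y" "y < 1" for h h' and y :: real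
  proof -
    have "((\<lambda>x. 0) has_vector_derivative h') (at y)"
      by (rule has_vector_derivative_transform_within_open[OF that(1), of "{0<..<1}"]) (use that in auto)
    then show ?thesis using vector_derivative_unique_at[OF _ has_vector_derivative_const] by blast
  qed
  have x01: "AE x in M01. 0 < x \<and> x < 1" unfolding AE_M01_iff by auto
  note sol' = conjunct2[OF conjunct2[OF sol[unfolded weak_solution_def]]]
  have "AE x in M01. f' x = 0"
    using sol' x01 by eventually_elim (blast intro: d0 f0)
  then have f'0: "f' y = 0" if "0 < y" "y < 1" for y
    by (rule continuous_AE_0[OF cont[OF AC_loc_imp_continuous_on[OF AC(2)]] _ that])
  have "AE x in M01. k x = 0"
    using sol' x01
  proof eventually_elim
    case (elim x)
    then have "(f' has_vector_derivative (potential \<alpha> x * f x - k x)) (at x)" "0 < x" "x < 1" by auto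
    from d0[OF this(1) f'0 this(2,3)] have "potential \<alpha> x * f x - k x = 0" .
    then show ?case using f0[of x] elim by simp
  qed
  then show ?thesis by (rule continuous_AE_0[OF cont[OF k] _ x])
qed

lemma u_w_independent:
  assumes \<alpha>: "0 < \<alpha>" and z: "\<And>x. 0 < x \<Longrightarrow> x < 1 \<Longrightarrow> b * complex_of_real (u_sol \<alpha> x) + c * complex_of_real (w_sol \<alpha> x) = 0"
  shows "b = 0" "c = 0"
proof -
  have *: "b * complex_of_real (t powr (2 * \<alpha>)) + c = 0" if t: "0 < t" "t < 1" for t
  proof -
    have e: "u_sol \<alpha> (1 - t) = t powr (2 * \<alpha>) * w_sol \<alpha> (1 - t)" "w_sol \<alpha> (1 - t) \<noteq> 0"
      using t by (simp_all add: u_sol_def w_sol_def flip: powr_add)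
    have "(b * complex_of_real (t powr (2 * \<alpha>)) + c) * complex_of_real (w_sol \<alpha> (1 - t)) = 0"
      using z[of "1 - t"] t unfolding e(1) by (simp add: algebra_simps)
    then show ?thesis using e(2) by simp
  qed
  have "b * complex_of_real ((1/2) powr (2 * \<alpha>)) + c - (b * complex_of_real ((1/4) powr (2 * \<alpha>)) + c) = 0"
    using *[of "1/2"] *[of "1/4"] by simp
  then have "b * complex_of_real ((1/2) powr (2 * \<alpha>) - (1/4) powr (2 * \<alpha>)) = 0"
    by (simp add: algebra_simps)
  moreover have "(1/4::real) powr (2 * \<alpha>) < (1/2) powr (2 * \<alpha>)" using \<alpha> by (intro powr_less_mono2) auto
  ultimately show "b = 0" by simp
  then show "c = 0" using *[of "1/2"] by simp
qed

text \<open>Apply \<open>\<tau>\<^sub>2\<close> to a vanishing linear combination: this leaves a relation between \<open>u\<close>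
  and \<open>w\<close>, whose quotient \<open>t^(2 \<alpha>)\<close> is not constant.\<close>

lemma solutions_independent:
  assumes \<alpha>: "1 \<le> \<alpha>" "\<alpha> < 3"
    and z: "scale_L2 a (abs_L2 (\<lambda>x. complex_of_real (u_sol \<alpha> x))) + scale_L2 b (abs_L2 (u2_sol \<alpha>)) + scale_L2 c (abs_L2 (u3_sol \<alpha>)) = 0"
  shows "a = 0 \<and> b = 0 \<and> c = 0"
proof -
  note sq = square_integrable_solutions[OF \<alpha>]
  obtain u' where u: "weak_solution \<alpha> (\<lambda>x. complex_of_real (u_sol \<alpha> x)) u' (\<lambda>x. 0)" using u_sol_weak by blast
  obtain u2' where u2: "weak_solution \<alpha> (u2_sol \<alpha>) u2' (\<lambda>x. complex_of_real (u_sol \<alpha> x))" using u2_sol_weak[OF \<alpha>(1)] by blast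
  obtain u3' where u3: "weak_solution \<alpha> (u3_sol \<alpha>) u3' (\<lambda>x. complex_of_real (w_sol \<alpha> x))" using u3_sol_weak by blast
  have "abs_L2 (\<lambda>x. a * complex_of_real (u_sol \<alpha> x) + b * u2_sol \<alpha> x + c * u3_sol \<alpha> x) = abs_L2 (\<lambda>x. 0)"
    using z sq by (simp add: scale_L2_abs plus_L2_abs square_integrable_scale square_integrable_add zero_L2_abs)
  then have ae: "AE x in M01. a * complex_of_real (u_sol \<alpha> x) + b * u2_sol \<alpha> x + c * u3_sol \<alpha> x = 0"
    using sq by (subst (asm) abs_L2_eq_iff) (auto intro!: square_integrable_scale square_integrable_add square_integrable_zero)
  have cu: "continuous_on {0..<1} (\<lambda>x. complex_of_real (u_sol \<alpha> x))" "continuous_on {0..<1} (\<lambda>x. complex_of_real (w_sol \<alpha> x))"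
    by (intro continuous_intros continuous_on_sol)+
  from weak_solution_lincomb[OF weak_solution_lincomb[OF u u2, of a b] u3, of 1 c]
  have sol: "weak_solution \<alpha> (\<lambda>x. a * complex_of_real (u_sol \<alpha> x) + b * u2_sol \<alpha> x + c * u3_sol \<alpha> x)
     (\<lambda>x. a * u' x + b * u2' x + c * u3' x) (\<lambda>x. b * complex_of_real (u_sol \<alpha> x) + c * complex_of_real (w_sol \<alpha> x))"
    by simp
  have "b * complex_of_real (u_sol \<alpha> x) + c * complex_of_real (w_sol \<alpha> x) = 0" if "0 < x" "x < 1" for x
    by (rule weak_solution_0_imp_0[OF sol _ ae that]) (intro continuous_intros cu)
  from u_w_independent[OF _ this] \<alpha> have bc: "b = 0" "c = 0" by auto
  have "AE x in M01. a * complex_of_real (u_sol \<alpha> x) = 0" using ae by (simp add: bc)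
  moreover have "continuous_on {0<..<1} (\<lambda>x. a * complex_of_real (u_sol \<alpha> x))"
    by (intro continuous_intros continuous_on_subset[OF cu(1)]) auto
  ultimately have "a * complex_of_real (u_sol \<alpha> (1/2)) = 0"
    using continuous_AE_0[of "\<lambda>x. a * complex_of_real (u_sol \<alpha> x)" "1/2"] by simp
  then have "a = 0" by (simp add: u_sol_def)
  with bc show ?thesis by blast
qed

section \<open>The deficiency numbers\<close>

text \<open>This gives the upper bound for all three deficiencies, with one, two and four functions
  \<open>s\<^sub>i\<close>.\<close>

lemma orthogonal_imp_lincomb:
  fixes s :: "nat \<Rightarrow> real \<Rightarrow> real"
  assumes K: "K \<in> orth_complement_L2 R" and s: "\<And>i. i < n \<Longrightarrow> continuous_on {0..<1} (s i)"
    and R: "\<And>H. H \<in> test_functions \<Longrightarrow> (\<And>i. i < n \<Longrightarrow> (\<integral>x. s i x * H x \<partial>M01) = 0) \<Longrightarrow>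
       abs_L2 (\<lambda>x. complex_of_real (H x)) \<in> R"
  obtains k c where "K = abs_L2 k" "square_integrable k" "AE x in M01. k x = (\<Sum>i<n. c i * complex_of_real (s i x))"
proof -
  obtain k where k: "K = abs_L2 k" "square_integrable k" by (rule L2_cases)
  have "\<exists>c. AE x in M01. k x = (\<Sum>i<n. c i * complex_of_real (s i x))"
  proof (rule annihilator_eq_lincomb[OF k(2) s])
    fix H assume H: "H \<in> test_functions" "\<And>i. i < n \<Longrightarrow> (\<integral>x. s i x * H x \<partial>M01) = 0"
    have "inner_L2 (abs_L2 (\<lambda>x. complex_of_real (H x))) K = 0"
      using K R[OF H] by (simp add: orth_complement_L2_def)
    then have "inner_L2 K (abs_L2 (\<lambda>x. complex_of_real (H x))) = 0"
      using inner_L2_commute[of K "abs_L2 (\<lambda>x. complex_of_real (H x))"] by simp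
    then show "(\<integral>x. k x * complex_of_real (H x) \<partial>M01) = 0"
      using k test_functions_square_integrable[OF H(1)] by (simp add: inner_L2_abs)
  qed
  then show ?thesis using that k by blast
qed

lemma independent_solutions:
  assumes "\<And>a b c. scale_L2 a U + scale_L2 b V + scale_L2 c W = 0 \<Longrightarrow> a = 0 \<and> b = 0 \<and> c = 0"
  shows "L2.independent {U, V, W}" "V \<noteq> U" "W \<noteq> V" "W \<noteq> U"
proof -
  have U: "U \<noteq> 0" using assms[of 1 0 0] by auto
  have V: "V \<notin> L2.span {U}"
  proof
    assume "V \<in> L2.span {U}"
    then obtain a where "V = scale_L2 a U" by (auto simp: L2.span_singleton)
    then have "scale_L2 (- a) U + scale_L2 1 V + scale_L2 0 W = 0" by (simp add: L2.scale_minus_left)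
    from assms[OF this] show False by simp
  qed
  have W: "W \<notin> L2.span {V, U}"
  proof
    assume "W \<in> L2.span {V, U}"
    then obtain b a where "W - scale_L2 b V = scale_L2 a U"
      by (auto simp: L2.span_insert[of V "{U}"] L2.span_singleton)
    then have "scale_L2 (- a) U + scale_L2 (- b) V + scale_L2 1 W = 0"
      by (simp add: L2.scale_minus_left algebra_simps)
    from assms[OF this] show False by simp
  qed
  show ne: "V \<noteq> U" "W \<noteq> V" "W \<noteq> U" using V W by (auto intro: L2.span_base)
  have "L2.independent {U}" using U by (simp add: L2.independent_insert)
  from L2.independent_insertI[OF W L2.independent_insertI[OF V this]]
  have "L2.independent {W, V, U}" .
  then show "L2.independent {U, V, W}" by (simp add: insert_commute)
qed

lemma deficiency0_eq_card:
  assumes "orth_complement_L2 (Range T) = L2.span B" "L2.independent B"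
  shows "deficiency0 T = card B"
  unfolding deficiency0_def assms(1) by (rule L2.dim_span_eq_card_independent[OF assms(2)])

theorem mainTheorem3:
  fixes \<alpha> :: real
  assumes "\<alpha> \<in> {1..<3}"
  shows "deficiency0 (T2min \<alpha>) = 1 \<and>
         deficiency0 (T2min \<alpha> O T2min \<alpha>) = 2 \<and>
         2 = 2 * deficiency0 (T2min \<alpha>) \<and>
         deficiency0 (T4min \<alpha>) = 3"
proof -
  have \<alpha>: "1 \<le> \<alpha>" "\<alpha> < 3" using assms by auto
  note sq = square_integrable_solutions[OF \<alpha>]
  note sub = subspace_orth_complement
  define U where "U = abs_L2 (\<lambda>x. complex_of_real (u_sol \<alpha> x))"
  define V where "V = abs_L2 (u2_sol \<alpha>)"
  define W where "W = abs_L2 (u3_sol \<alpha>)"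
  have zero: "scale_L2 a U + scale_L2 b V + scale_L2 c W = 0 \<Longrightarrow> a = 0 \<and> b = 0 \<and> c = 0" for a b c
    unfolding U_def V_def W_def by (rule solutions_independent[OF \<alpha>])
  have ind: "L2.independent {U, V, W}" and ne: "U \<noteq> V" "V \<noteq> W" "U \<noteq> W"
    using independent_solutions[OF zero] by metis+
  have comb: "scale_L2 a U + scale_L2 b V + scale_L2 c W = 
      abs_L2 (\<lambda>x. a * complex_of_real (u_sol \<alpha> x) + b * u2_sol \<alpha> x + c * u3_sol \<alpha> x)"
    "square_integrable (\<lambda>x. a * complex_of_real (u_sol \<alpha> x) + b * u2_sol \<alpha> x + c * u3_sol \<alpha> x)" for a b c
    unfolding U_def V_def W_def using sq 
    by (simp_all add: scale_L2_abs plus_L2_abs square_integrable_scale square_integrable_add)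
  define s where "s = (\<lambda>i. [u_sol \<alpha>, \<lambda>x. Re (u2_sol \<alpha> x), \<lambda>x. Re (u3_sol \<alpha> x), w_sol \<alpha>] ! i)"
  have s: "continuous_on {0..<1} (s i)" if "i < 4" for i
    using that by (auto simp: s_def numeral_eq_Suc less_Suc_eq intro!: continuous_on_sol continuous_intros continuous_on_u23)
  have s_simps: "s 0 = u_sol \<alpha>" "s 1 = (\<lambda>x. Re (u2_sol \<alpha> x))" "s 2 = (\<lambda>x. Re (u3_sol \<alpha> x))" "s 3 = w_sol \<alpha>"
    by (simp_all add: s_def numeral_eq_Suc)
  have "orth_complement_L2 (Range (T2min \<alpha>)) = L2.span {U}"
  proof
    show "orth_complement_L2 (Range (T2min \<alpha>)) \<subseteq> L2.span {U}"
    proof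
      fix K assume "K \<in> orth_complement_L2 (Range (T2min \<alpha>))"
      then obtain k c where k: "K = abs_L2 k" "square_integrable k" "AE x in M01. k x = (\<Sum>i<1. c i * complex_of_real (s i x))"
      proof (rule orthogonal_imp_lincomb)
        fix H assume "H \<in> test_functions" "\<And>i. i < 1 \<Longrightarrow> (\<integral>x. s i x * H x \<partial>M01) = 0"
        then show "abs_L2 (\<lambda>x. complex_of_real (H x)) \<in> Range (T2min \<alpha>)"
          using \<alpha> s_simps(1) by (intro test_function_in_Range_T2min) auto
      qed (use s in auto)
      have "K = scale_L2 (c 0) U + scale_L2 0 V + scale_L2 0 W"
        unfolding comb(1) k(1) using comb(2)[of "c 0" 0 0] k(2,3) by (simp add: abs_L2_eq_iff s_simps)
      then have "K = scale_L2 (c 0) U" by simp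
      then show "K \<in> L2.span {U}" by (auto simp: L2.span_singleton)
    qed
    show "L2.span {U} \<subseteq> orth_complement_L2 (Range (T2min \<alpha>))"
      unfolding T2min_def U_def
      using kernel_orthogonal_Range_adjoint[OF solutions_in_T2max(1)[OF \<alpha>]] by (intro L2.span_minimal sub) auto
  qed
  moreover have "L2.independent {U}" by (rule L2.independent_mono[OF ind]) auto
  ultimately have "deficiency0 (T2min \<alpha>) = card {U}" by (rule deficiency0_eq_card)
  then have 1: "deficiency0 (T2min \<alpha>) = 1" by simp
  have "orth_complement_L2 (Range (T2min \<alpha> O T2min \<alpha>)) = L2.span {U, V}"
  proof
    show "orth_complement_L2 (Range (T2min \<alpha> O T2min \<alpha>)) \<subseteq> L2.span {U, V}"
    proof
      fix K assume "K \<in> orth_complement_L2 (Range (T2min \<alpha> O T2min \<alpha>))"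
      then obtain k c where k: "K = abs_L2 k" "square_integrable k" "AE x in M01. k x = (\<Sum>i<2. c i * complex_of_real (s i x))"
      proof (rule orthogonal_imp_lincomb)
        fix H assume H: "H \<in> test_functions" "\<And>i. i < 2 \<Longrightarrow> (\<integral>x. s i x * H x \<partial>M01) = 0"
        show "abs_L2 (\<lambda>x. complex_of_real (H x)) \<in> Range (T2min \<alpha> O T2min \<alpha>)"
          using H(2)[of 0] H(2)[of 1] by (intro test_function_in_Range_T2min_square[OF \<alpha> H(1)]) (simp_all add: s_simps[unfolded One_nat_def])
      qed (use s in auto)
      have "K = scale_L2 (c 0) U + scale_L2 (c 1) V + scale_L2 0 W"
        unfolding comb(1) k(1) using comb(2)[of "c 0" "c 1" 0] k(2,3)
        by (simp add: abs_L2_eq_iff numeral_2_eq_2 s_simps[unfolded One_nat_def] u2_sol_real)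
      then have "K = scale_L2 (c 0) U + scale_L2 (c 1) V" by simp
      also have "\<dots> \<in> L2.span {U, V}" by (intro L2.span_add L2.span_scale L2.span_base) auto
      finally show "K \<in> L2.span {U, V}" .
    qed
    have "U \<in> orth_complement_L2 (Range (T2min \<alpha> O T2min \<alpha>))" "V \<in> orth_complement_L2 (Range (T2min \<alpha> O T2min \<alpha>))"
    proof -
      have "(0, 0) \<in> T2max \<alpha>"
        using log_power_in_T2max[of 0 0 0 0 0 \<alpha>] square_integrable_zero by (simp add: log_power_0[abs_def] zero_L2_abs)
      then show "U \<in> orth_complement_L2 (Range (T2min \<alpha> O T2min \<alpha>))" "V \<in> orth_complement_L2 (Range (T2min \<alpha> O T2min \<alpha>))"
        unfolding T2min_def U_def V_def
        using solutions_in_T2max[OF \<alpha>] by (blast intro: iterated_kernel_orthogonal_Range_adjoint_square)+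
    qed
    then show "L2.span {U, V} \<subseteq> orth_complement_L2 (Range (T2min \<alpha> O T2min \<alpha>))"
      by (intro L2.span_minimal sub) auto
  qed
  moreover have "L2.independent {U, V}" by (rule L2.independent_mono[OF ind]) auto
  ultimately have "deficiency0 (T2min \<alpha> O T2min \<alpha>) = card {U, V}" by (rule deficiency0_eq_card)
  then have 2: "deficiency0 (T2min \<alpha> O T2min \<alpha>) = 2" using ne by simp
  have "orth_complement_L2 (Range (T4min \<alpha>)) = L2.span {U, V, W}"
  proof
    show "orth_complement_L2 (Range (T4min \<alpha>)) \<subseteq> L2.span {U, V, W}"
    proof
      fix K assume "K \<in> orth_complement_L2 (Range (T4min \<alpha>))"
      then obtain k c where k: "K = abs_L2 k" "square_integrable k" "AE x in M01. k x = (\<Sum>i<4. c i * complex_of_real (s i x))"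
      proof (rule orthogonal_imp_lincomb)
        fix H assume H: "H \<in> test_functions" "\<And>i. i < 4 \<Longrightarrow> (\<integral>x. s i x * H x \<partial>M01) = 0"
        show "abs_L2 (\<lambda>x. complex_of_real (H x)) \<in> Range (T4min \<alpha>)"
          using H(2)[of 0] H(2)[of 1] H(2)[of 2] H(2)[of 3] 
          by (intro test_function_in_Range_T4min[OF \<alpha>(1) H(1)]) (simp_all add: s_simps[unfolded One_nat_def])
      qed (use s in auto)
      have "(\<Sum>i<4. c i * complex_of_real (s i x)) = c 0 * complex_of_real (u_sol \<alpha> x) + c 1 * u2_sol \<alpha> x + c 2 * u3_sol \<alpha> x 
          + c 3 * complex_of_real (w_sol \<alpha> x)" for x
      proof -
        have "{..<4} = {0, 1, 2, 3::nat}" by auto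
        then show ?thesis by (simp add: s_simps[unfolded One_nat_def] u2_sol_real u3_sol_real)
      qed
      with k(3) have ae: "AE x in M01. k x = c 0 * complex_of_real (u_sol \<alpha> x) + c 1 * u2_sol \<alpha> x + c 2 * u3_sol \<alpha> x 
          + c 3 * complex_of_real (w_sol \<alpha> x)" by simp
      note sqc = comb(2)[of "c 0" "c 1" "c 2"]
      have "c 3 = 0"
      proof (rule ccontr)
        assume c3: "c 3 \<noteq> 0"
        \<comment> \<open>All other terms of the relation are square integrable, hence so would be \<open>w\<close>.\<close>
        let ?d = "\<lambda>x. (1 / c 3) * (k x + - (c 0 * complex_of_real (u_sol \<alpha> x) + c 1 * u2_sol \<alpha> x + c 2 * u3_sol \<alpha> x))"
        have "square_integrable ?d"
          by (intro square_integrable_scale square_integrable_add k(2) square_integrable_minus sqc)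
        moreover have "(\<lambda>x. complex_of_real (w_sol \<alpha> x)) \<in> borel_measurable M01"
          unfolding log_power_w_sol[symmetric] by (rule measurable_log_power)
        moreover have "AE x in M01. ?d x = complex_of_real (w_sol \<alpha> x)"
          using ae by (rule eventually_mono) (use c3 in simp)
        ultimately have "square_integrable (\<lambda>x. complex_of_real (w_sol \<alpha> x))"
          by (rule square_integrable_cong_AE)
        then show False using w_sol_not_square_integrable[OF \<alpha>(1)] by blast
      qed
      then have "K = scale_L2 (c 0) U + scale_L2 (c 1) V + scale_L2 (c 2) W"
        unfolding comb(1) k(1) using sqc k(2) ae by (simp add: abs_L2_eq_iff)
      also have "\<dots> \<in> L2.span {U, V, W}" by (intro L2.span_add L2.span_scale L2.span_base) auto
      finally show "K \<in> L2.span {U, V, W}" .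
    qed
    show "L2.span {U, V, W} \<subseteq> orth_complement_L2 (Range (T4min \<alpha>))"
      unfolding T4min_def U_def V_def W_def
      using solutions_in_T4max[OF \<alpha>, THEN kernel_orthogonal_Range_adjoint] by (intro L2.span_minimal sub) auto
  qed
  then have "deficiency0 (T4min \<alpha>) = card {U, V, W}" using ind by (rule deficiency0_eq_card)
  then have 3: "deficiency0 (T4min \<alpha>) = 3" using ne by simp
  from 1 2 3 show ?thesis by simp
qed

end
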